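(* Let $\mathcal X\neq\{0\}$ and $\mathcal Y\neq\{0\}$ be reflexive real Banach spaces, let $\boldsymbol{\mathcal X}=\mathcal X\times\mathcal Y^*$ be normed by $(x,y^* )\mapsto\sqrt{\|x\|^2+\|y^*\|^2}$, with dual $\boldsymbol{\mathcal X}^*=\mathcal X^*\times\mathcal Y$ normed by $(x^*,y)\mapsto\sqrt{\|x^*\|^2+\|y\|^2}$. Let $A\colon\mathcal X\to2^{\mathcal X^*}$ and $B\colon\mathcal Y\to2^{\mathcal Y^*}$ be maximally monotone, let $L\colon\mathcal X\to\mathcal Y$ be linear and bounded, and let $$\boldsymbol Z=\{(x,y^* )\in\boldsymbol{\mathcal X}\mid -L^*y^*\in Ax\ \text{and}\ Lx\in B^{-1}y^*\}.$$ Let $f\colon\mathcal X\to]-\infty,+\infty]$ and $g\colon\mathcal Y\to]-\infty,+\infty]$ be Legendre functions, set $\boldsymbol f\colon\boldsymbol{\mathcal X}\to]-\infty,+\infty]\colon(x,y^* )\mapsto f(x)+g^*(y^* )$, let $x_0\in\operatorname{int}\operatorname{dom}f$ and $y_0^*\in\operatorname{int}\operatorname{dom}g^*$, suppose that $\boldsymbol Z\cap\operatorname{int}\operatorname{dom}\boldsymbol f\neq\varnothing$, and let $(\overline x,\overline y^* )=P^{\boldsymbol f}_{\boldsymbol Z}(x_0,y_0^* )$ be the Bregman projection of $(x_0,y_0^* )$ onto $\boldsymbol Z$. Let $h\in\Gamma_0(\mathcal X)$ and $j\in\Gamma_0(\mathcal Y)$ be Legendre functions such that $\operatorname{int}\operatorname{dom}f\subset\operatorname{int}\operatorname{dom}h$,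 $L(\operatorname{int}\operatorname{dom}f)\subset\operatorname{int}\operatorname{dom}j$, and there exist $\varepsilon,\delta\in]0,+\infty[$ such that $\nabla h+\varepsilon A$ and $\nabla j+\delta B$ are coercive. Let $\sigma\in[\max\{\varepsilon,\delta\},+\infty[$ and iterate, for $n=0,1,2,\dots$: - choose $(\gamma_n,\mu_n)\in[\varepsilon,\sigma]\times[\delta,\sigma]$; - $a_n=(\nabla h+\gamma_nA)^{-1}\big(\nabla h(x_n)-\gamma_nL^*y_n^*\big)$; - $a_n^*=\gamma_n^{-1}\big(\nabla h(x_n)-\nabla h(a_n)\big)-L^*y_n^*$; - $b_n=(\nabla j+\mu_nB)^{-1}\big(\nabla j(Lx_n)+\mu_ny_n^*\big)$; - $b_n^*=\mu_n^{-1}\big(\nabla j(Lx_n)-\nabla j(b_n)\big)+y_n^*$; - $\boldsymbol H_n=\{(x,y^* )\in\boldsymbol{\mathcal X}\mid\langle x,a_n^*+L^*b_n^*\rangle+\langle b_n-La_n,y^*\rangle\le\langle a_n,a_n^*\rangle+\langle b_n,b_n^*\rangle\}$; - $(x_{n+1/2},y^*_{n+1/2})=P^{\boldsymbol f}_{\boldsymbol H_n}(x_n,y_n^* )$; - $(x_{n+1},y_{n+1}^* )=Q^{\boldsymbol f}\big((x_0,y_0^* ),(x_n,y_n^* ),(x_{n+1/2},y_{n+1/2}^* )\big)$. Then the following hold. (i) For every $n\in\mathbb N$, the following are equivalent: (a) $(x_n,y_n^* )=(\overline x,\overline y^* )$; (b) $(x_n,y_n^* )\in\boldsymbol Z$;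 (c) $(x_n,y_n^* )\in\boldsymbol H_n$; (d) $x_n=a_n$ and $y_n^*=b_n^*$; (e) $La_n=b_n$ and $a_n^*=-L^*b_n^*$; (f) $\boldsymbol H_n=\boldsymbol{\mathcal X}$; (g) $(x_{n+1/2},y_{n+1/2}^* )=(x_n,y_n^* )$; (h) $(x_{n+1},y_{n+1}^* )=(x_n,y_n^* )$. (ii) $\sum_{n\in\mathbb N}D^f(x_{n+1},x_n)<+\infty$ and $\sum_{n\in\mathbb N}D^{g^*}(y_{n+1}^*,y_n^* )<+\infty$. (iii) $\sum_{n\in\mathbb N}D^f(x_{n+1/2},x_n)<+\infty$ and $\sum_{n\in\mathbb N}D^{g^*}(y_{n+1/2}^*,y_n^* )<+\infty$. (iv) Suppose that each function $k\in\{f,g^*,h,j\}$ satisfies the following condition: for every sequence $(u_n)_{n\in\mathbb N}$ in $\operatorname{int}\operatorname{dom}k$ and every bounded sequence $(v_n)_{n\in\mathbb N}$ in $\operatorname{int}\operatorname{dom}k$, $D^k(u_n,v_n)\to0$ implies $u_n-v_n\to0$. Suppose moreover that $\nabla h$ and $\nabla j$ are uniformly continuous on every bounded subset of $\operatorname{int}\operatorname{dom}h$ and $\operatorname{int}\operatorname{dom}j$, respectively. Then $x_n\to\overline x$ and $y_n^*\to\overline y^*$ (strong convergence).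
   Context: $\langle\cdot,\cdot\rangle$ is the duality pairing between a space and its dual; on the product, $\langle(x,y^* ),(x^*,y)\rangle=\langle x,x^*\rangle+\langle y,y^*\rangle$. $\Gamma_0(\mathcal X)$ is the class of proper lower semicontinuous convex functions from $\mathcal X$ to $]-\infty,+\infty]$; $f^*$ is the Fenchel conjugate; $\partial f$ is the convex subdifferential; $\operatorname{dom}M=\{x\mid Mx\neq\varnothing\}$ for a set-valued operator $M$. Legendre function: $f\in\Gamma_0(\mathcal X)$ is Legendre if it is essentially smooth ($\partial f$ is both locally bounded and single-valued on its domain) and essentially strictly convex ($\partial f^*$ is locally bounded on its domain and $f$ is strictly convex on every convex subset of $\operatorname{dom}\partial f$). Such an $f$ is Gâteaux differentiable on $\operatorname{int}\operatorname{dom}f\neq\varnothing$, and $\nabla f$ is regarded as an operator with domain $\operatorname{int}\operatorname{dom}f$. Bregman distance: $D^f(x,y)=f(x)-f(y)-\langle x-y,\nabla f(y)\rangle$ if $y\in\operatorname{int}\operatorname{dom}f$, and $D^f(x,y)=+\infty$ otherwise. Bregman projector: for $C$ closed convex with $C\cap\operatorname{int}\operatorname{dom}f\neq\varnothing$, $P^f_C\colon\operatorname{int}\operatorname{dom}f\to C\cap\operatorname{int}\operatorname{dom}f$ maps $y$ to the unique minimizer over $x\in C$ of $D^f(x,y)$. For $\boldsymbol x,\boldsymbol y\in\operatorname{int}\operatorname{dom}\boldsymbol f$, $H^{\boldsymbol f}(\boldsymbol x,\boldsymbol y)=\{\boldsymbol z\in\boldsymbol{\mathcal X}\mid\langle\boldsymbol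 z-\boldsymbol y,\nabla\boldsymbol f(\boldsymbol x)-\nabla\boldsymbol f(\boldsymbol y)\rangle\le0\}$. For $\boldsymbol x_0,\boldsymbol x,\boldsymbol y\in\operatorname{int}\operatorname{dom}\boldsymbol f$ such that $H^{\boldsymbol f}(\boldsymbol x_0,\boldsymbol x)\cap H^{\boldsymbol f}(\boldsymbol x,\boldsymbol y)\cap\operatorname{int}\operatorname{dom}\boldsymbol f\neq\varnothing$, $Q^{\boldsymbol f}(\boldsymbol x_0,\boldsymbol x,\boldsymbol y)=P^{\boldsymbol f}_{H^{\boldsymbol f}(\boldsymbol x_0,\boldsymbol x)\cap H^{\boldsymbol f}(\boldsymbol x,\boldsymbol y)}\boldsymbol x_0$. Coercive operator: $M\colon\mathcal X\to2^{\mathcal X^*}$ is coercive if there exists $z\in\operatorname{dom}M$ such that $\lim_{\|x\|\to+\infty}\inf_{x^*\in Mx}\langle x-z,x^*\rangle/\|x\|=+\infty$ (with $\inf\varnothing=+\infty$). $a=(\nabla h+\gamma A)^{-1}(u)$ means that $a$ is the unique point such that $a\in\operatorname{int}\operatorname{dom}h$ and $u\in\nabla h(a)+\gamma Aa$; similarly for $(\nabla j+\mu B)^{-1}$. *)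

theory Defs
  imports "HOL-Analysis.Analysis"
begin

text \<open>
  The topological dual of a real normed space \<open>'a\<close> is the normed space of bounded linear
  functionals, and the duality pairing of \<open>x\<close> and \<open>\<phi>\<close> is \<open>\<phi> x\<close>.
  For a function \<open>f\<close> on a space \<open>'a\<close>, subgradients and gradients are elements of the dual of
  \<open>'a\<close>. In particular, for the conjugate of a function on a reflexive space, they are elements of
  the bidual; the identification of the bidual with the space itself is not carried out, since
  only pairings with elements of the dual and norms of such (sub)gradients are needed. The same
  applies to the dual of a product space.
\<close>

type_synonym 'a dual = "'a \<Rightarrow>\<^sub>L real"

definition bidual_embed :: "'a::real_normed_vector \<Rightarrow> 'a dual dual" where
  "bidual_embed x = Blinfun (\<lambda>\<phi>. blinfun_apply \<phi> x)"

lemma bidual_embed_apply [simp]: "blinfun_apply (bidual_embed x) \<phi> = blinfun_apply \<phi> x"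
  unfolding bidual_embed_def
  by (subst bounded_linear_Blinfun_apply) (auto intro: bounded_linear_intros)

definition reflexive_space :: "'a::real_normed_vector itself \<Rightarrow> bool" where
  "reflexive_space _ \<longleftrightarrow> surj (bidual_embed :: 'a \<Rightarrow> 'a dual dual)"

definition adjoint_op ::
  "('a::real_normed_vector \<Rightarrow>\<^sub>L 'b::real_normed_vector) \<Rightarrow> 'b dual \<Rightarrow> 'a dual" where
  "adjoint_op L \<psi> = \<psi> o\<^sub>L L"


section \<open>Extended-real-valued convex functions\<close>

definition edom :: "('a \<Rightarrow> ereal) \<Rightarrow> 'a set" where
  "edom f = {x. f x < \<infinity>}"

definition proper_fun :: "('a \<Rightarrow> ereal) \<Rightarrow> bool" where
  "proper_fun f \<longleftrightarrow> (\<forall>x. f x \<noteq> -\<infinity>) \<and> edom f \<noteq> {}"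

definition lsc_fun :: "('a::topological_space \<Rightarrow> ereal) \<Rightarrow> bool" where
  "lsc_fun f \<longleftrightarrow> (\<forall>x. f x \<le> Liminf (at x) f)"

definition convex_fun :: "('a::real_vector \<Rightarrow> ereal) \<Rightarrow> bool" where
  "convex_fun f \<longleftrightarrow>
    (\<forall>x y. \<forall>t\<in>{0<..<1::real}.
      f (t *\<^sub>R x + (1 - t) *\<^sub>R y) \<le> ereal t * f x + ereal (1 - t) * f y)"

definition Gamma0 :: "('a::real_normed_vector \<Rightarrow> ereal) set" where
  "Gamma0 = {f. proper_fun f \<and> lsc_fun f \<and> convex_fun f}"

definition conjugate :: "('a::real_normed_vector \<Rightarrow> ereal) \<Rightarrow> 'a dual \<Rightarrow> ereal" where
  "conjugate f \<phi> = (SUP x. ereal (blinfun_apply \<phi> x) - f x)"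


section \<open>Set-valued operators\<close>

definition op_dom :: "('a \<Rightarrow> 'b set) \<Rightarrow> 'a set" where
  "op_dom M = {x. M x \<noteq> {}}"

definition op_inverse :: "('a \<Rightarrow> 'b set) \<Rightarrow> 'b \<Rightarrow> 'a set" where
  "op_inverse M y = {x. y \<in> M x}"

definition monotone_op :: "('a::real_normed_vector \<Rightarrow> 'a dual set) \<Rightarrow> bool" where
  "monotone_op M \<longleftrightarrow>
    (\<forall>x y. \<forall>\<phi>\<in>M x. \<forall>\<psi>\<in>M y. 0 \<le> blinfun_apply (\<phi> - \<psi>) (x - y))"

definition maximally_monotone :: "('a::real_normed_vector \<Rightarrow> 'a dual set) \<Rightarrow> bool" where
  "maximally_monotone M \<longleftrightarrow>
    monotone_op M \<and> (\<forall>N. monotone_op N \<longrightarrow> (\<forall>x. M x \<subseteq> N x) \<longrightarrow> N = M)"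

definition locally_bounded_on_dom ::
  "('a::metric_space \<Rightarrow> 'b::metric_space set) \<Rightarrow> bool" where
  "locally_bounded_on_dom M \<longleftrightarrow>
    (\<forall>x\<in>op_dom M. \<exists>U. open U \<and> x \<in> U \<and> bounded (\<Union>y\<in>U. M y))"

definition single_valued_on_dom :: "('a \<Rightarrow> 'b set) \<Rightarrow> bool" where
  "single_valued_on_dom M \<longleftrightarrow> (\<forall>x\<in>op_dom M. \<exists>\<phi>. M x = {\<phi>})"

text \<open>In the complete lattice of extended reals the infimum of the empty set is \<open>\<infinity>\<close>.\<close>

definition coercive_op :: "('a::real_normed_vector \<Rightarrow> 'a dual set) \<Rightarrow> bool" where
  "coercive_op M \<longleftrightarrow>
    (\<exists>z\<in>op_dom M.
      ((\<lambda>x. INF \<phi>\<in>M x. ereal (blinfun_apply \<phi> (x - z) / norm x)) \<longlongrightarrow> \<infinity>) at_infinity)"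


section \<open>Subdifferentials, gradients and Legendre functions\<close>

definition subdifferential ::
  "('a::real_normed_vector \<Rightarrow> ereal) \<Rightarrow> 'a \<Rightarrow> 'a dual set" where
  "subdifferential f x = {\<phi>. \<forall>y. ereal (blinfun_apply \<phi> (y - x)) + f x \<le> f y}"

definition strictly_convex_fun_on ::
  "'a::real_vector set \<Rightarrow> ('a \<Rightarrow> ereal) \<Rightarrow> bool" where
  "strictly_convex_fun_on S f \<longleftrightarrow>
    (\<forall>x\<in>S. \<forall>y\<in>S. x \<noteq> y \<longrightarrow> (\<forall>t\<in>{0<..<1::real}.
      f (t *\<^sub>R x + (1 - t) *\<^sub>R y) < ereal t * f x + ereal (1 - t) * f y))"

definition essentially_smooth :: "('a::real_normed_vector \<Rightarrow> ereal) \<Rightarrow> bool" where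
  "essentially_smooth f \<longleftrightarrow>
    locally_bounded_on_dom (subdifferential f) \<and> single_valued_on_dom (subdifferential f)"

definition essentially_strictly_convex :: "('a::real_normed_vector \<Rightarrow> ereal) \<Rightarrow> bool" where
  "essentially_strictly_convex f \<longleftrightarrow>
    locally_bounded_on_dom (subdifferential (conjugate f)) \<and>
    (\<forall>S. convex S \<and> S \<subseteq> op_dom (subdifferential f) \<longrightarrow> strictly_convex_fun_on S f)"

definition legendre :: "('a::real_normed_vector \<Rightarrow> ereal) \<Rightarrow> bool" where
  "legendre f \<longleftrightarrow> f \<in> Gamma0 \<and> essentially_smooth f \<and> essentially_strictly_convex f"

text \<open>
  The Gateaux gradient. It is only used at interior points of the domain of a proper function;
  there \<open>f\<close> is finite near \<open>x\<close>, so that passing to real values is harmless.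
\<close>

definition gradient :: "('a::real_normed_vector \<Rightarrow> ereal) \<Rightarrow> 'a \<Rightarrow> 'a dual" where
  "gradient f x = (THE \<phi>. \<forall>v.
    ((\<lambda>t. (real_of_ereal (f (x + t *\<^sub>R v)) - real_of_ereal (f x)) / t)
      \<longlongrightarrow> blinfun_apply \<phi> v) (at 0))"

definition gradient_plus ::
  "('a::real_normed_vector \<Rightarrow> ereal) \<Rightarrow> real \<Rightarrow> ('a \<Rightarrow> 'a dual set) \<Rightarrow> 'a \<Rightarrow> 'a dual set" where
  "gradient_plus h c M x =
    (if x \<in> interior (edom h) then {gradient h x + c *\<^sub>R \<phi> |\<phi>. \<phi> \<in> M x} else {})"

text \<open>The operator \<open>(\<nabla>h + c M)\<^sup>-\<^sup>1\<close>, at points where it is single-valued.\<close>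

definition gradient_plus_inv ::
  "('a::real_normed_vector \<Rightarrow> ereal) \<Rightarrow> real \<Rightarrow> ('a \<Rightarrow> 'a dual set) \<Rightarrow> 'a dual \<Rightarrow> 'a" where
  "gradient_plus_inv h c M u = (THE a. u \<in> gradient_plus h c M a)"


section \<open>Bregman distances and projections\<close>

definition bregman_dist ::
  "('a::real_normed_vector \<Rightarrow> ereal) \<Rightarrow> 'a \<Rightarrow> 'a \<Rightarrow> ereal" where
  "bregman_dist f x y =
    (if y \<in> interior (edom f) then f x - f y - ereal (blinfun_apply (gradient f y) (x - y))
     else \<infinity>)"

definition bregman_proj ::
  "('a::real_normed_vector \<Rightarrow> ereal) \<Rightarrow> 'a set \<Rightarrow> 'a \<Rightarrow> 'a" where
  "bregman_proj f C y = (THE x. is_arg_min (\<lambda>x. bregman_dist f x y) (\<lambda>x. x \<in> C) x)"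

definition bregman_halfspace ::
  "('a::real_normed_vector \<Rightarrow> ereal) \<Rightarrow> 'a \<Rightarrow> 'a \<Rightarrow> 'a set" where
  "bregman_halfspace f x y =
    {z. blinfun_apply (gradient f x - gradient f y) (z - y) \<le> 0}"

definition bregman_Q ::
  "('a::real_normed_vector \<Rightarrow> ereal) \<Rightarrow> 'a \<Rightarrow> 'a \<Rightarrow> 'a \<Rightarrow> 'a" where
  "bregman_Q f x0 x y =
    bregman_proj f (bregman_halfspace f x0 x \<inter> bregman_halfspace f x y) x0"

definition bregman_dist_controls :: "('a::real_normed_vector \<Rightarrow> ereal) \<Rightarrow> bool" where
  "bregman_dist_controls k \<longleftrightarrow>
    (\<forall>u v :: nat \<Rightarrow> 'a. range u \<subseteq> interior (edom k) \<longrightarrow>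
      range v \<subseteq> interior (edom k) \<longrightarrow> bounded (range v) \<longrightarrow>
      (\<lambda>n. bregman_dist k (u n) (v n)) \<longlonglongrightarrow> 0 \<longrightarrow> (\<lambda>n. u n - v n) \<longlonglongrightarrow> 0)"


section \<open>Kuhn--Tucker sets\<close>

definition kuhn_tucker_set ::
  "('a::real_normed_vector \<Rightarrow> 'a dual set) \<Rightarrow> ('b::real_normed_vector \<Rightarrow> 'b dual set) \<Rightarrow>
    ('a \<Rightarrow>\<^sub>L 'b) \<Rightarrow> ('a \<times> 'b dual) set" where
  "kuhn_tucker_set A B L =
    {(x, y'). - adjoint_op L y' \<in> A x \<and> blinfun_apply L x \<in> op_inverse B y'}"

end

theory Submission
  imports Defs
begin

text \<open>
  Each point of the graphs of \<open>A\<close> and \<open>B\<close> cuts out a half-space containing the Kuhn--Tucker set \<open>Z\<close>,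
  and \<open>Z\<close> is the intersection of all of them; \<open>H n\<close> is the one given by \<open>(a n, a' n)\<close> and
  \<open>(b n, b' n)\<close>. The violation of its inequality at \<open>(x n, y n)\<close> is a sum of two terms of the form
  \<open>\<langle>u - v, \<nabla>h u - \<nabla>h v\<rangle>\<close>, which gives (i). For (ii) and (iii), \<open>Z\<close> stays in the half-spaces of
  Haugazeau's scheme, so \<open>D (w n) (w 0)\<close> increases to at most \<open>D zbar (w 0)\<close> and its increments
  dominate the summands. For (iv), the vanishing violation forces weak cluster points into \<open>Z\<close>, hence
  \<open>D (w n) (w 0)\<close> tends to \<open>D zbar (w 0)\<close> and \<open>D zbar (w n)\<close> tends to \<open>0\<close>.

  The convex analysis rests on one separation result, the sandwich theorem for epigraphs. No weak
  topology is needed: in a reflexive space a minimizer is a subgradient of the conjugate at \<open>0\<close>, and a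
  weak cluster point is a linear functional below \<open>\<phi> \<mapsto> limsup \<phi> (w n)\<close>. The resolvents are defined
  everywhere because the Fitzpatrick function of \<open>A\<close> can be separated from
  \<open>(x, \<phi>) \<mapsto> - k x - k\<^sup>* (- \<phi>)\<close>, where \<open>k\<close> is \<open>h\<close>, tilted and restricted to a large ball.
\<close>

section \<open>Hahn--Banach and separation of epigraphs\<close>

text \<open>The definitions of \<open>a'\<close> and \<open>b'\<close> make
  \<open>a' n + adjoint_op L (y n)\<close> and \<open>b' n - y n\<close> scaled differences of
  gradients; hence the two terms of the violation. Each is a scaled symmetrized Bregman distance, so
  in (iv) its decay turns into norm convergence of the resolvent steps. One cluster point controls
  the whole sequence: \<open>D (w n) (w 0)\<close> is monotone, so its limit can be compared with
  the distance of the cluster point without passing to subsequences. The ball in the construction of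
  the resolvents keeps the conjugate of \<open>k\<close> bounded on bounded sets, which provides the
  interior that separation requires. The coercivity estimate afterwards places the solution strictly
  inside the ball, so the constraint disappears. The gradients of \<open>conjugate g\<close> live in
  the bidual. To avoid identifying spaces, \<open>F\<close> is not shown to be Legendre; the
  properties collected in \<open>bregman_fun\<close> are proved for both summands and carried over
  to the sum.\<close>

definition sublinear :: "('a::real_vector \<Rightarrow> real) \<Rightarrow> bool" where
  "sublinear p \<longleftrightarrow>
    (\<forall>u v. p (u + v) \<le> p u + p v) \<and> (\<forall>t u. 0 \<le> t \<longrightarrow> p (t *\<^sub>R u) = t * p u)"

lemma sublinear_add: "sublinear p \<Longrightarrow> p (u + v) \<le> p u + p v"
  and sublinear_scale: "sublinear p \<Longrightarrow> 0 \<le> t \<Longrightarrow> p (t *\<^sub>R u) = t * p u"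
  by (auto simp: sublinear_def)

lemma sublinear_zero: "sublinear p \<Longrightarrow> p 0 = 0"
  using sublinear_scale[of p 0 0] by simp

lemma sublinear_minus_le: "sublinear p \<Longrightarrow> - p (- u) \<le> p u"
  using sublinear_add[of p u "- u"] sublinear_zero[of p] by simp

text \<open>A minimal sublinear functional \<open>q\<close> is additive: it cannot lie strictly above the
  sublinear functional \<open>u \<mapsto> inf\<^sub>t\<^sub>\<ge>\<^sub>0 (q (u + t v) - t q v)\<close>.\<close>

lemma minimal_sublinear_additive:
  assumes q: "sublinear q"
    and min: "\<And>r. sublinear r \<Longrightarrow> (\<And>u. r u \<le> q u) \<Longrightarrow> r = q"
  shows "q (u + v) = q u + q v"
proof -
  define r where "r u = (INF t\<in>{0..}. q (u + t *\<^sub>R v) - t * q v)" for u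
  \<comment> \<open>Independent of \<open>t\<close>, hence the infimum is finite.\<close>
  have lower: "- q (- u) \<le> q (u + t *\<^sub>R v) - t * q v" if "0 \<le> t" for u t
    using sublinear_add[OF q, of "u + t *\<^sub>R v" "- u"] sublinear_scale[OF q that, of v] by simp
  have bdd: "bdd_below ((\<lambda>t. q (u + t *\<^sub>R v) - t * q v) ` {0..})" for u
    by (rule bdd_belowI2[where m="- q (- u)"]) (use lower in auto)
  have r_le: "r u \<le> q (u + t *\<^sub>R v) - t * q v" if "0 \<le> t" for u t
    unfolding r_def by (rule cINF_lower[OF bdd]) (use that in auto)
  have r_ge: "m \<le> r u" if "\<And>t. 0 \<le> t \<Longrightarrow> m \<le> q (u + t *\<^sub>R v) - t * q v" for u m
    unfolding r_def by (rule cINF_greatest) (use that in auto)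
  have "sublinear r"
    unfolding sublinear_def
  proof (intro conjI allI impI)
    fix u w
    \<comment> \<open>The parameters \<open>s\<close> for \<open>u\<close> and \<open>t\<close> for
      \<open>w\<close> combine to \<open>s + t\<close> for \<open>u + w\<close>, which decouples the
      two infima.\<close>
    have "r (u + w) - (q (w + t *\<^sub>R v) - t * q v) \<le> q (u + s *\<^sub>R v) - s * q v"
      if "0 \<le> s" "0 \<le> t" for s t
    proof -
      have "r (u + w) \<le> q (u + w + (s + t) *\<^sub>R v) - (s + t) * q v"
        using that by (intro r_le) auto
      also have "u + w + (s + t) *\<^sub>R v = (u + s *\<^sub>R v) + (w + t *\<^sub>R v)"
        by (simp add: algebra_simps)
      finally show ?thesis
        using sublinear_add[OF q, of "u + s *\<^sub>R v" "w + t *\<^sub>R v"] by (simp add: algebra_simps)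
    qed
    then have "r (u + w) - (q (w + t *\<^sub>R v) - t * q v) \<le> r u" if "0 \<le> t" for t
      using that by (intro r_ge) auto
    then have "r (u + w) - r u \<le> q (w + t *\<^sub>R v) - t * q v" if "0 \<le> t" for t
      using that by (simp add: algebra_simps)
    then have "r (u + w) - r u \<le> r w"
      by (rule r_ge)
    then show "r (u + w) \<le> r u + r w" by simp
  next
    fix s :: real and u
    assume s: "0 \<le> s"
    show "r (s *\<^sub>R u) = s * r u"
    proof (cases "s = 0")
      case True
      have "r 0 \<le> 0"
        using r_le[of 0 0] sublinear_zero[OF q] by simp
      moreover have "0 \<le> r 0"
        by (rule r_ge) (use sublinear_scale[OF q] in simp)
      ultimately show ?thesis using True by simp
    next
      case False
      then have s: "0 < s" using s by simp
      have le: "r (s *\<^sub>R u) \<le> s * r u" if s: "0 < s" for s u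
      proof -
        have "r (s *\<^sub>R u) / s \<le> q (u + t *\<^sub>R v) - t * q v" if "0 \<le> t" for t
        proof -
          have "r (s *\<^sub>R u) \<le> q (s *\<^sub>R u + (s * t) *\<^sub>R v) - (s * t) * q v"
            by (rule r_le) (use s that in auto)
          also have "s *\<^sub>R u + (s * t) *\<^sub>R v = s *\<^sub>R (u + t *\<^sub>R v)"
            by (simp add: algebra_simps)
          also have "q (s *\<^sub>R (u + t *\<^sub>R v)) = s * q (u + t *\<^sub>R v)"
            by (rule sublinear_scale[OF q]) (use s in auto)
          finally show ?thesis using s by (simp add: field_simps)
        qed
        then have "r (s *\<^sub>R u) / s \<le> r u" by (rule r_ge)
        then show ?thesis using s by (simp add: field_simps)
      qed
      have "r u \<le> inverse s * r (s *\<^sub>R u)"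
        using le[of "inverse s" "s *\<^sub>R u"] s by simp
      then have "s * r u \<le> r (s *\<^sub>R u)"
        using s by (simp add: field_simps)
      with le[OF s, of u] show ?thesis by simp
    qed
  qed
  moreover have "r u \<le> q u" for u
    using r_le[of 0 u] by simp
  ultimately have "r = q" by (rule min)
  \<comment> \<open>The parameter \<open>t = 1\<close> in the infimum gives superadditivity.\<close>
  then have "q u \<le> q (u + v) - q v"
    using r_le[of 1 u] by simp
  with sublinear_add[OF q, of u v] show ?thesis by simp
qed

text \<open>Zorn's lemma is applied to the sublinear functionals below \<open>p\<close> rather than
  to partial linear extensions: a minimal one is additive, hence linear. The pointwise infimum of a
  chain is finite because \<open>- p (- u)\<close> lies below every member.\<close>

theorem hahn_banach_sublinear:
  fixes p :: "'a::real_vector \<Rightarrow> real"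
  assumes p: "sublinear p"
  obtains l where "linear l" "\<And>u. l u \<le> p u"
proof -
  define Q where "Q = {q. sublinear q \<and> (\<forall>u. q u \<le> p u)}"
  \<comment> \<open>The order is reversed, so that a maximal element for Zorn's lemma is a minimal
    functional.\<close>
  define R where "R q r \<longleftrightarrow> (\<forall>u. r u \<le> q u)" for q r :: "'a \<Rightarrow> real"
  have po: "partial_order_on Q (relation_of R Q)"
    by (rule partial_order_on_relation_ofI) (auto simp: R_def fun_eq_iff intro: order_trans antisym)
  have "\<exists>u\<in>Q. \<forall>a\<in>C. R a u" if C: "C \<in> Chains (relation_of R Q)" for C
  proof (cases "C = {}")
    case True
    with p show ?thesis by (auto simp: Q_def)
  next
    case False
    have CQ: "C \<subseteq> Q" and chain: "\<And>q r. q \<in> C \<Longrightarrow> r \<in> C \<Longrightarrow> R q r \<or> R r q"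
      using C by (auto simp: Chains_def relation_of_def)
    define m where "m u = (INF q\<in>C. q u)" for u
    have lower: "- p (- u) \<le> q u" if "q \<in> C" for q u
    proof -
      have "sublinear q" "q (- u) \<le> p (- u)"
        using that CQ by (auto simp: Q_def)
      with sublinear_minus_le[of q u] show ?thesis by simp
    qed
    have m_le: "m u \<le> q u" if "q \<in> C" for q u
      unfolding m_def by (rule cINF_lower) (use that lower in \<open>auto intro!: bdd_belowI2\<close>)
    have m_ge: "c \<le> m u" if "\<And>q. q \<in> C \<Longrightarrow> c \<le> q u" for c u
      unfolding m_def by (rule cINF_greatest) (use that False in auto)
    have "sublinear m"
      unfolding sublinear_def
    proof (intro conjI allI impI)
      fix u v
      \<comment> \<open>The two infima run over different members \<open>q\<close> and
        \<open>r\<close> of the chain; the smaller of them serves for both.\<close>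
      have "m (u + v) - q u \<le> r v" if "q \<in> C" "r \<in> C" for q r
      proof -
        obtain s where "s \<in> C" "\<And>u. s u \<le> q u" "\<And>u. s u \<le> r u"
          using chain[of q r] \<open>q \<in> C\<close> \<open>r \<in> C\<close> by (auto simp: R_def)
        moreover have "sublinear s" using \<open>s \<in> C\<close> CQ by (auto simp: Q_def)
        ultimately have "m (u + v) \<le> q u + r v"
          using m_le[of s "u + v"] sublinear_add[of s u v] by (smt (verit))
        then show ?thesis by simp
      qed
      then have "m (u + v) - q u \<le> m v" if "q \<in> C" for q
        using that by (intro m_ge) auto
      then have "m (u + v) - m v \<le> q u" if "q \<in> C" for q
        using that by (smt (verit))
      then have "m (u + v) - m v \<le> m u" by (rule m_ge)
      then show "m (u + v) \<le> m u + m v" by simp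
    next
      fix t :: real and u
      assume t: "0 \<le> t"
      have *: "q (t *\<^sub>R u) = t * q u" if "q \<in> C" for q
        by (rule sublinear_scale) (use that CQ t in \<open>auto simp: Q_def\<close>)
      show "m (t *\<^sub>R u) = t * m u"
      proof (cases "t = 0")
        case True
        have "(\<lambda>q. q 0) ` C = {0}" using * True False by (force simp: image_iff)
        then have "m 0 = 0" by (simp add: m_def)
        then show ?thesis using True by simp
      next
        case False
        then have t: "0 < t" using t by simp
        have "m (t *\<^sub>R u) / t \<le> m u"
        proof (rule m_ge)
          fix q assume "q \<in> C"
          then show "m (t *\<^sub>R u) / t \<le> q u"
            using m_le[of q "t *\<^sub>R u"] *[of q] t by (simp add: field_simps)
        qed
        moreover have "t * m u \<le> m (t *\<^sub>R u)"
        proof (rule m_ge)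
          fix q assume "q \<in> C"
          then show "t * m u \<le> q (t *\<^sub>R u)"
            using m_le[of q u] *[of q] t by simp
        qed
        ultimately show ?thesis using t by (simp add: field_simps)
      qed
    qed
    moreover have "m u \<le> p u" for u
      using False CQ m_le[of _ u] by (auto simp: Q_def intro: order_trans)
    ultimately show ?thesis
      using m_le by (auto simp: Q_def R_def)
  qed
  from predicate_Zorn[OF po this]
  obtain q where q: "q \<in> Q" and min: "\<And>r. r \<in> Q \<Longrightarrow> R q r \<Longrightarrow> r = q"
    by blast
  have sq: "sublinear q" and qp: "q u \<le> p u" for u
    using q by (auto simp: Q_def)
  have add: "q (u + v) = q u + q v" for u v
  proof (rule minimal_sublinear_additive[OF sq])
    fix r assume r: "sublinear r" "\<And>u. r u \<le> q u"
    then have "r \<in> Q" using qp by (auto simp: Q_def intro: order_trans)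
    then show "r = q" using r by (intro min) (auto simp: R_def)
  qed
  have neg: "q (- u) = - q u" for u
    using add[of u "- u"] sublinear_zero[OF sq] by simp
  have "q (t *\<^sub>R u) = t * q u" for t u
  proof (cases "0 \<le> t")
    case True
    then show ?thesis by (rule sublinear_scale[OF sq])
  next
    case False
    then have "q (- (t *\<^sub>R u)) = - t * q u"
      using sublinear_scale[OF sq, of "- t" u] by simp
    then show ?thesis using neg[of "t *\<^sub>R u"] by simp
  qed
  then have "linear q"
    using add by (intro linearI) auto
  then show ?thesis using qp that by blast
qed

lemma linear_bounded_dual:
  fixes l :: "'a::real_normed_vector \<Rightarrow> real"
  assumes l: "linear l" and K: "\<And>u. l u \<le> K * norm u"
  obtains \<phi> :: "'a dual" where "\<And>u. blinfun_apply \<phi> u = l u"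
proof -
  have "\<bar>l u\<bar> \<le> K * norm u" for u
    using K[of u] K[of "- u"] linear_neg[OF l, of u] by (simp add: abs_le_iff)
  then have "bounded_linear l"
    using l by (intro bounded_linear_intro[where K=K])
      (auto simp: linear_add linear_scale mult.commute)
  then show ?thesis
    using that[of "Blinfun l"] by (simp add: bounded_linear_Blinfun_apply)
qed

text \<open>The separating functional is a linear minorant of the directional derivative at \<open>0\<close> of
  the marginal function \<open>u \<mapsto> inf {a + b |x a b. (x + u, a) \<in> E \<and> (x, b) \<in> D}\<close>.\<close>

theorem sandwich:
  fixes E D :: "('a::real_normed_vector \<times> real) set"
  assumes E: "convex E" and D: "convex D"
    and r: "0 < r" and ball: "\<And>u. norm (u - z) < r \<Longrightarrow> (u, M) \<in> E"
    and z: "(z, \<beta>) \<in> D"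
    and nonneg: "\<And>x a b. (x, a) \<in> E \<Longrightarrow> (x, b) \<in> D \<Longrightarrow> 0 \<le> a + b"
  obtains \<phi> :: "'a dual" and c where
    "\<And>x a. (x, a) \<in> E \<Longrightarrow> blinfun_apply \<phi> x + c \<le> a"
    "\<And>x b. (x, b) \<in> D \<Longrightarrow> - blinfun_apply \<phi> x - c \<le> b"
proof -
  \<comment> \<open>The infimum of \<open>V u\<close> is the directional derivative; collecting the
    quotients of all scales \<open>t\<close> avoids an extended-valued marginal function.\<close>
  define V where "V u = {(a + b) / t |a b t w x. 0 < t \<and> (w, a) \<in> E \<and> (x, b) \<in> D \<and> w - x = t *\<^sub>R u}"
    for u
  have VI: "(a + b) / t \<in> V u" if "0 < t" "(w, a) \<in> E" "(x, b) \<in> D" "w - x = t *\<^sub>R u" for a b t w x u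
    using that unfolding V_def by blast
  have V_add: "s1 + s2 \<in> V (u1 + u2)" if s1: "s1 \<in> V u1" and s2: "s2 \<in> V u2" for s1 s2 u1 u2
  proof -
    obtain a1 b1 t1 w1 x1 where 1: "s1 = (a1 + b1) / t1" "0 < t1" "(w1, a1) \<in> E" "(x1, b1) \<in> D"
      "w1 - x1 = t1 *\<^sub>R u1" using s1 by (auto simp: V_def)
    obtain a2 b2 t2 w2 x2 where 2: "s2 = (a2 + b2) / t2" "0 < t2" "(w2, a2) \<in> E" "(x2, b2) \<in> D"
      "w2 - x2 = t2 *\<^sub>R u2" using s2 by (auto simp: V_def)
    \<comment> \<open>Weights proportional to \<open>t2\<close> and \<open>t1\<close> give both
      displacements the common scale \<open>t\<close>; then \<open>l1 / t = 1 / t1\<close> and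
      \<open>l2 / t = 1 / t2\<close> make the quotients add exactly.\<close>
    define l1 l2 t where "l1 = t2 / (t1 + t2)" and "l2 = t1 / (t1 + t2)"
      and "t = t1 * t2 / (t1 + t2)"
    have "t1 + t2 \<noteq> 0" using 1(2) 2(2) by simp
    then have "l1 + l2 = 1"
      by (simp add: l1_def l2_def add.commute flip: add_divide_distrib)
    then have l: "0 \<le> l1" "0 \<le> l2" "l1 + l2 = 1" "0 < t" "l1 * t1 = t" "l2 * t2 = t"
      using 1(2) 2(2) by (auto simp: l1_def l2_def t_def)
    have "l1 *\<^sub>R (w1, a1) + l2 *\<^sub>R (w2, a2) \<in> E"
      using E 1(3) 2(3) l by (intro convexD)
    moreover have "l1 *\<^sub>R (x1, b1) + l2 *\<^sub>R (x2, b2) \<in> D"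
      using D 1(4) 2(4) l by (intro convexD)
    moreover have "(l1 *\<^sub>R w1 + l2 *\<^sub>R w2) - (l1 *\<^sub>R x1 + l2 *\<^sub>R x2) = t *\<^sub>R (u1 + u2)"
    proof -
      have "(l1 *\<^sub>R w1 + l2 *\<^sub>R w2) - (l1 *\<^sub>R x1 + l2 *\<^sub>R x2) = l1 *\<^sub>R (w1 - x1) + l2 *\<^sub>R (w2 - x2)"
        by (simp add: algebra_simps)
      also have "\<dots> = (l1 * t1) *\<^sub>R u1 + (l2 * t2) *\<^sub>R u2"
        using 1 2 by simp
      finally show ?thesis using l by (simp add: algebra_simps)
    qed
    ultimately have "((l1 * a1 + l2 * a2) + (l1 * b1 + l2 * b2)) / t \<in> V (u1 + u2)"
      using l by (intro VI) auto
    moreover have "((l1 * a1 + l2 * a2) + (l1 * b1 + l2 * b2)) / t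
        = (a1 + b1) * (l1 / t) + (a2 + b2) * (l2 / t)"
      using l by (simp add: field_simps)
    moreover have "l1 / t = 1 / t1" "l2 / t = 1 / t2"
      using 1(2) 2(2) by (auto simp: l1_def l2_def t_def)
    ultimately show ?thesis using 1(1) 2(1) by simp
  qed
  have V_zero: "0 \<le> s" if "s \<in> V 0" for s
    using that nonneg by (auto simp: V_def intro!: divide_nonneg_pos)
  have V_scale: "k * s \<in> V (k *\<^sub>R u)" if s: "s \<in> V u" and k: "0 < k" for s u k
  proof -
    obtain a b t w x where *: "s = (a + b) / t" "0 < t" "(w, a) \<in> E" "(x, b) \<in> D"
      "w - x = t *\<^sub>R u" using s by (auto simp: V_def)
    have "(a + b) / (t / k) \<in> V (k *\<^sub>R u)"
      using * k by (intro VI) auto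
    moreover have "(a + b) / (t / k) = k * s" using * by simp
    ultimately show ?thesis by simp
  qed
  \<comment> \<open>The point \<open>z\<close> moved by \<open>r / 2\<close> in the direction of
    \<open>u\<close> stays in the ball, so \<open>(M + \<beta>) / t\<close> with
    \<open>t = r / (2 * norm u)\<close> is an admissible quotient.\<close>
  define K where "K = 2 * \<bar>M + \<beta>\<bar> / r"
  have K0: "0 \<le> K" using r by (simp add: K_def)
  have V_K: "\<exists>s\<in>V u. s \<le> K * norm u" if "u \<noteq> 0" for u
  proof -
    define t where "t = r / (2 * norm u)"
    have t: "0 < t" using that r by (simp add: t_def)
    have "norm (z + t *\<^sub>R u - z) < r"
      using that r by (simp add: t_def)
    then have "(M + \<beta>) / t \<in> V u"
      using ball z t by (intro VI[of _ "z + t *\<^sub>R u" _ z]) auto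
    moreover have "(M + \<beta>) / t \<le> \<bar>M + \<beta>\<bar> / t"
      using t by (intro divide_right_mono) auto
    moreover have "\<bar>M + \<beta>\<bar> / t = K * norm u"
      using that r by (simp add: t_def K_def field_simps)
    ultimately show ?thesis by force
  qed
  have V0: "(M + \<beta>) / 1 \<in> V 0"
    using ball[of z] r z by (intro VI[of _ z _ z]) auto
  have ne: "V u \<noteq> {}" for u
    using V0 V_K[of u] by (cases "u = 0") auto
  have lower: "- s' \<le> s" if "s \<in> V u" "s' \<in> V (- u)" for s s' u
    using V_zero[of "s + s'"] V_add[OF that] by simp
  have bdd: "bdd_below (V u)" for u
    using lower ne[of "- u"] by (metis bdd_belowI all_not_in_conv)
  define p where "p u = Inf (V u)" for u
  have p_le: "p u \<le> s" if "s \<in> V u" for s u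
    unfolding p_def using that bdd by (rule cInf_lower)
  have p_ge: "m \<le> p u" if "\<And>s. s \<in> V u \<Longrightarrow> m \<le> s" for m u
    unfolding p_def using ne that by (rule cInf_greatest)
  have p_scale: "p (k *\<^sub>R u) \<le> k * p u" if "0 < k" for k u
  proof -
    have "p (k *\<^sub>R u) / k \<le> p u"
      by (rule p_ge) (use p_le[OF V_scale[OF _ that]] that in \<open>simp add: field_simps\<close>)
    then show ?thesis using that by (simp add: field_simps)
  qed
  have p_scale': "p (k *\<^sub>R u) = k * p u" if "0 < k" for k u
    using p_scale[OF that, of u] p_scale[of "inverse k" "k *\<^sub>R u"] that
    by (simp add: field_simps)
  have p0: "p 0 = 0"
    using p_scale'[of 2 0] by simp
  have sub: "sublinear p"
    unfolding sublinear_def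
  proof (intro conjI allI impI)
    fix u v
    have "p (u + v) - s \<le> p v" if "s \<in> V u" for s
    proof (rule p_ge)
      fix s' assume "s' \<in> V v"
      from p_le[OF V_add[OF that this]] show "p (u + v) - s \<le> s'" by simp
    qed
    then have "p (u + v) - p v \<le> s" if "s \<in> V u" for s
      using that by (smt (verit))
    then have "p (u + v) - p v \<le> p u" by (rule p_ge)
    then show "p (u + v) \<le> p u + p v" by simp
  next
    fix t :: real and u
    assume "0 \<le> t"
    then show "p (t *\<^sub>R u) = t * p u"
      using p_scale'[of t u] p0 by (cases "t = 0") auto
  qed
  then obtain l where l: "linear l" "\<And>u. l u \<le> p u"
    by (rule hahn_banach_sublinear) blast
  have "l u \<le> K * norm u" for u
    using l(2)[of u] V_K[of u] p_le[of _ u] p0 by (cases "u = 0") fastforce+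
  then obtain \<phi> :: "'a dual" where \<phi>: "\<And>u. blinfun_apply \<phi> u = l u"
    by (rule linear_bounded_dual[OF l(1)]) blast
  have key: "blinfun_apply \<phi> w - a \<le> blinfun_apply \<phi> x + b" if "(w, a) \<in> E" "(x, b) \<in> D" for w a x b
  proof -
    have "(a + b) / 1 \<in> V (w - x)"
      using that by (intro VI) auto
    then have "l (w - x) \<le> a + b"
      using l(2)[of "w - x"] p_le[of "(a + b) / 1" "w - x"] by simp
    then show ?thesis
      using \<phi>[of "w - x"] by (simp add: blinfun.diff_right)
  qed
  \<comment> \<open>By \<open>key\<close> the values \<open>\<phi> w - a\<close> on \<open>E\<close>
    lie below the values \<open>\<phi> x + b\<close> on \<open>D\<close>; the supremum of the former
    fits in between.\<close>
  define c where "c = - (SUP (w, a)\<in>E. blinfun_apply \<phi> w - a)"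
  have "(z, M) \<in> E" using ball[of z] r by simp
  then have Ene: "E \<noteq> {}" by auto
  have "bdd_above ((\<lambda>(w, a). blinfun_apply \<phi> w - a) ` E)"
    by (rule bdd_aboveI2[where M="blinfun_apply \<phi> z + \<beta>"]) (use key z in auto)
  then have 1: "blinfun_apply \<phi> w - a \<le> - c" if "(w, a) \<in> E" for w a
    unfolding c_def using cSUP_upper[OF that] by force
  have 2: "- c \<le> blinfun_apply \<phi> x + b" if "(x, b) \<in> D" for x b
    unfolding c_def minus_minus by (rule cSUP_least[OF Ene]) (use key that in auto)
  show ?thesis
    by (rule that[of \<phi> c]) (use 1 2 in force)+
qed

section \<open>Closed convex functions\<close>

lemma convex_blinfun_halfspace:
  fixes p :: "'a::real_normed_vector dual"
  shows "convex {z. blinfun_apply p z \<le> c}"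
proof -
  have "linear (blinfun_apply p)" by (rule bounded_linear.linear[OF blinfun.bounded_linear_right])
  from convex_linear_vimage[OF this, of "{..c}"] show ?thesis by (simp add: vimage_def)
qed


definition epi :: "('a \<Rightarrow> ereal) \<Rightarrow> ('a \<times> real) set" where
  "epi f = {(x, a). f x \<le> ereal a}"

lemma mem_epi [simp]: "(x, a) \<in> epi f \<longleftrightarrow> f x \<le> ereal a"
  by (simp add: epi_def)

text \<open>\<open>Gamma0\<close> seen through epigraphs, the form in which the sandwich theorem
  applies.\<close>

definition closed_convex_fun :: "('a::real_normed_vector \<Rightarrow> ereal) \<Rightarrow> bool" where
  "closed_convex_fun f \<longleftrightarrow>
    (\<forall>x. f x \<noteq> -\<infinity>) \<and> edom f \<noteq> {} \<and> convex (epi f) \<and> closed (epi f)"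

lemma closed_convex_funD:
  assumes "closed_convex_fun f"
  shows "f x \<noteq> -\<infinity>" "edom f \<noteq> {}" "convex (epi f)" "closed (epi f)"
  using assms by (auto simp: closed_convex_fun_def)

lemma closed_convex_fun_finite:
  assumes "closed_convex_fun f" "x \<in> edom f"
  shows "\<exists>a. f x = ereal a"
  using closed_convex_funD(1)[OF assms(1), of x] assms(2) by (cases "f x") (auto simp: edom_def)

lemma epi_convexD:
  assumes "convex (epi f)" "f x \<le> ereal a" "f y \<le> ereal b" "0 \<le> t" "0 \<le> s" "t + s = 1"
  shows "f (t *\<^sub>R x + s *\<^sub>R y) \<le> ereal (t * a + s * b)"
  using convexD[OF assms(1), of "(x, a)" "(y, b)" t s] assms by simp

lemma ereal_le_if_real_le:
  assumes "\<And>a. y \<le> ereal a \<Longrightarrow> b \<le> a" "y \<noteq> -\<infinity>"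
  shows "ereal b \<le> y"
  using assms by (cases y) auto



lemma convex_epi:
  assumes "convex_fun f"
  shows "convex (epi f)"
  unfolding convex_alt
proof (clarify, simp)
  fix x y a b and u :: real
  assume *: "f x \<le> ereal a" "f y \<le> ereal b" "0 \<le> u" "u \<le> 1"
  \<comment> \<open>\<open>convex_fun\<close> speaks only of weights strictly between
    \<open>0\<close> and \<open>1\<close>.\<close>
  consider "u = 0" | "u = 1" | "u \<in> {0<..<1}" using * by fastforce
  then show "f ((1 - u) *\<^sub>R x + u *\<^sub>R y) \<le> ereal ((1 - u) * a + u * b)"
  proof cases
    case 3
    then have "f (u *\<^sub>R y + (1 - u) *\<^sub>R x) \<le> ereal u * f y + ereal (1 - u) * f x"
      using assms unfolding convex_fun_def by blast
    also have "\<dots> \<le> ereal u * ereal b + ereal (1 - u) * ereal a"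
      using * 3 by (intro add_mono ereal_mult_left_mono) auto
    finally show ?thesis by (simp add: add.commute)
  qed (use * in auto)
qed

lemma Gamma0_closed_convex_fun:
  assumes "f \<in> Gamma0"
  shows "closed_convex_fun f"
proof -
  have f: "proper_fun f" "lsc_fun f" "convex_fun f"
    using assms by (auto simp: Gamma0_def)
  have "l \<in> epi f" if X: "\<And>n. X n \<in> epi f" "X \<longlonglongrightarrow> l" for X l
  proof (rule ccontr)
    obtain x t where l: "l = (x, t)" by force
    assume "l \<notin> epi f"
    then have "ereal t < f x" by (simp add: l)
    then obtain s where s: "t < s" "ereal s < f x"
      using ereal_dense2[of "ereal t" "f x"] by auto
    have "\<forall>\<^sub>F y in at x. ereal s < f y"
      using f(2) s(2) unfolding lsc_fun_def le_Liminf_iff by blast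
    then obtain d where d: "0 < d" "\<And>y. y \<noteq> x \<Longrightarrow> dist y x < d \<Longrightarrow> ereal s < f y"
      by (auto simp: eventually_at)
    have 1: "(\<lambda>n. fst (X n)) \<longlonglongrightarrow> x" "(\<lambda>n. snd (X n)) \<longlonglongrightarrow> t"
      using X(2) tendsto_fst[of X l] tendsto_snd[of X l] by (auto simp: l)
    have "\<forall>\<^sub>F n in sequentially. dist (fst (X n)) x < d \<and> snd (X n) < s"
      using tendstoD[OF 1(1) d(1)] order_tendstoD(2)[OF 1(2) s(1)] by eventually_elim auto
    then obtain n where n: "dist (fst (X n)) x < d" "snd (X n) < s"
      by (auto dest: eventually_happens)
    \<comment> \<open>\<open>Liminf (at x)\<close> ignores the point \<open>x\<close> itself; terms
      with \<open>fst (X n) = x\<close> are covered by \<open>s < f x\<close> instead.\<close>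
    have "ereal s < f (fst (X n))"
      using d(2)[OF _ n(1)] s(2) by (cases "fst (X n) = x") auto
    moreover have "f (fst (X n)) \<le> ereal (snd (X n))"
      using X(1)[of n] by (auto simp: epi_def split: prod.splits)
    ultimately have "ereal s < ereal (snd (X n))" by (rule order.strict_trans2)
    then show False using n(2) by simp
  qed
  then have "closed (epi f)"
    unfolding closed_sequential_limits by blast
  then show ?thesis
    using f convex_epi by (auto simp: closed_convex_fun_def proper_fun_def)
qed

lemma closed_convex_fun_lsc:
  assumes f: "closed_convex_fun f" and \<alpha>: "ereal \<alpha> < f x"
  obtains r where "0 < r" "\<And>u. norm (u - x) < r \<Longrightarrow> ereal \<alpha> < f u"
proof -
  have "open (- epi f)" "(x, \<alpha>) \<in> - epi f"
    using f \<alpha> by (auto simp: closed_convex_fun_def)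
  then obtain r where r: "0 < r" "ball (x, \<alpha>) r \<subseteq> - epi f"
    by (meson open_contains_ball)
  have "ereal \<alpha> < f u" if "norm (u - x) < r" for u
  proof -
    have "(u, \<alpha>) \<in> ball (x, \<alpha>) r"
      using that by (simp add: dist_Pair_Pair dist_norm norm_minus_commute)
    then have "(u, \<alpha>) \<notin> epi f" using r(2) by blast
    then show ?thesis by simp
  qed
  with r(1) show ?thesis using that by blast
qed

text \<open>The negative of the cone \<open>\<alpha> - K * norm (u - x)\<close> is convex and
  bounded on balls, so it supplies the epigraph with interior for the sandwich theorem;
  \<open>f\<close> itself may be continuous nowhere.\<close>

lemma affine_minorant_of_norm_minorant:
  assumes f: "closed_convex_fun f" and K: "0 \<le> K"
    and le: "\<And>u. ereal (\<alpha> - K * norm (u - x)) \<le> f u"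
  obtains \<phi> :: "'a::real_normed_vector dual" and d where
    "\<And>u. ereal (blinfun_apply \<phi> u + d) \<le> f u" "\<alpha> \<le> blinfun_apply \<phi> x + d"
proof -
  obtain z where "z \<in> edom f" using f by (auto simp: closed_convex_fun_def)
  then obtain \<beta> where z: "(z, \<beta>) \<in> epi f"
    using closed_convex_fun_finite[OF f] by (metis mem_epi order_refl)
  define E where "E = {(u, a). K * norm (u - x) - \<alpha> \<le> a}"
  have cE: "convex E"
  proof (rule convexI, clarsimp simp: E_def)
    fix u v and a b s t :: real
    assume *: "K * norm (u - x) - \<alpha> \<le> a" "K * norm (v - x) - \<alpha> \<le> b" "0 \<le> s" "0 \<le> t" "s + t = 1"
    have "(s *\<^sub>R u + t *\<^sub>R v) - x = s *\<^sub>R (u - x) + t *\<^sub>R (v - x)"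
      using *(5) by (simp add: algebra_simps flip: scaleR_add_left)
    then have "norm ((s *\<^sub>R u + t *\<^sub>R v) - x) \<le> s * norm (u - x) + t * norm (v - x)"
      using norm_triangle_ineq[of "s *\<^sub>R (u - x)" "t *\<^sub>R (v - x)"] * by simp
    then have "K * norm ((s *\<^sub>R u + t *\<^sub>R v) - x) \<le> K * (s * norm (u - x) + t * norm (v - x))"
      using K by (rule mult_left_mono)
    also have "\<dots> \<le> s * (a + \<alpha>) + t * (b + \<alpha>)"
      using *(3,4) mult_left_mono[OF *(1), of s] mult_left_mono[OF *(2), of t] by (simp add: algebra_simps)
    also have "\<dots> = s * a + t * b + \<alpha>"
      using *(5) by (simp add: algebra_simps flip: distrib_left)
    finally show "K * norm (s *\<^sub>R u + t *\<^sub>R v - x) - \<alpha> \<le> s * a + t * b" by simp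
  qed
  have "(u, K * (norm (z - x) + 1) - \<alpha>) \<in> E" if "norm (u - z) < 1" for u
  proof -
    have "norm (u - x) \<le> norm (z - x) + 1"
      using that norm_triangle_ineq[of "u - z" "z - x"] by simp
    then show ?thesis using K by (auto simp: E_def mult_left_mono)
  qed
  moreover have "0 \<le> a + b" if "(u, a) \<in> E" "(u, b) \<in> epi f" for u a b
    using that le[of u] order_trans[of "ereal (\<alpha> - K * norm (u - x))" "f u" "ereal b"]
    by (auto simp: E_def)
  ultimately obtain \<phi> c where
    1: "\<And>x a. (x, a) \<in> E \<Longrightarrow> blinfun_apply \<phi> x + c \<le> a" and
    2: "\<And>x b. (x, b) \<in> epi f \<Longrightarrow> - blinfun_apply \<phi> x - c \<le> b"
    using sandwich[OF cE _ zero_less_one _ z] closed_convex_funD(3)[OF f] by metis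
  have "ereal (blinfun_apply (- \<phi>) u + - c) \<le> f u" for u
    by (rule ereal_le_if_real_le) (use 2[of u] f in \<open>auto simp: closed_convex_fun_def blinfun.minus_left\<close>)
  moreover have "\<alpha> \<le> blinfun_apply (- \<phi>) x + - c"
    using 1[of x "- \<alpha>"] by (simp add: E_def blinfun.minus_left)
  ultimately show ?thesis by (rule that)
qed

text \<open>Lower semicontinuity at a point \<open>z\<close> of the domain gives the bound
  \<open>a - 1\<close> on a ball. Farther out, too low a value at \<open>u\<close> would by
  convexity drag down the values on the segment to \<open>z\<close>.\<close>

lemma affine_minorant_exists:
  fixes f :: "'a::real_normed_vector \<Rightarrow> ereal"
  assumes f: "closed_convex_fun f"
  obtains \<phi> :: "'a dual" and d where "\<And>u. ereal (blinfun_apply \<phi> u + d) \<le> f u"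
proof -
  obtain z where "z \<in> edom f" using f by (auto simp: closed_convex_fun_def)
  then obtain a where z: "f z = ereal a"
    using closed_convex_fun_finite[OF f] by blast
  then obtain r where r: "0 < r" "\<And>u. norm (u - z) < r \<Longrightarrow> ereal (a - 1) < f u"
    using closed_convex_fun_lsc[OF f, of "a - 1" z] by auto
  have "ereal (a - 1 - 2 / r * norm (u - z)) \<le> f u" for u
  proof (cases "norm (u - z) < r")
    case True
    have "a - 1 - 2 / r * norm (u - z) \<le> a - 1" using r(1) by simp
    then show ?thesis using r(2)[OF True]
      by (meson ereal_less_eq(3) less_imp_le order_trans)
  next
    case False
    then have n: "r \<le> norm (u - z)" "0 < norm (u - z)" using r(1) by linarith+
    show ?thesis
    proof (rule ereal_le_if_real_le)
      fix b assume b: "f u \<le> ereal b"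
      \<comment> \<open>Contracts \<open>u\<close> to distance \<open>r / 2\<close> from
        \<open>z\<close>, inside the ball; this is the origin of the slope
        \<open>2 / r\<close>.\<close>
      define l where "l = r / (2 * norm (u - z))"
      have l: "0 < l" "l \<le> 1" using n r(1) by (auto simp: l_def field_simps)
      have "f ((1 - l) *\<^sub>R z + l *\<^sub>R u) \<le> ereal ((1 - l) * a + l * b)"
        using b z l closed_convex_funD(3)[OF f] by (intro epi_convexD) auto
      moreover have "(1 - l) *\<^sub>R z + l *\<^sub>R u - z = l *\<^sub>R (u - z)"
        by (simp add: algebra_simps)
      then have "norm ((1 - l) *\<^sub>R z + l *\<^sub>R u - z) < r"
        using l n r(1) by (simp add: l_def)
      then have "ereal (a - 1) < f ((1 - l) *\<^sub>R z + l *\<^sub>R u)" by (rule r(2))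
      ultimately have "a - 1 < (1 - l) * a + l * b"
        by (metis less_ereal.simps(1) order.strict_trans2)
      then have "l * (a - b) < 1" by (simp add: algebra_simps)
      then have "a - b < 1 / l" using l by (simp add: field_simps)
      also have "1 / l = 2 / r * norm (u - z)" by (simp add: l_def)
      finally show "a - 1 - 2 / r * norm (u - z) \<le> b" by simp
    qed (rule closed_convex_funD[OF f])
  qed
  from affine_minorant_of_norm_minorant[OF f _ this] r(1) that show ?thesis
    by (metis divide_nonneg_nonneg less_imp_le zero_le_numeral)
qed

text \<open>Takes the place of the Fenchel-Moreau theorem. Semicontinuity handles a ball around
  \<open>x\<close>; outside, the cone is made steep enough to fall below an affine minorant already
  known.\<close>

theorem affine_minorant_above:
  fixes f :: "'a::real_normed_vector \<Rightarrow> ereal"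
  assumes f: "closed_convex_fun f" and \<alpha>: "ereal \<alpha> < f x"
  obtains \<phi> :: "'a dual" and d where
    "\<And>u. ereal (blinfun_apply \<phi> u + d) \<le> f u" "\<alpha> < blinfun_apply \<phi> x + d"
proof -
  obtain \<alpha>' where \<alpha>': "\<alpha> < \<alpha>'" "ereal \<alpha>' < f x"
    using ereal_dense2[OF \<alpha>] by auto
  obtain r where r: "0 < r" "\<And>u. norm (u - x) < r \<Longrightarrow> ereal \<alpha>' < f u"
    using closed_convex_fun_lsc[OF f \<alpha>'(2)] by blast
  obtain p :: "'a dual" and d where p: "\<And>u. ereal (blinfun_apply p u + d) \<le> f u"
    using affine_minorant_exists[OF f] by blast
  \<comment> \<open>The height by which the affine minorant falls short of \<open>\<alpha>'\<close>
    at \<open>x\<close>; the extra slope \<open>s / r\<close> makes up for it at distance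
    \<open>r\<close>.\<close>
  define s where "s = max 0 (\<alpha>' - blinfun_apply p x - d)"
  define K where "K = norm p + s / r"
  have s: "0 \<le> s / r" using r(1) by (simp add: s_def)
  then have K: "0 \<le> K" by (simp add: K_def)
  have "ereal (\<alpha>' - K * norm (u - x)) \<le> f u" for u
  proof (cases "norm (u - x) < r")
    case True
    have "\<alpha>' - K * norm (u - x) \<le> \<alpha>'" using K by simp
    then show ?thesis using r(2)[OF True] by (meson ereal_less_eq(3) less_imp_le order_trans)
  next
    case False
    then have "s \<le> s / r * norm (u - x)"
      using s r(1) mult_left_mono[of r "norm (u - x)" "s / r"] by simp
    moreover have "- (norm p * norm (u - x)) \<le> blinfun_apply p (u - x)"
      using norm_blinfun[of p "u - x"] by (simp add: abs_le_iff)
    moreover have "\<alpha>' - blinfun_apply p x - d \<le> s" by (simp add: s_def)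
    ultimately have "\<alpha>' - K * norm (u - x) \<le> blinfun_apply p u + d"
      unfolding K_def by (simp add: blinfun.diff_right algebra_simps)
    then show ?thesis using p[of u] by (meson ereal_less_eq(3) order_trans)
  qed
  from affine_minorant_of_norm_minorant[OF f K this]
  obtain \<phi> e where "\<And>u. ereal (blinfun_apply \<phi> u + e) \<le> f u" "\<alpha>' \<le> blinfun_apply \<phi> x + e"
    by blast
  with \<alpha>'(1) show ?thesis using that[of \<phi> e] by auto
qed

lemma conjugate_le_iff:
  assumes "\<And>u. f u \<noteq> -\<infinity>"
  shows "conjugate f \<phi> \<le> ereal t \<longleftrightarrow> (\<forall>u a. f u \<le> ereal a \<longrightarrow> blinfun_apply \<phi> u - t \<le> a)"
proof -
  have "ereal (blinfun_apply \<phi> u) - f u \<le> ereal t \<longleftrightarrow>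
      (\<forall>a. f u \<le> ereal a \<longrightarrow> blinfun_apply \<phi> u - t \<le> a)" for u
    using assms[of u] by (cases "f u") force+
  then show ?thesis by (auto simp: conjugate_def SUP_le_iff)
qed

lemma convex_epi_conjugate:
  assumes f: "\<And>u. f u \<noteq> -\<infinity>"
  shows "convex (epi (conjugate f))"
proof (rule convexI, clarsimp simp: conjugate_le_iff[OF f] blinfun.add_left blinfun.scaleR_left)
  fix \<phi> \<psi> :: "'a dual" and s t k l a :: real and u
  assume *: "\<forall>u a. f u \<le> ereal a \<longrightarrow> blinfun_apply \<phi> u - s \<le> a"
    "\<forall>u a. f u \<le> ereal a \<longrightarrow> blinfun_apply \<psi> u - t \<le> a" "0 \<le> k" "0 \<le> l" "k + l = 1" "f u \<le> ereal a"
  have "k * blinfun_apply \<phi> u + l * blinfun_apply \<psi> u \<le> k * (a + s) + l * (a + t)"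
    using *(1)[rule_format, OF *(6)] *(2)[rule_format, OF *(6)] *(3,4)
    by (intro add_mono mult_left_mono) auto
  also have "\<dots> = a + (k * s + l * t)"
    using *(5) by (simp add: algebra_simps flip: distrib_left)
  finally show "k * blinfun_apply \<phi> u + l * blinfun_apply \<psi> u - (k * s + l * t) \<le> a" by simp
qed

text \<open>Coercivity of \<open>G\<close> makes its conjugate bounded near the origin of the dual; a subgradient of
  the conjugate there is, by reflexivity, a minimizer of \<open>G\<close>.\<close>

theorem coercive_minimizer_exists:
  fixes G :: "'a::real_normed_vector \<Rightarrow> ereal"
  assumes refl: "reflexive_space TYPE('a)" and G: "closed_convex_fun G"
    and \<alpha>: "0 < \<alpha>" and coercive: "\<And>u. ereal (\<alpha> * norm u - \<beta>) \<le> G u"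
  obtains x where "\<And>y. G x \<le> G y"
proof -
  define E where "E = epi (conjugate G)"
  have E: "(\<phi>, t) \<in> E \<longleftrightarrow> (\<forall>u a. G u \<le> ereal a \<longrightarrow> blinfun_apply \<phi> u - t \<le> a)" for \<phi> t
    by (simp add: E_def conjugate_le_iff closed_convex_funD(1)[OF G])
  \<comment> \<open>The infimum of \<open>G\<close>, which is minus its conjugate at
    \<open>0\<close>; a functional separating \<open>E\<close> from \<open>(0, m)\<close> is
    therefore a subgradient of the conjugate at \<open>0\<close>.\<close>
  define m where "m = Inf {a. \<exists>u. G u \<le> ereal a}"
  have lower: "\<alpha> * norm u - \<beta> \<le> a" if "G u \<le> ereal a" for u a
    using coercive[of u] that by (metis ereal_less_eq(3) order_trans)
  have "-\<beta> \<le> a" if "G u \<le> ereal a" for u a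
    using lower[OF that] \<alpha> by (smt (verit) mult_nonneg_nonneg norm_ge_zero)
  then have bdd: "bdd_below {a. \<exists>u. G u \<le> ereal a}"
    by (intro bdd_belowI[of _ "- \<beta>"]) blast
  have ne: "{a. \<exists>u. G u \<le> ereal a} \<noteq> {}"
  proof -
    obtain z where "z \<in> edom G" using closed_convex_funD(2)[OF G] by blast
    then obtain a where "G z = ereal a"
      using closed_convex_fun_finite[OF G] by blast
    then have "G z \<le> ereal a" by simp
    then show ?thesis by blast
  qed
  have m_le: "ereal m \<le> G u" for u
    by (rule ereal_le_if_real_le) (use bdd G in \<open>auto simp: m_def closed_convex_fun_def intro!: cInf_lower\<close>)
  have "convex E"
    unfolding E_def by (rule convex_epi_conjugate) (rule closed_convex_funD(1)[OF G])
  moreover have "(\<phi>, \<beta>) \<in> E" if "norm (\<phi> - 0) < \<alpha>" for \<phi>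
  proof -
    have "blinfun_apply \<phi> u - \<beta> \<le> a" if "G u \<le> ereal a" for u a
      using lower[OF that] norm_blinfun[of \<phi> u] \<open>norm (\<phi> - 0) < \<alpha>\<close>
        mult_right_mono[of "norm \<phi>" \<alpha> "norm u"] by simp
    then show ?thesis by (simp add: E)
  qed
  moreover have "0 \<le> a + b" if "(\<phi>, a) \<in> E" "(\<phi>, b) \<in> {(0, m)}" for \<phi> a b
  proof -
    have "- a \<le> c" if "G u \<le> ereal c" for u c
      using \<open>(\<phi>, a) \<in> E\<close> \<open>(\<phi>, b) \<in> _\<close> that by (force simp: E)
    then have "- a \<le> m"
      unfolding m_def using ne by (intro cInf_greatest) auto
    then show ?thesis using \<open>(\<phi>, b) \<in> _\<close> by simp
  qed
  ultimately obtain \<xi> c where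
    1: "\<And>\<phi> a. (\<phi>, a) \<in> E \<Longrightarrow> blinfun_apply \<xi> \<phi> + c \<le> a" and
    2: "\<And>\<phi> b. (\<phi>, b) \<in> {(0, m)} \<Longrightarrow> - blinfun_apply \<xi> \<phi> - c \<le> b"
    using sandwich[of E "{(0, m)}" \<alpha> 0 \<beta> m] \<alpha> by (metis convex_singleton singletonI)
  obtain x where x: "\<xi> = bidual_embed x"
    using refl by (auto simp: reflexive_space_def surj_def)
  have "G x \<le> ereal m"
  proof (rule ccontr)
    assume "\<not> G x \<le> ereal m"
    then obtain \<phi> d where d: "\<And>u. ereal (blinfun_apply \<phi> u + d) \<le> G u" "m < blinfun_apply \<phi> x + d"
      using affine_minorant_above[OF G, of m x] by (metis not_le)
    \<comment> \<open>The affine minorant bounds the conjugate at \<open>\<phi>\<close> by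
      \<open>- d\<close>; the subgradient inequality there caps its value at \<open>x\<close> by
      \<open>m\<close>.\<close>
    have "(\<phi>, - d) \<in> E"
      unfolding E using d(1) order_trans by fastforce
    from 1[OF this] 2[of 0 m] d(2) show False by (simp add: x)
  qed
  with m_le show ?thesis using that[of x] order_trans by blast
qed

text \<open>By Baire's theorem some sublevel set has interior; convexity transports the bound to any
  interior point of the domain.\<close>

theorem bounded_above_near_interior:
  fixes f :: "'a::banach \<Rightarrow> ereal"
  assumes f: "closed_convex_fun f" and x: "x \<in> interior (edom f)"
  obtains r M where "0 < r" "\<And>u. norm (u - x) < r \<Longrightarrow> f u \<le> ereal M"
proof -
  obtain \<rho> where \<rho>: "0 < \<rho>" "ball x \<rho> \<subseteq> edom f"
    using x by (meson mem_interior)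
  define T where "T n = {u. f u \<le> ereal (real n)}" for n :: nat
  have "closed ((\<lambda>u. (u, real n)) -` epi f)" for n
    by (intro closed_vimage closed_convex_funD[OF f] continuous_intros)
  then have clT: "closed (T n)" for n
    by (simp add: T_def vimage_def)
  have "\<exists>n. interior (T n) \<noteq> {}"
  proof (rule ccontr)
    assume *: "\<nexists>n. interior (T n) \<noteq> {}"
    have "interior (\<Union> (range T)) = {}"
      using Baire_category_alt[of "euclidean :: 'a topology" "range T"] clT *
      by (auto simp: completely_metrizable_space_euclidean)
    moreover have "ball x \<rho> \<subseteq> \<Union> (range T)"
    proof
      fix u assume "u \<in> ball x \<rho>"
      then obtain a where a: "f u = ereal a"
        using \<rho>(2) closed_convex_fun_finite[OF f] by blast
      obtain n :: nat where "a \<le> n" using real_arch_simple by blast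
      then show "u \<in> \<Union> (range T)" by (auto simp: T_def a)
    qed
    then have "x \<in> interior (\<Union> (range T))"
      using \<rho>(1) by (meson centre_in_ball interior_maximal open_ball subsetD)
    ultimately show False by simp
  qed
  then obtain n w where "w \<in> interior (T n)" by blast
  then obtain e where e: "0 < e" "ball w e \<subseteq> T n" by (meson mem_interior)
  \<comment> \<open>Chosen so that \<open>w'\<close>, on the far side of \<open>x\<close> from
    \<open>w\<close>, is still in the ball on which \<open>f\<close> is finite.\<close>
  define s where "s = \<rho> / (2 * (norm (w - x) + 1))"
  have s: "0 < s" using \<rho>(1) by (simp add: s_def add_nonneg_pos)
  define w' where "w' = x - s *\<^sub>R (w - x)"
  have "s * norm (w - x) < \<rho>"
  proof -
    have "s * norm (w - x) \<le> s * (norm (w - x) + 1)" using s by simp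
    also have "\<dots> = \<rho> / 2"
    proof -
      have "\<rho> / (2 * c) * c = \<rho> / 2" if "c \<noteq> 0" for c :: real
        using that by simp
      moreover have "norm (w - x) + 1 \<noteq> 0"
        by (smt (verit) norm_ge_zero)
      ultimately show ?thesis unfolding s_def by blast
    qed
    finally show ?thesis using \<rho>(1) by simp
  qed
  then have "w' \<in> ball x \<rho>"
    using s by (simp add: w'_def dist_norm)
  then obtain a where a: "f w' = ereal a"
    using \<rho>(2) closed_convex_fun_finite[OF f] by blast
  \<comment> \<open>The homothety with centre \<open>w'\<close> and ratio \<open>s / (1 + s)\<close>
    sends \<open>w\<close> to \<open>x\<close> and the ball of radius \<open>e\<close> to one of
    radius \<open>r\<close>.\<close>
  define r where "r = e * s / (1 + s)"
  have r: "0 < r" using s e(1) by (simp add: r_def)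
  have "f u \<le> ereal ((1 / (1 + s)) * a + (s / (1 + s)) * n)" if u: "norm (u - x) < r" for u
  proof -
    define v where "v = w + ((1 + s) / s) *\<^sub>R (u - x)"
    have "norm (v - w) = (1 + s) / s * norm (u - x)"
      using s by (simp add: v_def)
    also have "\<dots> < (1 + s) / s * r"
      using u s by (intro mult_strict_left_mono) auto
    also have "\<dots> = e" using s by (simp add: r_def)
    finally have "v \<in> ball w e" by (simp add: dist_norm norm_minus_commute)
    then have v: "f v \<le> ereal n" using e(2) by (auto simp: T_def)
    have "f ((1 / (1 + s)) *\<^sub>R w' + (s / (1 + s)) *\<^sub>R v)
        \<le> ereal ((1 / (1 + s)) * a + (s / (1 + s)) * n)"
      using s a v closed_convex_funD(3)[OF f]
      by (intro epi_convexD) (auto simp flip: add_divide_distrib)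
    moreover have "(1 / (1 + s)) *\<^sub>R w' + (s / (1 + s)) *\<^sub>R v = u"
    proof -
      have "(1 / (1 + s)) *\<^sub>R w' + (s / (1 + s)) *\<^sub>R v = (1 / (1 + s)) *\<^sub>R (w' + s *\<^sub>R v)"
        by (simp add: algebra_simps)
      also have "s *\<^sub>R v = s *\<^sub>R w + (1 + s) *\<^sub>R (u - x)"
        using s by (simp add: v_def scaleR_add_right)
      also have "w' + \<dots> = (1 + s) *\<^sub>R u"
        by (simp add: w'_def algebra_simps)
      finally show ?thesis using s by simp
    qed
    ultimately show ?thesis by simp
  qed
  with r show ?thesis by (rule that)
qed

section \<open>Subdifferentials and gradients\<close>

lemma subdifferential_iff:
  assumes "f x = ereal a" "\<And>y. f y \<noteq> -\<infinity>"
  shows "\<phi> \<in> subdifferential f x \<longleftrightarrow> (\<forall>y b. f y \<le> ereal b \<longrightarrow> a + blinfun_apply \<phi> (y - x) \<le> b)"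
proof -
  have "ereal (blinfun_apply \<phi> (y - x)) + f x \<le> f y \<longleftrightarrow>
      (\<forall>b. f y \<le> ereal b \<longrightarrow> a + blinfun_apply \<phi> (y - x) \<le> b)" for y
    using assms by (cases "f y") (force simp: add.commute)+
  then show ?thesis by (auto simp: subdifferential_def)
qed

text \<open>\<open>subdifferential\<close> does not ask for a finite value at \<open>x\<close>; the
  inequality at one point of the domain enforces it.\<close>

lemma subdifferential_edom:
  assumes "closed_convex_fun f" "\<phi> \<in> subdifferential f x"
  shows "x \<in> edom f"
proof -
  obtain z where "z \<in> edom f" using closed_convex_funD(2)[OF assms(1)] by blast
  have "ereal (blinfun_apply \<phi> (z - x)) + f x \<le> f z"
    using assms(2) by (simp add: subdifferential_def)
  then show ?thesis
    using \<open>z \<in> edom f\<close> by (cases "f x") (auto simp: edom_def)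
qed

lemma op_dom_subdifferential_subset:
  "closed_convex_fun f \<Longrightarrow> op_dom (subdifferential f) \<subseteq> edom f"
  by (auto simp: op_dom_def intro: subdifferential_edom)

lemma subdifferentialE:
  assumes "closed_convex_fun f" "\<phi> \<in> subdifferential f x"
  obtains a where "f x = ereal a" "\<And>y b. f y \<le> ereal b \<Longrightarrow> a + blinfun_apply \<phi> (y - x) \<le> b"
proof -
  obtain a where a: "f x = ereal a"
    using closed_convex_fun_finite[OF assms(1) subdifferential_edom[OF assms]] by blast
  with subdifferential_iff[of f x a \<phi>] closed_convex_funD(1)[OF assms(1)] assms(2) show ?thesis
    using that[OF a] by blast
qed

text \<open>Fermat's rule under the usual qualification: one summand is bounded above near a point
  of the domain of the other. Phrased with convex epigraphs so that distances, indicators and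
  restricted linear functions enter without a proof of closedness.\<close>

theorem subdifferential_sum_rule:
  fixes f k :: "'a::real_normed_vector \<Rightarrow> ereal"
  assumes cf: "convex (epi f)" and ck: "convex (epi k)"
    and f: "\<And>u. f u \<noteq> -\<infinity>" and k: "\<And>u. k u \<noteq> -\<infinity>"
    and r: "0 < r" "\<And>u. norm (u - z) < r \<Longrightarrow> f u \<le> ereal M" and z: "k z < \<infinity>"
    and x: "f x < \<infinity>" "k x < \<infinity>" and min: "\<And>y. f x + k x \<le> f y + k y"
  obtains \<phi> where "\<phi> \<in> subdifferential f x" "- \<phi> \<in> subdifferential k x"
proof -
  obtain a where a: "f x = ereal a" using x(1) f[of x] by (cases "f x") auto
  obtain b where b: "k x = ereal b" using x(2) k[of x] by (cases "k x") auto
  \<comment> \<open>Lowering \<open>k\<close> by the minimal value \<open>a + b\<close> turns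
    minimality into the sign condition of the sandwich theorem.\<close>
  define D where "D = {(y, t). k y \<le> ereal (t + (a + b))}"
  have "convex D"
    unfolding D_def
  proof (rule convexI, clarsimp)
    fix y y' and t t' l l' :: real
    assume *: "k y \<le> ereal (t + (a + b))" "k y' \<le> ereal (t' + (a + b))" "0 \<le> l" "0 \<le> l'" "l + l' = 1"
    have "k (l *\<^sub>R y + l' *\<^sub>R y') \<le> ereal (l * (t + (a + b)) + l' * (t' + (a + b)))"
      by (rule epi_convexD[OF ck]) (use * in auto)
    also have "l * (t + (a + b)) + l' * (t' + (a + b)) = l * t + l' * t' + (l + l') * (a + b)"
      by (simp add: algebra_simps)
    finally show "k (l *\<^sub>R y + l' *\<^sub>R y') \<le> ereal (l * t + l' * t' + (a + b))"
      using *(5) by simp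
  qed
  moreover obtain \<beta> where "(z, \<beta>) \<in> D"
  proof -
    obtain c where "k z = ereal c" using z k[of z] by (cases "k z") auto
    then have "(z, c - (a + b)) \<in> D" by (simp add: D_def)
    then show ?thesis by (rule that)
  qed
  moreover have "0 \<le> s + t" if "(y, s) \<in> epi f" "(y, t) \<in> D" for y s t
  proof -
    have "ereal (a + b) \<le> f y + k y" using min[of y] a b by simp
    also have "\<dots> \<le> ereal s + ereal (t + (a + b))"
      using that by (intro add_mono) (auto simp: D_def)
    finally show ?thesis by simp
  qed
  ultimately obtain \<phi> c where
    1: "\<And>x a. (x, a) \<in> epi f \<Longrightarrow> blinfun_apply \<phi> x + c \<le> a" and
    2: "\<And>x b. (x, b) \<in> D \<Longrightarrow> - blinfun_apply \<phi> x - c \<le> b"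
    using sandwich[OF cf, of D r z M] r by (metis mem_epi)
  \<comment> \<open>At \<open>x\<close> the two separating inequalities have opposite bounds, so
    both are equalities there and become subgradient inequalities.\<close>
  have "(x, - a) \<in> D" by (simp add: D_def b)
  then have *: "blinfun_apply \<phi> x + c = a"
    using 1[of x a] 2[of x "- a"] a by simp
  have "\<phi> \<in> subdifferential f x"
    unfolding subdifferential_iff[of f, OF a f]
    using 1 * by (fastforce simp: blinfun.diff_right)
  moreover have "- \<phi> \<in> subdifferential k x"
    unfolding subdifferential_iff[of k, OF b k]
  proof (intro allI impI)
    fix y t assume "k y \<le> ereal t"
    then have "(y, t - (a + b)) \<in> D" by (simp add: D_def)
    from 2[OF this] * show "b + blinfun_apply (- \<phi>) (y - x) \<le> t"
      by (simp add: blinfun.diff_right blinfun.minus_left)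
  qed
  ultimately show ?thesis by (rule that)
qed

lemma convex_edom:
  assumes "closed_convex_fun f"
  shows "convex (edom f)"
proof -
  have "edom f = fst ` epi f"
  proof (intro set_eqI iffI)
    fix x assume "x \<in> edom f"
    then obtain a where "f x = ereal a" using closed_convex_fun_finite[OF assms] by blast
    then show "x \<in> fst ` epi f" by (intro image_eqI[of _ _ "(x, a)"]) auto
  qed (auto simp: edom_def epi_def)
  then show ?thesis
    using convex_linear_image[OF linear_fst closed_convex_funD(3)[OF assms]] by simp
qed

text \<open>If a directional difference quotient stayed above \<open>\<phi> v + \<epsilon>\<close>, the sandwich theorem applied to
  the ray in direction \<open>v\<close> would give a second subgradient.\<close>

lemma unique_subgradient_upper:
  fixes f :: "'a::real_normed_vector \<Rightarrow> ereal"
  assumes f: "closed_convex_fun f"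
    and r: "0 < r" "\<And>u. norm (u - x) < r \<Longrightarrow> f u \<le> ereal M"
    and \<phi>: "\<phi> \<in> subdifferential f x" and uniq: "\<And>\<psi>. \<psi> \<in> subdifferential f x \<Longrightarrow> \<psi> = \<phi>"
    and a: "f x = ereal a" and d: "blinfun_apply \<phi> v < d"
  obtains t0 where "0 < t0" "\<And>t. 0 < t \<Longrightarrow> t \<le> t0 \<Longrightarrow> f (x + t *\<^sub>R v) \<le> ereal (a + t * d)"
proof -
  have "\<exists>t\<ge>0. f (x + t *\<^sub>R v) < ereal (a + t * d)"
  proof (rule ccontr)
    assume "\<not> ?thesis"
    then have *: "ereal (a + t * d) \<le> f (x + t *\<^sub>R v)" if "0 \<le> t" for t
      using that by (meson not_le)
    define D where "D = (\<lambda>t. (x + t *\<^sub>R v, - (a + t * d))) ` {0..}"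
    have "convex D"
      unfolding D_def
    proof (rule convexI, clarsimp)
      fix s t k l :: real
      assume st: "0 \<le> s" "0 \<le> t" "0 \<le> k" "0 \<le> l" "k + l = 1"
      have "k *\<^sub>R (x + s *\<^sub>R v) + l *\<^sub>R (x + t *\<^sub>R v) = (k + l) *\<^sub>R x + (k * s + l * t) *\<^sub>R v"
        by (simp add: algebra_simps)
      moreover have "k * (- a - s * d) + l * (- a - t * d) = - ((k + l) * a) - (k * s + l * t) * d"
        by (simp add: algebra_simps)
      ultimately show "(k *\<^sub>R (x + s *\<^sub>R v) + l *\<^sub>R (x + t *\<^sub>R v), k * (- a - s * d) + l * (- a - t * d))
          \<in> (\<lambda>t. (x + t *\<^sub>R v, - a - t * d)) ` {0..}"
        using st by (intro image_eqI[of _ _ "k * s + l * t"]) auto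
    qed
    moreover have "0 \<le> s + t" if y: "(y, s) \<in> epi f" "(y, t) \<in> D" for y s t
    proof -
      obtain \<tau> where \<tau>: "0 \<le> \<tau>" "y = x + \<tau> *\<^sub>R v" "t = - (a + \<tau> * d)"
        using y(2) by (auto simp: D_def)
      have "ereal (a + \<tau> * d) \<le> f y" using *[OF \<tau>(1)] \<tau>(2) by simp
      also have "f y \<le> ereal s" using y(1) by simp
      finally show ?thesis using \<tau>(3) by simp
    qed
    moreover have D: "(x + t *\<^sub>R v, - (a + t * d)) \<in> D" if "0 \<le> t" for t
      using that by (auto simp: D_def)
    moreover have "(x, - a) \<in> D" using D[of 0] by simp
    ultimately obtain \<psi> c where
      1: "\<And>x a. (x, a) \<in> epi f \<Longrightarrow> blinfun_apply \<psi> x + c \<le> a" and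
      2: "\<And>x b. (x, b) \<in> D \<Longrightarrow> - blinfun_apply \<psi> x - c \<le> b"
      using sandwich[OF closed_convex_funD(3)[OF f], of D r x M] r by (metis mem_epi)
    have c: "blinfun_apply \<psi> x + c = a"
      using 1[of x a] 2[OF D[of 0]] a by simp
    have "\<psi> \<in> subdifferential f x"
      unfolding subdifferential_iff[of f, OF a closed_convex_funD(1)[OF f]]
      using 1 c by (fastforce simp: blinfun.diff_right)
    then have "\<psi> = \<phi>" by (rule uniq)
    \<comment> \<open>At parameter \<open>1\<close> the ray forces
      \<open>d \<le> \<phi> v\<close>.\<close>
    then show False
      using 2[OF D[of 1]] c d by (simp add: blinfun.add_right)
  qed
  then obtain t0 where t0: "0 \<le> t0" "f (x + t0 *\<^sub>R v) < ereal (a + t0 * d)" by blast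
  then have "0 < t0" using a by (cases "t0 = 0") auto
  moreover have "f (x + t *\<^sub>R v) \<le> ereal (a + t * d)" if t: "0 < t" "t \<le> t0" for t
  proof -
    have "f ((1 - t / t0) *\<^sub>R x + (t / t0) *\<^sub>R (x + t0 *\<^sub>R v)) \<le> ereal ((1 - t / t0) * a + (t / t0) * (a + t0 * d))"
      by (rule epi_convexD[OF closed_convex_funD(3)[OF f]]) (use t t0 a \<open>0 < t0\<close> in auto)
    moreover have "(1 - t / t0) *\<^sub>R x + (t / t0) *\<^sub>R (x + t0 *\<^sub>R v) = x + t *\<^sub>R v"
      using \<open>0 < t0\<close> by (simp add: algebra_simps)
    moreover have "(1 - t / t0) * a + (t / t0) * (a + t0 * d) = a + t * d"
      using \<open>0 < t0\<close> by (simp add: field_simps)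
    ultimately show ?thesis by simp
  qed
  ultimately show ?thesis by (rule that)
qed

text \<open>For small positive \<open>t\<close> the difference quotients are squeezed between
  \<open>\<phi> v\<close> and \<open>\<phi> v + e / 2\<close>. Limits being unique, the description
  in \<open>gradient\<close> denotes \<open>\<phi>\<close>.\<close>

theorem gradient_eq_unique_subgradient:
  fixes f :: "'a::real_normed_vector \<Rightarrow> ereal"
  assumes f: "closed_convex_fun f"
    and r: "0 < r" "\<And>u. norm (u - x) < r \<Longrightarrow> f u \<le> ereal M"
    and \<phi>: "\<phi> \<in> subdifferential f x" and uniq: "\<And>\<psi>. \<psi> \<in> subdifferential f x \<Longrightarrow> \<psi> = \<phi>"
  shows "gradient f x = \<phi>"
proof -
  obtain a where a: "f x = ereal a" and sub: "\<And>y b. f y \<le> ereal b \<Longrightarrow> a + blinfun_apply \<phi> (y - x) \<le> b"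
    using \<phi> by (rule subdifferentialE[OF f]) blast
  define q where "q t v = (real_of_ereal (f (x + t *\<^sub>R v)) - real_of_ereal (f x)) / t" for t v
  have lim: "((\<lambda>t. q t v) \<longlongrightarrow> blinfun_apply \<phi> v) (at 0)" for v
  proof (rule tendstoI)
    fix e :: real assume e: "0 < e"
    have bound: "\<exists>t0>0. \<forall>t. 0 < t \<and> t \<le> t0 \<longrightarrow>
        blinfun_apply \<phi> v \<le> q t v \<and> q t v \<le> blinfun_apply \<phi> v + e / 2" for v
    proof -
      obtain t0 where t0: "0 < t0"
        "\<And>t. 0 < t \<Longrightarrow> t \<le> t0 \<Longrightarrow> f (x + t *\<^sub>R v) \<le> ereal (a + t * (blinfun_apply \<phi> v + e / 2))"
        using unique_subgradient_upper[OF f r \<phi> uniq a, of v "blinfun_apply \<phi> v + e / 2"] e by auto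
      have "blinfun_apply \<phi> v \<le> q t v \<and> q t v \<le> blinfun_apply \<phi> v + e / 2" if t: "0 < t" "t \<le> t0" for t
      proof -
        obtain b where b: "f (x + t *\<^sub>R v) = ereal b"
          using t0(2)[OF t] closed_convex_funD(1)[OF f, of "x + t *\<^sub>R v"]
          by (cases "f (x + t *\<^sub>R v)") auto
        have "b \<le> a + t * (blinfun_apply \<phi> v + e / 2)" "a + t * blinfun_apply \<phi> v \<le> b"
          using t0(2)[OF t] sub[of "x + t *\<^sub>R v" b] b by (auto simp: blinfun.scaleR_right)
        then show ?thesis using t a b by (simp add: q_def field_simps)
      qed
      with t0(1) show ?thesis by blast
    qed
    obtain t1 where t1: "0 < t1"
      "\<And>t. 0 < t \<Longrightarrow> t \<le> t1 \<Longrightarrow> blinfun_apply \<phi> v \<le> q t v \<and> q t v \<le> blinfun_apply \<phi> v + e / 2"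
      using bound[of v] by blast
    obtain t2 where t2: "0 < t2"
      "\<And>t. 0 < t \<Longrightarrow> t \<le> t2 \<Longrightarrow> blinfun_apply \<phi> (- v) \<le> q t (- v) \<and> q t (- v) \<le> blinfun_apply \<phi> (- v) + e / 2"
      using bound[of "- v"] by blast
    have "dist (q t v) (blinfun_apply \<phi> v) < e" if t: "t \<noteq> 0" "dist t 0 < min t1 t2" for t
    proof (cases "0 < t")
      case True
      then show ?thesis using t1(2)[of t] t e by (auto simp: dist_real_def)
    next
      case False
      \<comment> \<open>Negative \<open>t\<close> are positive ones in the direction
        \<open>- v\<close>.\<close>
      have "q t v = - q (- t) (- v)" by (simp add: q_def minus_divide_left)
      then show ?thesis using t2(2)[of "- t"] t e False
        by (auto simp: dist_real_def blinfun.minus_right)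
    qed
    then show "\<forall>\<^sub>F t in at 0. dist (q t v) (blinfun_apply \<phi> v) < e"
      unfolding eventually_at using t1(1) t2(1) by (intro exI[of _ "min t1 t2"]) auto
  qed
  show ?thesis
    unfolding gradient_def
  proof (rule the_equality)
    show "\<forall>v. ((\<lambda>t. (real_of_ereal (f (x + t *\<^sub>R v)) - real_of_ereal (f x)) / t) \<longlongrightarrow> blinfun_apply \<phi> v) (at 0)"
      using lim by (simp add: q_def)
    fix \<psi> :: "'a dual"
    assume "\<forall>v. ((\<lambda>t. (real_of_ereal (f (x + t *\<^sub>R v)) - real_of_ereal (f x)) / t) \<longlongrightarrow> blinfun_apply \<psi> v) (at 0)"
    then have "blinfun_apply \<psi> v = blinfun_apply \<phi> v" for v
      using lim[of v] unfolding q_def by (intro LIM_unique) auto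
    then show "\<psi> = \<phi>" by (intro blinfun_eqI) auto
  qed
qed

lemma convex_singleton_fun: "convex (epi (\<lambda>y. if y = x then 0 else \<infinity>))"
  by (rule convexI) (auto split: if_splits simp flip: scaleR_add_left)

text \<open>The sum rule with the indicator of \<open>{x}\<close>, for which \<open>x\<close> is
  trivially a minimizer.\<close>

lemma subgradient_exists:
  fixes f :: "'a::banach \<Rightarrow> ereal"
  assumes f: "closed_convex_fun f" and x: "x \<in> interior (edom f)"
  shows "x \<in> op_dom (subdifferential f)"
proof -
  obtain r M where r: "0 < r" "\<And>u. norm (u - x) < r \<Longrightarrow> f u \<le> ereal M"
    using bounded_above_near_interior[OF f x] by blast
  have "f x < \<infinity>" using x interior_subset by (auto simp: edom_def)
  define k :: "'a \<Rightarrow> ereal" where "k y = (if y = x then 0 else \<infinity>)" for y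
  have "convex (epi k)"
    using convex_singleton_fun unfolding k_def .
  moreover have "f x + k x \<le> f y + k y" for y
    using closed_convex_funD(1)[OF f, of y] by (cases "f y") (auto simp: k_def)
  ultimately obtain \<phi> where "\<phi> \<in> subdifferential f x"
    using subdifferential_sum_rule[of f k r x M x] closed_convex_funD(1,3)[OF f] r \<open>f x < \<infinity>\<close>
    by (force simp: k_def)
  then show ?thesis by (auto simp: op_dom_def)
qed

section \<open>Calculus of closed convex functions\<close>

lemma closed_convex_fun_add_continuous:
  fixes k :: "'a::real_normed_vector \<Rightarrow> real"
  assumes f: "closed_convex_fun f" and k: "convex_on UNIV k" "continuous_on UNIV k"
  shows "closed_convex_fun (\<lambda>x. f x + ereal (k x))"
proof -
  have *: "f x + ereal (k x) \<le> ereal a \<longleftrightarrow> f x \<le> ereal (a - k x)" for x a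
    by (cases "f x") auto
  have "epi (\<lambda>x. f x + ereal (k x)) = (\<lambda>z. (fst z, snd z - k (fst z))) -` epi f"
    by (auto simp: *)
  moreover have "closed ((\<lambda>z. (fst z, snd z - k (fst z))) -` epi f)"
    using closed_convex_funD(4)[OF f]
    by (intro closed_vimage continuous_intros continuous_on_compose2[OF k(2)]) auto
  ultimately have "closed (epi (\<lambda>x. f x + ereal (k x)))" by simp
  moreover have "convex (epi (\<lambda>x. f x + ereal (k x)))"
  proof (rule convexI, clarsimp simp: *)
    fix x y and a b s t :: real
    assume st: "f x \<le> ereal (a - k x)" "f y \<le> ereal (b - k y)" "0 \<le> s" "0 \<le> t" "s + t = 1"
    have "f (s *\<^sub>R x + t *\<^sub>R y) \<le> ereal (s * (a - k x) + t * (b - k y))"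
      by (rule epi_convexD[OF closed_convex_funD(3)[OF f]]) (use st in auto)
    moreover have "k (s *\<^sub>R x + t *\<^sub>R y) \<le> s * k x + t * k y"
      using k(1) st by (auto simp: convex_on_def)
    ultimately show "f (s *\<^sub>R x + t *\<^sub>R y) \<le> ereal (s * a + t * b - k (s *\<^sub>R x + t *\<^sub>R y))"
      by (elim order_trans) (simp add: algebra_simps)
  qed
  moreover have "f x + ereal (k x) \<noteq> -\<infinity>" for x
    using closed_convex_funD(1)[OF f, of x] by (cases "f x") auto
  moreover have "edom (\<lambda>x. f x + ereal (k x)) \<noteq> {}"
    using closed_convex_funD(2)[OF f] by (auto simp: edom_def)
  ultimately show ?thesis by (simp add: closed_convex_fun_def)
qed

lemma closed_convex_fun_restrict:
  assumes f: "closed_convex_fun f" and C: "closed C" "convex C" "C \<inter> edom f \<noteq> {}"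
  shows "closed_convex_fun (\<lambda>x. if x \<in> C then f x else \<infinity>)"
proof -
  have "epi (\<lambda>x. if x \<in> C then f x else \<infinity>) = epi f \<inter> C \<times> UNIV"
    by (auto split: if_splits)
  moreover have "closed (epi f \<inter> C \<times> UNIV)" "convex (epi f \<inter> C \<times> UNIV)"
    using closed_convex_funD[OF f] C by (auto intro!: closed_Int convex_Int closed_Times convex_Times)
  ultimately show ?thesis
    using closed_convex_funD(1)[OF f] C(3) by (auto simp: closed_convex_fun_def edom_def)
qed

lemma closed_convex_fun_conjugate:
  assumes f: "closed_convex_fun f"
  shows "closed_convex_fun (conjugate f)"
proof -
  note le = conjugate_le_iff[OF closed_convex_funD(1)[OF f]]
  have "closed {p :: 'a dual \<times> real. blinfun_apply (fst p) u - snd p \<le> a}" for u a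
    by (intro closed_Collect_le continuous_intros)
  then have "closed (\<Inter>z\<in>epi f. {p :: 'a dual \<times> real. blinfun_apply (fst p) (fst z) - snd p \<le> snd z})"
    by (intro closed_INT) auto
  moreover have "epi (conjugate f) = (\<Inter>z\<in>epi f. {p. blinfun_apply (fst p) (fst z) - snd p \<le> snd z})"
    by (auto simp: le epi_def)
  ultimately have "closed (epi (conjugate f))" by simp
  moreover have "convex (epi (conjugate f))"
    by (rule convex_epi_conjugate) (rule closed_convex_funD(1)[OF f])
  moreover have "conjugate f \<phi> \<noteq> -\<infinity>" for \<phi>
  proof
    assume *: "conjugate f \<phi> = -\<infinity>"
    obtain z where "z \<in> edom f" using closed_convex_funD(2)[OF f] by blast
    then obtain a where a: "f z = ereal a" using closed_convex_fun_finite[OF f] by blast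
    have "conjugate f \<phi> \<le> ereal (blinfun_apply \<phi> z - a - 1)" by (simp add: *)
    then have "blinfun_apply \<phi> z - (blinfun_apply \<phi> z - a - 1) \<le> a"
      unfolding le using a by (metis order_refl)
    then show False by simp
  qed
  moreover have "edom (conjugate f) \<noteq> {}"
  proof -
    obtain \<phi> :: "'a dual" and d where d: "\<And>u. ereal (blinfun_apply \<phi> u + d) \<le> f u"
      using affine_minorant_exists[OF f] by blast
    have "conjugate f \<phi> \<le> ereal (- d)"
      unfolding le
    proof (intro allI impI)
      fix u a assume "f u \<le> ereal a"
      with d[of u] have "ereal (blinfun_apply \<phi> u + d) \<le> ereal a" by (rule order_trans)
      then show "blinfun_apply \<phi> u - - d \<le> a" by simp
    qed
    then have "\<phi> \<in> edom (conjugate f)" by (auto simp: edom_def less_top[symmetric])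
    then show ?thesis by blast
  qed
  ultimately show ?thesis by (simp add: closed_convex_fun_def)
qed

text \<open>From the conjugate back to \<open>f\<close> closedness matters: if \<open>f x\<close>
  exceeded \<open>\<phi> x - b\<close>, an affine minorant of \<open>f\<close> above that value at
  \<open>x\<close> would violate the subgradient inequality of the conjugate at its own
  slope.\<close>

lemma subdifferential_conjugate_iff:
  assumes f: "closed_convex_fun f"
  shows "bidual_embed x \<in> subdifferential (conjugate f) \<phi> \<longleftrightarrow> \<phi> \<in> subdifferential f x"
proof
  note le = conjugate_le_iff[OF closed_convex_funD(1)[OF f]]
  assume "bidual_embed x \<in> subdifferential (conjugate f) \<phi>"
  then obtain b where b: "conjugate f \<phi> = ereal b" and
    sub: "\<And>\<psi> c. conjugate f \<psi> \<le> ereal c \<Longrightarrow> b + blinfun_apply (\<psi> - \<phi>) x \<le> c"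
    by (rule subdifferentialE[OF closed_convex_fun_conjugate[OF f]]) auto
  have "conjugate f \<phi> \<le> ereal b" using b by simp
  then have upper: "blinfun_apply \<phi> u - b \<le> a" if "f u \<le> ereal a" for u a
    unfolding le using that by blast
  have "f x \<le> ereal (blinfun_apply \<phi> x - b)"
  proof (rule ccontr)
    assume "\<not> ?thesis"
    then obtain \<psi> d where d: "\<And>u. ereal (blinfun_apply \<psi> u + d) \<le> f u"
      "blinfun_apply \<phi> x - b < blinfun_apply \<psi> x + d"
      using affine_minorant_above[OF f, of "blinfun_apply \<phi> x - b" x] by (metis not_le)
    have "conjugate f \<psi> \<le> ereal (- d)"
      unfolding le using d(1) order_trans by fastforce
    from sub[OF this] d(2) show False by (simp add: blinfun.diff_left)
  qed
  then have fx: "f x = ereal (blinfun_apply \<phi> x - b)"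
    using upper[of x] closed_convex_funD(1)[OF f, of x] by (cases "f x") fastforce+
  show "\<phi> \<in> subdifferential f x"
    unfolding subdifferential_iff[of f, OF fx closed_convex_funD(1)[OF f]]
    using upper by (auto simp: blinfun.diff_right)
next
  note le = conjugate_le_iff[OF closed_convex_funD(1)[OF f]]
  assume "\<phi> \<in> subdifferential f x"
  then obtain a where a: "f x = ereal a" and
    sub: "\<And>y b. f y \<le> ereal b \<Longrightarrow> a + blinfun_apply \<phi> (y - x) \<le> b"
    by (rule subdifferentialE[OF f]) blast
  have lower: "blinfun_apply \<psi> x - a \<le> c" if "conjugate f \<psi> \<le> ereal c" for \<psi> c
    using that[unfolded le, rule_format, of x a] a by simp
  have "conjugate f \<phi> \<le> ereal (blinfun_apply \<phi> x - a)"
    unfolding le using sub by (fastforce simp: blinfun.diff_right)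
  then have cf: "conjugate f \<phi> = ereal (blinfun_apply \<phi> x - a)"
    using lower[of \<phi>] closed_convex_funD(1)[OF closed_convex_fun_conjugate[OF f], of \<phi>]
    by (cases "conjugate f \<phi>") fastforce+
  show "bidual_embed x \<in> subdifferential (conjugate f) \<phi>"
    unfolding subdifferential_iff[of "conjugate f", OF cf closed_convex_funD(1)[OF closed_convex_fun_conjugate[OF f]]]
    using lower by (auto simp: blinfun.diff_left)
qed

section \<open>Legendre functions\<close>

lemma norming_functional:
  fixes u :: "'a::real_normed_vector"
  obtains e :: "'a dual" where "norm e \<le> 1" "blinfun_apply e u = norm u"
proof -
  define E where "E = {(v :: 'a, a). norm v \<le> a}"
  have "convex E"
  proof (rule convexI, clarsimp simp: E_def)
    fix v w :: 'a and a b s t :: real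
    assume *: "norm v \<le> a" "norm w \<le> b" "0 \<le> s" "0 \<le> t"
    have "norm (s *\<^sub>R v + t *\<^sub>R w) \<le> s * norm v + t * norm w"
      using norm_triangle_ineq[of "s *\<^sub>R v" "t *\<^sub>R w"] * by simp
    also have "\<dots> \<le> s * a + t * b"
      using * by (intro add_mono mult_left_mono) auto
    finally show "norm (s *\<^sub>R v + t *\<^sub>R w) \<le> s * a + t * b" .
  qed
  moreover have "(v, norm u + 1) \<in> E" if "norm (v - u) < 1" for v
    using that norm_triangle_ineq2[of v u] by (simp add: E_def)
  ultimately obtain \<phi> :: "'a dual" and c where
    1: "\<And>x a. (x, a) \<in> E \<Longrightarrow> blinfun_apply \<phi> x + c \<le> a" and
    2: "\<And>x b. (x, b) \<in> {(u, - norm u)} \<Longrightarrow> - blinfun_apply \<phi> x - c \<le> b"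
    using sandwich[of E "{(u, - norm u)}" 1 u "norm u + 1" "- norm u"]
    by (auto simp: E_def)
  have c: "c \<le> 0" using 1[of 0 0] by (simp add: E_def)
  have le: "blinfun_apply \<phi> v \<le> norm v" for v
  proof (rule ccontr)
    assume "\<not> ?thesis"
    then have d: "0 < blinfun_apply \<phi> v - norm v" by simp
    \<comment> \<open>Scaling \<open>v\<close> by \<open>t\<close> raises the excess over the norm
      to \<open>1 - c\<close>, while only \<open>- c\<close> is allowed.\<close>
    define t where "t = (1 - c) / (blinfun_apply \<phi> v - norm v)"
    have t: "0 \<le> t" using d c by (simp add: t_def)
    have "blinfun_apply \<phi> (t *\<^sub>R v) + c \<le> norm (t *\<^sub>R v)"
      by (rule 1) (simp add: E_def)
    then have "t * (blinfun_apply \<phi> v - norm v) \<le> - c"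
      using t by (simp add: blinfun.scaleR_right algebra_simps)
    moreover have "t * (blinfun_apply \<phi> v - norm v) = 1 - c" using d by (simp add: t_def)
    ultimately show False by simp
  qed
  have "\<bar>blinfun_apply \<phi> v\<bar> \<le> norm v" for v
    using le[of v] le[of "- v"] by (simp add: blinfun.minus_right abs_le_iff)
  then have "norm \<phi> \<le> 1"
    by (intro norm_blinfun_bound) auto
  moreover have "blinfun_apply \<phi> u = norm u"
    using 2[of u "- norm u"] le[of u] c by simp
  ultimately show ?thesis by (rule that)
qed

section \<open>Reflexivity of duals and products\<close>

lemma reflexive_dual:
  assumes "reflexive_space TYPE('a::real_normed_vector)"
  shows "reflexive_space TYPE('a dual)"
  unfolding reflexive_space_def surj_def
proof
  fix \<Xi> :: "'a dual dual dual"
  have bl: "bounded_linear (bidual_embed :: 'a \<Rightarrow> 'a dual dual)"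
  proof (rule bounded_linear_intro[where K=1])
    show "norm (bidual_embed x) \<le> norm x * 1" for x :: 'a
    proof (rule norm_blinfun_bound)
      show "norm (blinfun_apply (bidual_embed x) \<phi>) \<le> norm x * 1 * norm \<phi>" for \<phi>
        using norm_blinfun[of \<phi> x] by (simp add: mult.commute)
    qed simp
  qed (auto intro!: blinfun_eqI simp: blinfun.add_left blinfun.add_right blinfun.scaleR_left blinfun.scaleR_right)
  define \<phi> where "\<phi> = Blinfun (\<lambda>x. blinfun_apply \<Xi> (bidual_embed x))"
  have \<phi>: "blinfun_apply \<phi> x = blinfun_apply \<Xi> (bidual_embed x)" for x
    unfolding \<phi>_def
    by (subst bounded_linear_Blinfun_apply)
      (auto intro: bounded_linear_compose[OF blinfun.bounded_linear_right bl])
  have "blinfun_apply \<Xi> \<xi> = blinfun_apply (bidual_embed \<phi>) \<xi>" for \<xi>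
  proof -
    obtain x where "\<xi> = bidual_embed x"
      using assms by (auto simp: reflexive_space_def surj_def)
    then show ?thesis using \<phi> by simp
  qed
  then show "\<exists>\<phi>. \<Xi> = bidual_embed \<phi>"
    by (intro exI[of _ \<phi>] blinfun_eqI)
qed

definition pair_dual :: "'a::real_normed_vector dual \<Rightarrow> 'b::real_normed_vector dual \<Rightarrow> ('a \<times> 'b) dual" where
  "pair_dual \<phi> \<psi> = (\<phi> o\<^sub>L fst_blinfun) + (\<psi> o\<^sub>L snd_blinfun)"

lemma pair_dual_apply [simp]:
  "blinfun_apply (pair_dual \<phi> \<psi>) z = blinfun_apply \<phi> (fst z) + blinfun_apply \<psi> (snd z)"
  by (simp add: pair_dual_def blinfun.add_left fst_blinfun.rep_eq snd_blinfun.rep_eq)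

lemma pair_dual_cases:
  fixes \<Phi> :: "('a::real_normed_vector \<times> 'b::real_normed_vector) dual"
  obtains \<phi> \<psi> where "\<Phi> = pair_dual \<phi> \<psi>"
proof -
  define \<phi> \<psi> where "\<phi> = Blinfun (\<lambda>u. blinfun_apply \<Phi> (u, 0))" and "\<psi> = Blinfun (\<lambda>v. blinfun_apply \<Phi> (0, v))"
  have \<phi>: "blinfun_apply \<phi> u = blinfun_apply \<Phi> (u, 0)" for u
    unfolding \<phi>_def by (subst bounded_linear_Blinfun_apply) (auto intro!: bounded_linear_intros bounded_linear_Pair)
  have \<psi>: "blinfun_apply \<psi> v = blinfun_apply \<Phi> (0, v)" for v
    unfolding \<psi>_def by (subst bounded_linear_Blinfun_apply) (auto intro!: bounded_linear_intros bounded_linear_Pair)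
  have "blinfun_apply \<Phi> z = blinfun_apply (pair_dual \<phi> \<psi>) z" for z
    using blinfun.add_right[of \<Phi> "(fst z, 0)" "(0, snd z)"] by (simp add: \<phi> \<psi>)
  then have "\<Phi> = pair_dual \<phi> \<psi>" by (rule blinfun_eqI)
  then show ?thesis by (rule that)
qed

lemma reflexive_prod:
  assumes "reflexive_space TYPE('a::real_normed_vector)" "reflexive_space TYPE('b::real_normed_vector)"
  shows "reflexive_space TYPE('a \<times> 'b)"
  unfolding reflexive_space_def surj_def
proof
  fix \<Xi> :: "('a \<times> 'b) dual dual"
  define \<xi> \<eta> where "\<xi> = Blinfun (\<lambda>\<phi>. blinfun_apply \<Xi> (\<phi> o\<^sub>L fst_blinfun))"
    and "\<eta> = Blinfun (\<lambda>\<psi>. blinfun_apply \<Xi> (\<psi> o\<^sub>L snd_blinfun))"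
  have \<xi>: "blinfun_apply \<xi> \<phi> = blinfun_apply \<Xi> (\<phi> o\<^sub>L fst_blinfun)" for \<phi>
    unfolding \<xi>_def by (subst bounded_linear_Blinfun_apply) (auto intro!: bounded_linear_intros)
  have \<eta>: "blinfun_apply \<eta> \<psi> = blinfun_apply \<Xi> (\<psi> o\<^sub>L snd_blinfun)" for \<psi>
    unfolding \<eta>_def by (subst bounded_linear_Blinfun_apply) (auto intro!: bounded_linear_intros)
  obtain x y where xy: "\<xi> = bidual_embed x" "\<eta> = bidual_embed y"
    using assms by (metis reflexive_space_def surjD)
  have "blinfun_apply \<Xi> \<Phi> = blinfun_apply (bidual_embed (x, y)) \<Phi>" for \<Phi>
  proof -
    obtain \<phi> \<psi> where \<Phi>: "\<Phi> = pair_dual \<phi> \<psi>" by (rule pair_dual_cases)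
    have "blinfun_apply \<Xi> \<Phi> = blinfun_apply \<xi> \<phi> + blinfun_apply \<eta> \<psi>"
      by (simp add: \<Phi> pair_dual_def blinfun.add_right \<xi> \<eta>)
    then show ?thesis by (simp add: xy \<Phi>)
  qed
  then show "\<exists>z. \<Xi> = bidual_embed z"
    by (intro exI[of _ "(x, y)"] blinfun_eqI)
qed

lemma convex_epi_real:
  assumes "convex_on UNIV k"
  shows "convex (epi (\<lambda>x. ereal (k x)))"
proof (rule convexI, clarsimp)
  fix x y and a b s t :: real
  assume *: "k x \<le> a" "k y \<le> b" "0 \<le> s" "0 \<le> t" "s + t = 1"
  have "k (s *\<^sub>R x + t *\<^sub>R y) \<le> s * k x + t * k y"
    using assms * by (auto simp: convex_on_def)
  also have "\<dots> \<le> s * a + t * b"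
    using * by (intro add_mono mult_left_mono) auto
  finally show "k (s *\<^sub>R x + t *\<^sub>R y) \<le> s * a + t * b" .
qed

text \<open>The point \<open>u\<close> minimizes \<open>f + K dist w\<close>, and \<open>q\<close> comes from the sum rule.\<close>

lemma distance_penalty_subgradient:
  fixes f :: "'a::real_normed_vector \<Rightarrow> ereal"
  assumes refl: "reflexive_space TYPE('a)" and f: "closed_convex_fun f"
    and minor: "\<And>u. ereal (blinfun_apply p u + d) \<le> f u" and K: "norm p < K"
  shows "\<exists>u q. q \<in> subdifferential f u \<and> (u \<noteq> w \<longrightarrow> K \<le> norm q) \<and>
    (\<forall>v b. f v \<le> ereal b \<longrightarrow> f u \<le> ereal (b + K * dist w v - K * dist w u))"
proof -
  have K0: "0 \<le> K" using K norm_ge_zero[of p] by linarith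
  define k where "k u = K * dist w u" for u
  have k: "convex_on UNIV k"
    unfolding k_def by (intro convex_on_cmul K0 convex_on_dist) auto
  have "closed_convex_fun (\<lambda>u. f u + ereal (k u))"
    by (intro closed_convex_fun_add_continuous f k) (auto simp: k_def intro!: continuous_intros)
  moreover have "ereal ((K - norm p) * norm u - (K * norm w - d)) \<le> f u + ereal (k u)" for u
  proof -
    have "- (norm p * norm u) \<le> blinfun_apply p u"
      using norm_blinfun[of p u] by (simp add: abs_le_iff)
    moreover have "norm u - norm w \<le> dist w u"
      using norm_triangle_ineq2[of u w] by (simp add: dist_norm norm_minus_commute)
    then have "K * (norm u - norm w) \<le> K * dist w u" using K0 by (rule mult_left_mono)
    ultimately have "(K - norm p) * norm u - (K * norm w - d) \<le> (blinfun_apply p u + d) + k u"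
      by (simp add: k_def algebra_simps)
    then have "ereal ((K - norm p) * norm u - (K * norm w - d)) \<le> ereal (blinfun_apply p u + d) + ereal (k u)"
      by simp
    also have "\<dots> \<le> f u + ereal (k u)" by (intro add_right_mono minor)
    finally show ?thesis .
  qed
  ultimately obtain u where u: "\<And>v. f u + ereal (k u) \<le> f v + ereal (k v)"
    using coercive_minimizer_exists[OF refl, of "\<lambda>u. f u + ereal (k u)" "K - norm p" "K * norm w - d"] K
    by auto
  obtain z where "z \<in> edom f" using closed_convex_funD(2)[OF f] by blast
  then have z: "f z < \<infinity>" by (simp add: edom_def)
  have fu: "f u < \<infinity>" using u[of z] z by (cases "f u"; cases "f z") auto
  have "ereal (k v) \<le> ereal (K * (dist w z + 1))" if "norm (v - z) < 1" for v
    using that dist_triangle[of w v z] K0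
    by (auto simp: k_def dist_norm norm_minus_commute intro!: mult_left_mono)
  then obtain \<phi> where \<phi>: "\<phi> \<in> subdifferential (\<lambda>u. ereal (k u)) u" "- \<phi> \<in> subdifferential f u"
    using subdifferential_sum_rule[of "\<lambda>u. ereal (k u)" f 1 z "K * (dist w z + 1)" u] u fu z
      convex_epi_real[OF k] closed_convex_funD(1,3)[OF f] by (force simp: add.commute)
  \<comment> \<open>Towards \<open>w\<close> the penalty decreases at slope \<open>K\<close>, so its
    subgradients away from \<open>w\<close> have norm at least \<open>K\<close>.\<close>
  have "K \<le> norm (- \<phi>)" if "u \<noteq> w"
  proof -
    have "blinfun_apply \<phi> (w - u) + k u \<le> k w"
      using \<phi>(1) by (auto simp: subdifferential_def)
    moreover have "- (norm \<phi> * norm (w - u)) \<le> blinfun_apply \<phi> (w - u)"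
      using norm_blinfun[of \<phi> "w - u"] by (simp add: abs_le_iff)
    ultimately have "K * norm (w - u) \<le> norm \<phi> * norm (w - u)"
      by (simp add: k_def dist_norm)
    then show ?thesis using that by simp
  qed
  moreover have "f u \<le> ereal (b + K * dist w v - K * dist w u)" if "f v \<le> ereal b" for v b
    using u[of v] that fu closed_convex_funD(1)[OF f, of u]
    by (cases "f u"; cases "f v") (auto simp: k_def)
  ultimately show ?thesis using \<phi>(2) by blast
qed

section \<open>The domain of the subdifferential\<close>

lemma op_dom_subdifferential_nonempty:
  fixes f :: "'a::real_normed_vector \<Rightarrow> ereal"
  assumes "reflexive_space TYPE('a)" "closed_convex_fun f"
  shows "op_dom (subdifferential f) \<noteq> {}"
proof -
  obtain p :: "'a dual" and d where p: "\<And>u. ereal (blinfun_apply p u + d) \<le> f u"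
    using affine_minorant_exists[OF assms(2)] by blast
  have "norm p < norm p + 1" by simp
  from distance_penalty_subgradient[OF assms p this]
  obtain u q where "q \<in> subdifferential f u" by blast
  then show ?thesis by (auto simp: op_dom_def)
qed

text \<open>For \<open>w\<close> near \<open>x\<close> a minimizer \<open>u\<close> of
  \<open>f\<close> plus \<open>C + 1\<close> times the distance to \<open>w\<close> stays in the
  neighbourhood \<open>U\<close> on which subgradients have norm at most \<open>C\<close>. If
  \<open>u\<close> differed from \<open>w\<close>, it would have a subgradient of norm at least
  \<open>C + 1\<close>; hence \<open>u = w\<close>, and \<open>w\<close> has a subgradient.\<close>

theorem open_op_dom_subdifferential:
  fixes f :: "'a::real_normed_vector \<Rightarrow> ereal"
  assumes refl: "reflexive_space TYPE('a)" and f: "closed_convex_fun f"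
    and lb: "locally_bounded_on_dom (subdifferential f)"
  shows "open (op_dom (subdifferential f))"
  unfolding open_dist
proof
  fix x assume x: "x \<in> op_dom (subdifferential f)"
  then obtain U where U: "open U" "x \<in> U" "bounded (\<Union>y\<in>U. subdifferential f y)"
    using lb by (auto simp: locally_bounded_on_dom_def)
  obtain C where C: "\<And>y q. y \<in> U \<Longrightarrow> q \<in> subdifferential f y \<Longrightarrow> norm q \<le> C"
    using U(3) unfolding bounded_iff by blast
  obtain \<rho> where \<rho>: "0 < \<rho>" "ball x \<rho> \<subseteq> U"
    using U(1,2) by (meson open_contains_ball)
  obtain p where p: "p \<in> subdifferential f x" using x by (auto simp: op_dom_def)
  then obtain a where a: "f x = ereal a" and
    sub: "\<And>y b. f y \<le> ereal b \<Longrightarrow> a + blinfun_apply p (y - x) \<le> b"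
    by (rule subdifferentialE[OF f]) blast
  have pC: "norm p \<le> C" using C U(2) p by blast
  then have C0: "0 \<le> C" using norm_ge_zero[of p] by linarith
  have minor: "ereal (blinfun_apply p u + (a - blinfun_apply p x)) \<le> f u" for u
  proof (rule ereal_le_if_real_le)
    fix b assume "f u \<le> ereal b"
    from sub[OF this] show "blinfun_apply p u + (a - blinfun_apply p x) \<le> b"
      by (simp add: blinfun.diff_right)
  qed (rule closed_convex_funD(1)[OF f])
  have "w \<in> op_dom (subdifferential f)" if w: "dist w x < \<rho> / (2 * C + 2)" for w
  proof -
    have "norm p < C + 1" using pC by simp
    from distance_penalty_subgradient[OF refl f minor this, of w]
    obtain u q where q: "q \<in> subdifferential f u" and uw: "u \<noteq> w \<Longrightarrow> C + 1 \<le> norm q"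
      and le: "\<And>v b. f v \<le> ereal b \<Longrightarrow> f u \<le> ereal (b + (C + 1) * dist w v - (C + 1) * dist w u)"
      by blast
    \<comment> \<open>Comparing \<open>u\<close> with \<open>x\<close> and bounding
      \<open>f u\<close> below through \<open>p\<close> gives
      \<open>dist w u \<le> (2 * C + 1) * dist w x\<close>; one more triangle inequality explains
      the radius \<open>\<rho> / (2 * C + 2)\<close>.\<close>
    have "a + blinfun_apply p (u - x) \<le> a + (C + 1) * dist w x - (C + 1) * dist w u"
      by (intro sub le) (simp add: a)
    moreover have "- (C * dist u x) \<le> blinfun_apply p (u - x)"
    proof -
      have "\<bar>blinfun_apply p (u - x)\<bar> \<le> norm p * dist u x"
        using norm_blinfun[of p "u - x"] by (simp add: dist_norm)
      also have "\<dots> \<le> C * dist u x" using pC by (intro mult_right_mono) auto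
      finally show ?thesis by simp
    qed
    moreover have tri: "dist u x \<le> dist w u + dist w x"
      using dist_triangle[of u x w] by (simp add: dist_commute)
    then have "C * dist u x \<le> C * (dist w u + dist w x)" using C0 by (rule mult_left_mono)
    ultimately have "dist w u \<le> (2 * C + 1) * dist w x"
      by (simp add: algebra_simps)
    with tri have "dist u x \<le> (2 * C + 2) * dist w x" by (simp add: algebra_simps)
    also have "\<dots> < \<rho>" using w C0 by (simp add: field_simps)
    finally have "u \<in> U" using \<rho>(2) by (auto simp: dist_commute)
    then have "u = w" using C q uw by force
    then show ?thesis using q by (auto simp: op_dom_def)
  qed
  moreover have "0 < \<rho> / (2 * C + 2)" using \<rho>(1) C0 by simp
  ultimately show "\<exists>e>0. \<forall>y. dist y x < e \<longrightarrow> y \<in> op_dom (subdifferential f)" by blast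
qed

corollary op_dom_subdifferential_eq_interior:
  fixes f :: "'a::banach \<Rightarrow> ereal"
  assumes "reflexive_space TYPE('a)" "closed_convex_fun f" "locally_bounded_on_dom (subdifferential f)"
  shows "op_dom (subdifferential f) = interior (edom f)"
  using interior_maximal[OF op_dom_subdifferential_subset open_op_dom_subdifferential] assms
    subgradient_exists[OF assms(2)] by blast

text \<open>The consequences of the Legendre property that are inherited by separable sums.\<close>

definition bregman_fun :: "('a::real_normed_vector \<Rightarrow> ereal) \<Rightarrow> bool" where
  "bregman_fun f \<longleftrightarrow> closed_convex_fun f \<and> interior (edom f) \<noteq> {} \<and>
    op_dom (subdifferential f) = interior (edom f) \<and>
    (\<forall>x. \<forall>p\<in>subdifferential f x. \<forall>q\<in>subdifferential f x. p = q) \<and>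
    strictly_convex_fun_on (interior (edom f)) f \<and>
    (\<forall>x. \<forall>p\<in>subdifferential f x. \<exists>\<alpha>>0. \<exists>\<beta>. \<forall>u.
      ereal (blinfun_apply p u + \<alpha> * norm u - \<beta>) \<le> f u)"

lemma strictly_convex_subgradients:
  assumes f: "closed_convex_fun f" and S: "strictly_convex_fun_on S f" "x \<in> S" "y \<in> S" "x \<noteq> y"
    and p: "p \<in> subdifferential f x" and q: "q \<in> subdifferential f y"
  shows "0 < blinfun_apply (p - q) (x - y)"
proof -
  obtain a where a: "f x = ereal a" "\<And>y b. f y \<le> ereal b \<Longrightarrow> a + blinfun_apply p (y - x) \<le> b"
    using p by (rule subdifferentialE[OF f]) blast
  obtain b where b: "f y = ereal b" "\<And>x a. f x \<le> ereal a \<Longrightarrow> b + blinfun_apply q (x - y) \<le> a"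
    using q by (rule subdifferentialE[OF f]) blast
  define z where "z = (1 / 2) *\<^sub>R x + (1 / 2) *\<^sub>R y"
  have "(1 / 2 :: real) \<in> {0<..<1}" by simp
  then have "f ((1 / 2) *\<^sub>R x + (1 - 1 / 2) *\<^sub>R y) < ereal (1 / 2) * f x + ereal (1 - 1 / 2) * f y"
    using S unfolding strictly_convex_fun_on_def by blast
  then have "f z < ereal (a / 2 + b / 2)" by (simp add: z_def a b)
  moreover obtain c where c: "f z = ereal c"
    using calculation closed_convex_funD(1)[OF f, of z] by (cases "f z") auto
  ultimately have "c < a / 2 + b / 2" by simp
  moreover have "a + blinfun_apply p (z - x) \<le> c" "b + blinfun_apply q (z - y) \<le> c"
    using a(2)[of z c] b(2)[of z c] c by auto
  moreover have "z - x = - (1 / 2) *\<^sub>R (x - y)" "z - y = (1 / 2) *\<^sub>R (x - y)"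
    by (auto simp: z_def algebra_simps simp flip: scaleR_add_left)
  then have "blinfun_apply p (z - x) = - (blinfun_apply p (x - y) / 2)"
    "blinfun_apply q (z - y) = blinfun_apply q (x - y) / 2"
    by (simp_all add: blinfun.scaleR_right blinfun.minus_right)
  ultimately show ?thesis by (simp add: blinfun.diff_left)
qed

lemma bregman_funD:
  assumes "bregman_fun f"
  shows "closed_convex_fun f" "interior (edom f) \<noteq> {}"
    "op_dom (subdifferential f) = interior (edom f)"
    "p \<in> subdifferential f x \<Longrightarrow> q \<in> subdifferential f x \<Longrightarrow> p = q"
    "strictly_convex_fun_on (interior (edom f)) f"
  using assms by (auto simp: bregman_fun_def)

lemma bregman_fun_coercive:
  assumes "bregman_fun f" "p \<in> subdifferential f x"
  obtains \<alpha> \<beta> where "0 < \<alpha>" "\<And>u. ereal (blinfun_apply p u + \<alpha> * norm u - \<beta>) \<le> f u"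
proof -
  have "\<forall>p\<in>subdifferential f x. \<exists>\<alpha>>0. \<exists>\<beta>. \<forall>u. ereal (blinfun_apply p u + \<alpha> * norm u - \<beta>) \<le> f u"
    using assms(1) by (simp add: bregman_fun_def)
  then show ?thesis using assms(2) that by blast
qed

text \<open>Used to end optimality arguments: once the sum rule has produced a subgradient at a
  minimizer, the minimizer is known to be interior and the subgradient to be the gradient.\<close>

lemma bregman_fun_subdifferential:
  fixes f :: "'a::banach \<Rightarrow> ereal"
  assumes f: "bregman_fun f"
  shows "p \<in> subdifferential f x \<longleftrightarrow> x \<in> interior (edom f) \<and> p = gradient f x"
proof -
  have "x \<in> interior (edom f)" "p = gradient f x" if p: "p \<in> subdifferential f x" for p
  proof -
    show x: "x \<in> interior (edom f)"
      using p bregman_funD(3)[OF f] by (auto simp: op_dom_def)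
    obtain r M where "0 < r" "\<And>u. norm (u - x) < r \<Longrightarrow> f u \<le> ereal M"
      using bounded_above_near_interior[OF bregman_funD(1)[OF f] x] by blast
    with p show "p = gradient f x"
      using gradient_eq_unique_subgradient[OF bregman_funD(1)[OF f]] bregman_funD(4)[OF f] by metis
  qed
  moreover have "\<exists>p. p \<in> subdifferential f x" if "x \<in> interior (edom f)"
    using that bregman_funD(3)[OF f] by (auto simp: op_dom_def)
  ultimately show ?thesis by blast
qed

lemma strictly_monotone_gradient:
  fixes f :: "'a::banach \<Rightarrow> ereal"
  assumes f: "bregman_fun f" and x: "x \<in> interior (edom f)" "y \<in> interior (edom f)" "x \<noteq> y"
  shows "0 < blinfun_apply (gradient f x - gradient f y) (x - y)"
  using strictly_convex_subgradients[OF bregman_funD(1,5)[OF f] x]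
    bregman_fun_subdifferential[OF f] x by blast

lemma legendre_op_dom:
  fixes f :: "'a::banach \<Rightarrow> ereal"
  assumes refl: "reflexive_space TYPE('a)" and f: "legendre f"
  shows "op_dom (subdifferential f) = interior (edom f)"
    "op_dom (subdifferential (conjugate f)) = interior (edom (conjugate f))"
proof -
  have c: "closed_convex_fun f"
    using f by (auto simp: legendre_def intro: Gamma0_closed_convex_fun)
  show "op_dom (subdifferential f) = interior (edom f)"
    using f by (intro op_dom_subdifferential_eq_interior refl c) (auto simp: legendre_def essentially_smooth_def)
  show "op_dom (subdifferential (conjugate f)) = interior (edom (conjugate f))"
    using f by (intro op_dom_subdifferential_eq_interior reflexive_dual refl closed_convex_fun_conjugate c)
      (auto simp: legendre_def essentially_strictly_convex_def)
qed

text \<open>The growth clause comes from the conjugate: a subgradient \<open>p\<close> of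
  \<open>f\<close> is interior to the conjugate's domain, and boundedness of the conjugate on a ball
  around \<open>p\<close> makes \<open>f\<close> outgrow \<open>p\<close> by a multiple of the
  norm.\<close>

theorem legendre_bregman_fun:
  fixes f :: "'a::banach \<Rightarrow> ereal"
  assumes refl: "reflexive_space TYPE('a)" and f: "legendre f"
  shows "bregman_fun f"
  unfolding bregman_fun_def
proof (intro conjI allI ballI)
  show c: "closed_convex_fun f"
    using f by (auto simp: legendre_def intro: Gamma0_closed_convex_fun)
  note dom = legendre_op_dom[OF refl f]
  show "op_dom (subdifferential f) = interior (edom f)" by (rule dom)
  then show "interior (edom f) \<noteq> {}"
    using op_dom_subdifferential_nonempty[OF refl c] by simp
  show "p = q" if "p \<in> subdifferential f x" "q \<in> subdifferential f x" for x p q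
  proof -
    have "x \<in> op_dom (subdifferential f)" using that by (auto simp: op_dom_def)
    then obtain \<phi> where "subdifferential f x = {\<phi>}"
      using f by (auto simp: legendre_def essentially_smooth_def single_valued_on_dom_def)
    then show ?thesis using that by simp
  qed
  show "strictly_convex_fun_on (interior (edom f)) f"
    using f dom convex_interior[OF convex_edom[OF c]]
    by (auto simp: legendre_def essentially_strictly_convex_def)
  fix x p assume "p \<in> subdifferential f x"
  then have "bidual_embed x \<in> subdifferential (conjugate f) p"
    using subdifferential_conjugate_iff[OF c] by blast
  then have "p \<in> interior (edom (conjugate f))"
    using dom(2) by (auto simp: op_dom_def)
  then obtain r M where r: "0 < r" "\<And>q. norm (q - p) < r \<Longrightarrow> conjugate f q \<le> ereal M"
    using bounded_above_near_interior[OF closed_convex_fun_conjugate[OF c]] by blast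
  have "ereal (blinfun_apply p u + r / 2 * norm u - M) \<le> f u" for u
  proof (rule ereal_le_if_real_le)
    fix a assume a: "f u \<le> ereal a"
    \<comment> \<open>Moving \<open>p\<close> by \<open>r / 2\<close> in the direction norming
      \<open>u\<close> stays in the ball and yields the term \<open>r / 2 * norm u\<close>.\<close>
    obtain e :: "'a dual" where e: "norm e \<le> 1" "blinfun_apply e u = norm u"
      by (rule norming_functional)
    have "norm (p + (r / 2) *\<^sub>R e - p) < r"
      using e(1) r(1) mult_left_mono[OF e(1), of "r / 2"] by simp
    then have "conjugate f (p + (r / 2) *\<^sub>R e) \<le> ereal M" by (rule r(2))
    then have "blinfun_apply (p + (r / 2) *\<^sub>R e) u - M \<le> a"
      using a conjugate_le_iff[of f, OF closed_convex_funD(1)[OF c]] by blast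
    then show "blinfun_apply p u + r / 2 * norm u - M \<le> a"
      using e(2) by (simp add: blinfun.add_left blinfun.scaleR_left)
  qed (rule closed_convex_funD(1)[OF c])
  then show "\<exists>\<alpha>>0. \<exists>\<beta>. \<forall>u. ereal (blinfun_apply p u + \<alpha> * norm u - \<beta>) \<le> f u"
    using r(1) by (intro exI[of _ "r / 2"] conjI exI[of _ M] allI) auto
qed

text \<open>Inverting the subdifferential exchanges the properties: strict monotonicity of the
  gradient of \<open>f\<close> makes the subgradients of the conjugate unique, uniqueness of the
  subgradients of \<open>f\<close> makes the conjugate strictly convex, and boundedness of
  \<open>f\<close> near an interior point becomes growth of the conjugate. The biconjugate on the
  bidual never appears.\<close>

theorem legendre_conjugate_bregman_fun:
  fixes f :: "'a::banach \<Rightarrow> ereal"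
  assumes refl: "reflexive_space TYPE('a)" and f: "legendre f"
  shows "bregman_fun (conjugate f)"
  unfolding bregman_fun_def
proof (intro conjI allI ballI)
  note fB = legendre_bregman_fun[OF refl f]
  note c = bregman_funD(1)[OF fB]
  show c': "closed_convex_fun (conjugate f)" by (rule closed_convex_fun_conjugate[OF c])
  have refl': "\<exists>x. \<xi> = bidual_embed x" for \<xi> :: "'a dual dual"
    using refl by (auto simp: reflexive_space_def surj_def)
  note inv = subdifferential_conjugate_iff[OF c]
  show dom: "op_dom (subdifferential (conjugate f)) = interior (edom (conjugate f))"
    by (rule legendre_op_dom[OF refl f])
  show "interior (edom (conjugate f)) \<noteq> {}"
    using dom op_dom_subdifferential_nonempty[OF reflexive_dual[OF refl] c'] by simp
  show "\<xi> = \<eta>" if "\<xi> \<in> subdifferential (conjugate f) \<phi>" "\<eta> \<in> subdifferential (conjugate f) \<phi>" for \<phi> \<xi> \<eta>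
  proof -
    obtain x y where xy: "\<xi> = bidual_embed x" "\<eta> = bidual_embed y" using refl' by metis
    then have "\<phi> \<in> subdifferential f x" "\<phi> \<in> subdifferential f y" using that inv by auto
    then have "x = y"
      using bregman_fun_subdifferential[OF fB] strictly_monotone_gradient[OF fB, of x y] by auto
    then show ?thesis using xy by simp
  qed
  show "strictly_convex_fun_on (interior (edom (conjugate f))) (conjugate f)"
    unfolding strictly_convex_fun_on_def
  proof (intro ballI impI)
    fix \<phi> \<psi> and t :: real
    assume *: "\<phi> \<in> interior (edom (conjugate f))" "\<psi> \<in> interior (edom (conjugate f))" "\<phi> \<noteq> \<psi>" "t \<in> {0<..<1}"
    define \<theta> where "\<theta> = t *\<^sub>R \<phi> + (1 - t) *\<^sub>R \<psi>"
    have "\<theta> \<in> interior (edom (conjugate f))"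
      unfolding \<theta>_def using * convex_interior[OF convex_edom[OF c']] by (intro convexD) auto
    then obtain \<zeta> where "\<zeta> \<in> subdifferential (conjugate f) \<theta>"
      using dom by (auto simp: op_dom_def)
    then obtain x where x: "bidual_embed x \<in> subdifferential (conjugate f) \<theta>"
      using refl'[of \<zeta>] by auto
    then obtain b where b: "conjugate f \<theta> = ereal b" and
      sub: "\<And>\<omega> c. conjugate f \<omega> \<le> ereal c \<Longrightarrow> b + blinfun_apply (\<omega> - \<theta>) x \<le> c"
      by (rule subdifferentialE[OF c']) auto
    have fin: "\<exists>a. conjugate f \<omega> = ereal a" if "\<omega> \<in> interior (edom (conjugate f))" for \<omega>
      using that interior_subset closed_convex_fun_finite[OF c'] by blast
    obtain a1 where a1: "conjugate f \<phi> = ereal a1" using fin *(1) by blast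
    obtain a2 where a2: "conjugate f \<psi> = ereal a2" using fin *(2) by blast
    have le1: "b + blinfun_apply (\<phi> - \<theta>) x \<le> a1" using sub a1 by simp
    have le2: "b + blinfun_apply (\<psi> - \<theta>) x \<le> a2" using sub a2 by simp
    \<comment> \<open>Where the conjugate meets its affine minorant through \<open>\<theta>\<close>
      with slope \<open>x\<close>, that slope is a subgradient. If strictness failed, both endpoints
      would be such points and \<open>f\<close> would have two subgradients at
      \<open>x\<close>.\<close>
    have touch: "\<omega> \<in> {\<phi>. bidual_embed x \<in> subdifferential (conjugate f) \<phi>}"
      if "conjugate f \<omega> = ereal (b + blinfun_apply (\<omega> - \<theta>) x)" for \<omega>
      using sub that unfolding mem_Collect_eq
      by (subst subdifferential_iff[of "conjugate f", OF that closed_convex_funD(1)[OF c']])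
        (auto simp: blinfun.diff_left)
    have avg: "t * (b + blinfun_apply (\<phi> - \<theta>) x) + (1 - t) * (b + blinfun_apply (\<psi> - \<theta>) x) = b"
    proof -
      have "t * blinfun_apply \<phi> x + (1 - t) * blinfun_apply \<psi> x = blinfun_apply \<theta> x"
        by (simp add: \<theta>_def blinfun.add_left blinfun.scaleR_left)
      then show ?thesis by (simp add: blinfun.diff_left algebra_simps)
    qed
    have "b < t * a1 + (1 - t) * a2"
    proof (rule ccontr)
      assume "\<not> ?thesis"
      moreover have "t * (b + blinfun_apply (\<phi> - \<theta>) x) \<le> t * a1"
        "(1 - t) * (b + blinfun_apply (\<psi> - \<theta>) x) \<le> (1 - t) * a2"
        using le1 le2 *(4) by (auto intro!: mult_left_mono)
      ultimately have "t * (b + blinfun_apply (\<phi> - \<theta>) x) = t * a1"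
        "(1 - t) * (b + blinfun_apply (\<psi> - \<theta>) x) = (1 - t) * a2"
        using avg by linarith+
      then have "b + blinfun_apply (\<phi> - \<theta>) x = a1" "b + blinfun_apply (\<psi> - \<theta>) x = a2"
        using *(4) by auto
      then have "\<phi> \<in> subdifferential f x" "\<psi> \<in> subdifferential f x"
        using touch a1 a2 inv by auto
      then show False using bregman_funD(4)[OF fB] *(3) by blast
    qed
    then show "conjugate f (t *\<^sub>R \<phi> + (1 - t) *\<^sub>R \<psi>) < ereal t * conjugate f \<phi> + ereal (1 - t) * conjugate f \<psi>"
      using a1 a2 b by (simp add: \<theta>_def)
  qed
  fix \<phi> \<xi> assume \<xi>: "\<xi> \<in> subdifferential (conjugate f) \<phi>"
  obtain x where x: "\<xi> = bidual_embed x" using refl' by blast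
  then have "x \<in> interior (edom f)"
    using \<xi> inv bregman_fun_subdifferential[OF fB] by blast
  then obtain r M where r: "0 < r" "\<And>u. norm (u - x) < r \<Longrightarrow> f u \<le> ereal M"
    using bounded_above_near_interior[OF c] by blast
  have "ereal (blinfun_apply \<xi> \<psi> + r / 2 * norm \<psi> - M) \<le> conjugate f \<psi>" for \<psi>
  proof (rule ereal_le_if_real_le)
    fix a assume a: "conjugate f \<psi> \<le> ereal a"
    \<comment> \<open>The bound \<open>norm \<psi> \<le> s\<close> is the claim solved for the norm;
      it follows from the bound on \<open>f\<close> in the ball of radius \<open>r\<close> around
      \<open>x\<close>.\<close>
    define s where "s = 2 / r * (a + M - blinfun_apply \<psi> x)"
    have lower: "blinfun_apply \<psi> u - a \<le> M" if "norm (u - x) < r" for u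
      using a r(2)[OF that] conjugate_le_iff[of f, OF closed_convex_funD(1)[OF c]] by blast
    have s0: "0 \<le> s" using lower[of x] r(1) by (simp add: s_def)
    have le: "blinfun_apply \<psi> v \<le> s * norm v" for v
    proof (cases "v = 0")
      case False
      define t where "t = r / (2 * norm v)"
      have t: "0 < t" using False r(1) by (simp add: t_def)
      have "norm (x + t *\<^sub>R v - x) < r" using False r(1) by (simp add: t_def)
      from lower[OF this] have "t * blinfun_apply \<psi> v \<le> a + M - blinfun_apply \<psi> x"
        by (simp add: blinfun.add_right blinfun.scaleR_right)
      then have "blinfun_apply \<psi> v \<le> (a + M - blinfun_apply \<psi> x) / t"
        using t by (simp add: field_simps)
      also have "\<dots> = s * norm v" using False r(1) by (simp add: t_def s_def)
      finally show ?thesis .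
    qed (use s0 in simp)
    have "norm \<psi> \<le> s"
      using s0 le[of "- v" for v] le
      by (intro norm_blinfun_bound) (auto simp: abs_le_iff blinfun.minus_right)
    then show "blinfun_apply \<xi> \<psi> + r / 2 * norm \<psi> - M \<le> a"
      using r(1) by (simp add: s_def x field_simps)
  qed (rule closed_convex_funD(1)[OF c'])
  then show "\<exists>\<alpha>>0. \<exists>\<beta>. \<forall>u. ereal (blinfun_apply \<xi> u + \<alpha> * norm u - \<beta>) \<le> conjugate f u"
    using r(1) by (intro exI[of _ "r / 2"] conjI exI[of _ M] allI) auto
qed

section \<open>Separable sums\<close>

definition sep_sum :: "('a \<Rightarrow> ereal) \<Rightarrow> ('b \<Rightarrow> ereal) \<Rightarrow> 'a \<times> 'b \<Rightarrow> ereal" where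
  "sep_sum f k = (\<lambda>(u, v). f u + k v)"

lemma sep_sum_apply [simp]: "sep_sum f k (u, v) = f u + k v"
  by (simp add: sep_sum_def)

lemma edom_sep_sum:
  assumes "\<And>u. f u \<noteq> -\<infinity>" "\<And>v. k v \<noteq> -\<infinity>"
  shows "edom (sep_sum f k) = edom f \<times> edom k"
proof -
  have "f u + k v < \<infinity> \<longleftrightarrow> f u < \<infinity> \<and> k v < \<infinity>" for u v
    using assms(1)[of u] assms(2)[of v] by (cases "f u"; cases "k v") auto
  then show ?thesis by (auto simp: edom_def)
qed

text \<open>Lets affine minorants be chosen for each summand separately; an infinite summand absorbs
  whatever the other leaves.\<close>

lemma ereal_less_addE:
  fixes s t :: ereal
  assumes "ereal a < s + t" "s \<noteq> -\<infinity>" "t \<noteq> -\<infinity>"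
  obtains b c where "a = b + c" "ereal b < s" "ereal c < t"
proof (cases s; cases t)
  fix p q assume pq: "s = ereal p" "t = ereal q"
  show thesis
    by (rule that[of "p - (p + q - a) / 2" "q - (p + q - a) / 2"]) (use assms(1) pq in \<open>auto simp: field_simps\<close>)
next
  fix p assume pq: "s = ereal p" "t = \<infinity>"
  show thesis by (rule that[of "p - 1" "a - p + 1"]) (use pq in auto)
next
  fix q assume pq: "s = \<infinity>" "t = ereal q"
  show thesis by (rule that[of "a - q + 1" "q - 1"]) (use pq in auto)
next
  assume pq: "s = \<infinity>" "t = \<infinity>"
  show thesis by (rule that[of a 0]) (use pq in auto)
qed (use assms in auto)

text \<open>The epigraph is the intersection of the half-spaces given by sums of affine minorants,
  which gives closedness and convexity together.\<close>

lemma closed_convex_fun_sep_sum: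
  fixes f :: "'a::real_normed_vector \<Rightarrow> ereal" and k :: "'b::real_normed_vector \<Rightarrow> ereal"
  assumes f: "closed_convex_fun f" and k: "closed_convex_fun k"
  shows "closed_convex_fun (sep_sum f k)"
proof -
  define N where "N = {(\<phi> :: 'a dual, \<psi> :: 'b dual, d).
    \<exists>b c. d = b + c \<and> (\<forall>u. ereal (blinfun_apply \<phi> u + b) \<le> f u) \<and> (\<forall>v. ereal (blinfun_apply \<psi> v + c) \<le> k v)}"
  define A where "A = (\<lambda>(\<phi> :: 'a dual, \<psi> :: 'b dual, d). {z :: ('a \<times> 'b) \<times> real.
    blinfun_apply (pair_dual \<phi> \<psi>) (fst z) + d \<le> snd z})"
  have "((u, v), a) \<in> epi (sep_sum f k) \<longleftrightarrow> ((u, v), a) \<in> (\<Inter>n\<in>N. A n)" for u v a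
  proof
    assume *: "((u, v), a) \<in> epi (sep_sum f k)"
    have "blinfun_apply \<phi> u + blinfun_apply \<psi> v + (b + c) \<le> a"
      if "\<forall>u. ereal (blinfun_apply \<phi> u + b) \<le> f u" "\<forall>v. ereal (blinfun_apply \<psi> v + c) \<le> k v" for \<phi> \<psi> b c
    proof -
      have "ereal (blinfun_apply \<phi> u + b) + ereal (blinfun_apply \<psi> v + c) \<le> f u + k v"
        using that by (intro add_mono) auto
      also have "\<dots> \<le> ereal a" using * by simp
      finally show ?thesis by simp
    qed
    then show "((u, v), a) \<in> (\<Inter>n\<in>N. A n)" by (auto simp: N_def A_def)
  next
    assume *: "((u, v), a) \<in> (\<Inter>n\<in>N. A n)"
    show "((u, v), a) \<in> epi (sep_sum f k)"
    proof (rule ccontr)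
      assume "\<not> ?thesis"
      then have "ereal a < f u + k v" by (simp add: not_le)
      then obtain b c where bc: "a = b + c" "ereal b < f u" "ereal c < k v"
        using closed_convex_funD(1)[OF f] closed_convex_funD(1)[OF k] by (rule ereal_less_addE)
      obtain \<phi> b' where 1: "\<And>u. ereal (blinfun_apply \<phi> u + b') \<le> f u" "b < blinfun_apply \<phi> u + b'"
        using affine_minorant_above[OF f bc(2)] by blast
      obtain \<psi> c' where 2: "\<And>v. ereal (blinfun_apply \<psi> v + c') \<le> k v" "c < blinfun_apply \<psi> v + c'"
        using affine_minorant_above[OF k bc(3)] by blast
      have "(\<phi>, \<psi>, b' + c') \<in> N" using 1(1) 2(1) by (auto simp: N_def)
      then have "((u, v), a) \<in> A (\<phi>, \<psi>, b' + c')" using * by blast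
      then show False using 1(2) 2(2) bc(1) by (simp add: A_def)
    qed
  qed
  then have epi: "epi (sep_sum f k) = (\<Inter>n\<in>N. A n)" by auto
  have "closed (A n)" for n
    unfolding A_def by (cases n) (auto intro!: closed_Collect_le continuous_intros)
  then have "closed (epi (sep_sum f k))" unfolding epi by (intro closed_INT) auto
  moreover have "convex (A n)" for n
  proof -
    obtain \<phi> \<psi> d where n: "n = (\<phi>, \<psi>, d)" by (cases n)
    have "A n = {z. blinfun_apply (pair_dual (pair_dual \<phi> \<psi>) (- id_blinfun)) z \<le> - d}"
      by (auto simp: A_def n blinfun.minus_left)
    then show ?thesis using convex_blinfun_halfspace by metis
  qed
  then have "convex (epi (sep_sum f k))" unfolding epi by (intro convex_INT) auto
  moreover have "sep_sum f k z \<noteq> -\<infinity>" for z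
    using closed_convex_funD(1)[OF f] closed_convex_funD(1)[OF k] by (cases z) auto
  moreover have "edom (sep_sum f k) \<noteq> {}"
    using edom_sep_sum[of f k] closed_convex_funD(1,2)[OF f] closed_convex_funD(1,2)[OF k] by auto
  ultimately show ?thesis by (simp add: closed_convex_fun_def)
qed

lemma subdifferential_sep_sum:
  assumes f: "closed_convex_fun f" and k: "closed_convex_fun k"
  shows "pair_dual \<phi> \<psi> \<in> subdifferential (sep_sum f k) (u, v) \<longleftrightarrow>
    \<phi> \<in> subdifferential f u \<and> \<psi> \<in> subdifferential k v"
proof
  assume *: "pair_dual \<phi> \<psi> \<in> subdifferential (sep_sum f k) (u, v)"
  have uv: "u \<in> edom f" "v \<in> edom k"
    using subdifferential_edom[OF closed_convex_fun_sep_sum[OF f k] *]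
      edom_sep_sum[of f k] closed_convex_funD(1)[OF f] closed_convex_funD(1)[OF k] by auto
  obtain a b where ab: "f u = ereal a" "k v = ereal b"
    using closed_convex_fun_finite[OF f uv(1)] closed_convex_fun_finite[OF k uv(2)] by blast
  have sub: "a + b + blinfun_apply (pair_dual \<phi> \<psi>) (z - (u, v)) \<le> c"
    if "sep_sum f k z \<le> ereal c" for z c
  proof -
    have "sep_sum f k (u, v) = ereal (a + b)" by (simp add: ab)
    from subdifferential_iff[of "sep_sum f k", OF this closed_convex_funD(1)[OF closed_convex_fun_sep_sum[OF f k]]]
    show ?thesis using * that by blast
  qed
  have "a + blinfun_apply \<phi> (y - u) \<le> c" if "f y \<le> ereal c" for y c
    using sub[of "(y, v)" "c + b"] that ab(2) add_right_mono[OF that, of "ereal b"] by simp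
  moreover have "b + blinfun_apply \<psi> (y - v) \<le> c" if "k y \<le> ereal c" for y c
    using sub[of "(u, y)" "a + c"] that ab(1) add_left_mono[OF that, of "ereal a"] by simp
  ultimately show "\<phi> \<in> subdifferential f u \<and> \<psi> \<in> subdifferential k v"
    using subdifferential_iff[of f, OF ab(1) closed_convex_funD(1)[OF f]]
      subdifferential_iff[of k, OF ab(2) closed_convex_funD(1)[OF k]] by blast
next
  assume *: "\<phi> \<in> subdifferential f u \<and> \<psi> \<in> subdifferential k v"
  have "ereal (blinfun_apply (pair_dual \<phi> \<psi>) ((y, w) - (u, v))) + (f u + k v) \<le> f y + k w" for y w
  proof -
    have "(ereal (blinfun_apply \<phi> (y - u)) + f u) + (ereal (blinfun_apply \<psi> (w - v)) + k v) \<le> f y + k w"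
      using * by (intro add_mono) (auto simp: subdifferential_def)
    then show ?thesis by (simp add: ac_simps flip: plus_ereal.simps(1))
  qed
  then show "pair_dual \<phi> \<psi> \<in> subdifferential (sep_sum f k) (u, v)"
    by (auto simp: subdifferential_def)
qed

theorem bregman_fun_sep_sum:
  fixes f :: "'a::banach \<Rightarrow> ereal" and k :: "'b::banach \<Rightarrow> ereal"
  assumes f: "bregman_fun f" and k: "bregman_fun k"
  shows "bregman_fun (sep_sum f k)"
  unfolding bregman_fun_def
proof (intro conjI allI ballI)
  note cf = bregman_funD(1)[OF f] and ck = bregman_funD(1)[OF k]
  note sub = subdifferential_sep_sum[OF cf ck]
  have dom: "edom (sep_sum f k) = edom f \<times> edom k"
    by (intro edom_sep_sum closed_convex_funD(1) cf ck)
  then have int: "interior (edom (sep_sum f k)) = interior (edom f) \<times> interior (edom k)"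
    by (simp add: interior_Times)
  show "closed_convex_fun (sep_sum f k)" by (rule closed_convex_fun_sep_sum[OF cf ck])
  show "interior (edom (sep_sum f k)) \<noteq> {}"
    using bregman_funD(2)[OF f] bregman_funD(2)[OF k] int by auto
  have "(u, v) \<in> op_dom (subdifferential (sep_sum f k)) \<longleftrightarrow>
      u \<in> op_dom (subdifferential f) \<and> v \<in> op_dom (subdifferential k)" for u v
  proof -
    have "(\<exists>\<Phi>. \<Phi> \<in> subdifferential (sep_sum f k) (u, v)) \<longleftrightarrow>
      (\<exists>\<phi> \<psi>. pair_dual \<phi> \<psi> \<in> subdifferential (sep_sum f k) (u, v))"
      by (metis pair_dual_cases)
    then show ?thesis unfolding op_dom_def sub by blast
  qed
  then show "op_dom (subdifferential (sep_sum f k)) = interior (edom (sep_sum f k))"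
    using bregman_funD(3)[OF f] bregman_funD(3)[OF k] int by auto
  show "p = q" if "p \<in> subdifferential (sep_sum f k) z" "q \<in> subdifferential (sep_sum f k) z" for z p q
  proof -
    obtain u v where z: "z = (u, v)" by force
    obtain \<phi> \<psi> where p: "p = pair_dual \<phi> \<psi>" by (rule pair_dual_cases)
    obtain \<phi>' \<psi>' where q: "q = pair_dual \<phi>' \<psi>'" by (rule pair_dual_cases)
    from that show ?thesis
      unfolding z p q sub using bregman_funD(4)[OF f] bregman_funD(4)[OF k] by blast
  qed
  show "strictly_convex_fun_on (interior (edom (sep_sum f k))) (sep_sum f k)"
    unfolding strictly_convex_fun_on_def
  proof (intro ballI impI)
    fix z w and t :: real
    assume *: "z \<in> interior (edom (sep_sum f k))" "w \<in> interior (edom (sep_sum f k))" "z \<noteq> w" "t \<in> {0<..<1}"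
    obtain u v u' v' where zw: "z = (u, v)" "w = (u', v')" by (metis surj_pair)
    have fin: "u \<in> edom f" "u' \<in> edom f" "v \<in> edom k" "v' \<in> edom k"
      using *(1,2) interior_subset[of "edom f"] interior_subset[of "edom k"] by (auto simp: int zw)
    obtain a a' b b' where ab: "f u = ereal a" "f u' = ereal a'" "k v = ereal b" "k v' = ereal b'"
      using fin closed_convex_fun_finite[OF cf] closed_convex_fun_finite[OF ck] by metis
    have lf: "f (t *\<^sub>R u + (1 - t) *\<^sub>R u') \<le> ereal (t * a + (1 - t) * a')"
      using ab *(4) by (intro epi_convexD[OF closed_convex_funD(3)[OF cf]]) auto
    have lk: "k (t *\<^sub>R v + (1 - t) *\<^sub>R v') \<le> ereal (t * b + (1 - t) * b')"
      using ab *(4) by (intro epi_convexD[OF closed_convex_funD(3)[OF ck]]) auto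
    have "f (t *\<^sub>R u + (1 - t) *\<^sub>R u') < ereal t * f u + ereal (1 - t) * f u'" if "u \<noteq> u'"
      using bregman_funD(5)[OF f] *(1,2,4) that by (auto simp: strictly_convex_fun_on_def int zw)
    then have sf: "f (t *\<^sub>R u + (1 - t) *\<^sub>R u') < ereal (t * a + (1 - t) * a')" if "u \<noteq> u'"
      using that ab by simp
    have "k (t *\<^sub>R v + (1 - t) *\<^sub>R v') < ereal t * k v + ereal (1 - t) * k v'" if "v \<noteq> v'"
      using bregman_funD(5)[OF k] *(1,2,4) that by (auto simp: strictly_convex_fun_on_def int zw)
    then have sk: "k (t *\<^sub>R v + (1 - t) *\<^sub>R v') < ereal (t * b + (1 - t) * b')" if "v \<noteq> v'"
      using that ab by simp
    \<comment> \<open>Distinct pairs differ in at least one component, and there the inequality is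
      strict.\<close>
    have "f (t *\<^sub>R u + (1 - t) *\<^sub>R u') + k (t *\<^sub>R v + (1 - t) *\<^sub>R v')
        < ereal (t * a + (1 - t) * a' + (t * b + (1 - t) * b'))"
      using lf lk sf sk *(3) closed_convex_funD(1)[OF cf, of "t *\<^sub>R u + (1 - t) *\<^sub>R u'"]
        closed_convex_funD(1)[OF ck, of "t *\<^sub>R v + (1 - t) *\<^sub>R v'"]
      by (cases "f (t *\<^sub>R u + (1 - t) *\<^sub>R u')"; cases "k (t *\<^sub>R v + (1 - t) *\<^sub>R v')") (auto simp: zw)
    then show "sep_sum f k (t *\<^sub>R z + (1 - t) *\<^sub>R w) < ereal t * sep_sum f k z + ereal (1 - t) * sep_sum f k w"
      by (simp add: zw ab algebra_simps)
  qed
  fix z p assume "p \<in> subdifferential (sep_sum f k) z"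
  moreover obtain u v where z: "z = (u, v)" by force
  moreover obtain \<phi> \<psi> where p: "p = pair_dual \<phi> \<psi>" by (rule pair_dual_cases)
  ultimately have s: "\<phi> \<in> subdifferential f u" "\<psi> \<in> subdifferential k v" using sub by auto
  obtain \<alpha> \<beta> where 1: "0 < \<alpha>" "\<And>u. ereal (blinfun_apply \<phi> u + \<alpha> * norm u - \<beta>) \<le> f u"
    using bregman_fun_coercive[OF f s(1)] by blast
  obtain \<alpha>' \<beta>' where 2: "0 < \<alpha>'" "\<And>v. ereal (blinfun_apply \<psi> v + \<alpha>' * norm v - \<beta>') \<le> k v"
    using bregman_fun_coercive[OF k s(2)] by blast
  have "ereal (blinfun_apply p w + min \<alpha> \<alpha>' * norm w - (\<beta> + \<beta>')) \<le> sep_sum f k w" for w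
  proof -
    obtain y y' where w: "w = (y, y')" by force
    have "min \<alpha> \<alpha>' * norm w \<le> min \<alpha> \<alpha>' * (norm y + norm y')"
      using 1(1) 2(1) by (auto simp: w intro!: mult_left_mono norm_Pair_le)
    also have "\<dots> \<le> \<alpha> * norm y + \<alpha>' * norm y'"
      unfolding distrib_left by (intro add_mono mult_right_mono) auto
    finally have "ereal (blinfun_apply p w + min \<alpha> \<alpha>' * norm w - (\<beta> + \<beta>'))
      \<le> ereal (blinfun_apply \<phi> y + \<alpha> * norm y - \<beta>) + ereal (blinfun_apply \<psi> y' + \<alpha>' * norm y' - \<beta>')"
      by (simp add: p w)
    also have "\<dots> \<le> f y + k y'" by (intro add_mono 1 2)
    finally show ?thesis by (simp add: w)
  qed
  then show "\<exists>\<alpha>>0. \<exists>\<beta>. \<forall>u. ereal (blinfun_apply p u + \<alpha> * norm u - \<beta>) \<le> sep_sum f k u"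
    using 1(1) 2(1) by (intro exI[of _ "min \<alpha> \<alpha>'"] conjI exI[of _ "\<beta> + \<beta>'"] allI) auto
qed

lemma gradient_sep_sum:
  fixes f :: "'a::banach \<Rightarrow> ereal" and k :: "'b::banach \<Rightarrow> ereal"
  assumes f: "bregman_fun f" and k: "bregman_fun k"
    and uv: "u \<in> interior (edom f)" "v \<in> interior (edom k)"
  shows "gradient (sep_sum f k) (u, v) = pair_dual (gradient f u) (gradient k v)"
proof -
  have "pair_dual (gradient f u) (gradient k v) \<in> subdifferential (sep_sum f k) (u, v)"
    using subdifferential_sep_sum[OF bregman_funD(1)[OF f] bregman_funD(1)[OF k]] uv
      bregman_fun_subdifferential[OF f] bregman_fun_subdifferential[OF k] by blast
  then show ?thesis
    using bregman_fun_subdifferential[OF bregman_fun_sep_sum[OF f k]] by simp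
qed

section \<open>Bregman projections\<close>

text \<open>The Bregman distance as a real number; meaningful for \<open>x\<close> in the domain of \<open>f\<close> and \<open>y\<close> in
  its interior.\<close>

definition rbregman :: "('a::real_normed_vector \<Rightarrow> ereal) \<Rightarrow> 'a \<Rightarrow> 'a \<Rightarrow> real" where
  "rbregman f x y = real_of_ereal (f x) - real_of_ereal (f y) - blinfun_apply (gradient f y) (x - y)"

text \<open>Purely algebraic: the values of \<open>f\<close> cancel, whatever real numbers stand for
  them.\<close>

lemma three_point_identity:
  "rbregman f z y = rbregman f z x + rbregman f x y + blinfun_apply (gradient f x - gradient f y) (z - x)"
  by (simp add: rbregman_def blinfun.diff_left blinfun.diff_right)

lemma rbregman_self [simp]: "rbregman f x x = 0"
  by (simp add: rbregman_def)

lemma bregman_dist_eq_rbregman: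
  assumes "closed_convex_fun f" "x \<in> edom f" "y \<in> interior (edom f)"
  shows "bregman_dist f x y = ereal (rbregman f x y)"
proof -
  have "y \<in> edom f" using assms(3) interior_subset by blast
  then obtain a b where "f x = ereal a" "f y = ereal b"
    using closed_convex_fun_finite[OF assms(1)] assms(2) by blast
  then show ?thesis using assms(3) by (simp add: bregman_dist_def rbregman_def)
qed

lemma bregman_dist_outside:
  assumes "closed_convex_fun f" "x \<notin> edom f"
  shows "bregman_dist f x y = \<infinity>"
proof (cases "y \<in> interior (edom f)")
  case True
  then have "y \<in> edom f" using interior_subset by blast
  then obtain b where "f y = ereal b"
    using closed_convex_fun_finite[OF assms(1)] by blast
  moreover have "f x = \<infinity>" using assms(2) by (simp add: edom_def)
  ultimately show ?thesis using True by (simp add: bregman_dist_def)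
qed (simp add: bregman_dist_def)

lemma real_of_ereal_subgradient:
  assumes "closed_convex_fun f" "p \<in> subdifferential f y" "x \<in> edom f"
  shows "real_of_ereal (f y) + blinfun_apply p (x - y) \<le> real_of_ereal (f x)"
proof -
  obtain b where b: "f y = ereal b" "\<And>x a. f x \<le> ereal a \<Longrightarrow> b + blinfun_apply p (x - y) \<le> a"
    using assms(2) by (rule subdifferentialE[OF assms(1)]) blast
  obtain a where a: "f x = ereal a" using closed_convex_fun_finite[OF assms(1,3)] by blast
  show ?thesis using b(2)[of x a] by (simp add: a b(1))
qed

lemma bregman_fun_gradient:
  fixes f :: "'a::banach \<Rightarrow> ereal"
  assumes "bregman_fun f" "y \<in> interior (edom f)"
  shows "gradient f y \<in> subdifferential f y"
  using bregman_fun_subdifferential[OF assms(1)] assms(2) by simp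

lemma rbregman_nonneg:
  fixes f :: "'a::banach \<Rightarrow> ereal"
  assumes f: "bregman_fun f" and "x \<in> edom f" "y \<in> interior (edom f)"
  shows "0 \<le> rbregman f x y"
  using real_of_ereal_subgradient[OF bregman_funD(1)[OF f] bregman_fun_gradient[OF f assms(3)] assms(2)]
  by (simp add: rbregman_def)

text \<open>The point \<open>x\<close> may lie on the boundary, where no gradient is at hand.
  Equality makes the gradient at \<open>y\<close> a subgradient at \<open>x\<close> too, which moves
  \<open>x\<close> into the interior; strict monotonicity then applies.\<close>

lemma rbregman_eq_0_imp_eq:
  fixes f :: "'a::banach \<Rightarrow> ereal"
  assumes f: "bregman_fun f" and x: "x \<in> edom f" and y: "y \<in> interior (edom f)"
    and 0: "rbregman f x y = 0"
  shows "x = y"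
proof -
  note c = bregman_funD(1)[OF f]
  obtain a where a: "f x = ereal a" using closed_convex_fun_finite[OF c x] by blast
  obtain b where b: "f y = ereal b" "\<And>z c. f z \<le> ereal c \<Longrightarrow> b + blinfun_apply (gradient f y) (z - y) \<le> c"
    using bregman_fun_gradient[OF f y] by (rule subdifferentialE[OF c]) blast
  have "a = b + blinfun_apply (gradient f y) (x - y)" using 0 by (simp add: rbregman_def a b(1))
  then have "gradient f y \<in> subdifferential f x"
    using b(2) by (subst subdifferential_iff[of f, OF a closed_convex_funD(1)[OF c]])
      (auto simp: blinfun.diff_right)
  then have "x \<in> interior (edom f)" "gradient f y = gradient f x"
    using bregman_fun_subdifferential[OF f] by auto
  then show ?thesis using strictly_monotone_gradient[OF f _ y, of x] by force
qed

lemma bounded_bregman_sublevel: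
  fixes f :: "'a::banach \<Rightarrow> ereal"
  assumes f: "bregman_fun f" and y: "y \<in> interior (edom f)"
  shows "\<exists>R. \<forall>x\<in>edom f. rbregman f x y \<le> c \<longrightarrow> norm x \<le> R"
proof -
  obtain \<alpha> \<beta> where \<alpha>: "0 < \<alpha>" "\<And>u. ereal (blinfun_apply (gradient f y) u + \<alpha> * norm u - \<beta>) \<le> f u"
    using bregman_fun_coercive[OF f bregman_fun_gradient[OF f y]] by blast
  have "norm x \<le> (c + \<beta> + real_of_ereal (f y) - blinfun_apply (gradient f y) y) / \<alpha>"
    if x: "x \<in> edom f" "rbregman f x y \<le> c" for x
  proof -
    obtain a where "f x = ereal a" using closed_convex_fun_finite[OF bregman_funD(1)[OF f] x(1)] by blast
    with \<alpha>(2)[of x] x(2) have "\<alpha> * norm x \<le> c + \<beta> + real_of_ereal (f y) - blinfun_apply (gradient f y) y"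
      by (simp add: rbregman_def blinfun.diff_right)
    then show ?thesis using \<alpha>(1) by (simp add: field_simps)
  qed
  then show ?thesis by blast
qed

text \<open>The Pythagorean inequality of Bregman geometry: membership in the half-space is the sign
  of the last term in the three-point identity.\<close>

lemma bregman_halfspace_inequality:
  assumes "z \<in> bregman_halfspace f y x"
  shows "rbregman f z x + rbregman f x y \<le> rbregman f z y"
  using assms three_point_identity[of f z y x]
  by (simp add: bregman_halfspace_def blinfun.diff_left)

lemma bregman_proj_eqI:
  fixes f :: "'a::banach \<Rightarrow> ereal"
  assumes f: "bregman_fun f" and y: "y \<in> interior (edom f)"
    and x: "x \<in> C" "x \<in> interior (edom f)" and C: "C \<subseteq> bregman_halfspace f y x"
  shows "bregman_proj f C y = x"
proof -
  note c = bregman_funD(1)[OF f]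
  have xe: "x \<in> edom f" using x(2) interior_subset by blast
  have strict: "bregman_dist f x y < bregman_dist f z y" if z: "z \<in> C" "z \<noteq> x" for z
  proof (cases "z \<in> edom f")
    case True
    have "0 < rbregman f z x"
      using rbregman_nonneg[OF f True x(2)] rbregman_eq_0_imp_eq[OF f True x(2)] z(2) by force
    then have "rbregman f x y < rbregman f z y"
      using bregman_halfspace_inequality[of z f y x] C z(1) by auto
    then show ?thesis using bregman_dist_eq_rbregman[OF c _ y] True xe by simp
  next
    case False
    then show ?thesis using bregman_dist_outside[OF c] bregman_dist_eq_rbregman[OF c xe y] by simp
  qed
  have "is_arg_min (\<lambda>x. bregman_dist f x y) (\<lambda>x. x \<in> C) x"
    unfolding is_arg_min_def using x(1) strict by (metis less_asym less_irrefl)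
  moreover have "z = x" if "is_arg_min (\<lambda>x. bregman_dist f x y) (\<lambda>x. x \<in> C) z" for z
    using that x(1) strict unfolding is_arg_min_def by blast
  ultimately show ?thesis unfolding bregman_proj_def by (rule the_equality)
qed

text \<open>Up to constants the objective is \<open>f\<close> minus \<open>p\<close> on
  \<open>C\<close>, and its growth is a clause of \<open>bregman_fun\<close>. A minimizer might a
  priori lie on the boundary of the domain; the sum rule, applicable because \<open>C\<close> meets
  the interior, gives it a subgradient of \<open>f\<close> and so puts it in the interior.\<close>

theorem bregman_proj:
  fixes f :: "'a::banach \<Rightarrow> ereal"
  assumes refl: "reflexive_space TYPE('a)" and f: "bregman_fun f"
    and C: "closed C" "convex C" "C \<inter> interior (edom f) \<noteq> {}" and y: "y \<in> interior (edom f)"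
  shows "bregman_proj f C y \<in> C" "bregman_proj f C y \<in> interior (edom f)"
    "C \<subseteq> bregman_halfspace f y (bregman_proj f C y)"
proof -
  note c = bregman_funD(1)[OF f]
  define p where "p = gradient f y"
  obtain z where z: "z \<in> C" "z \<in> interior (edom f)" using C(3) by blast
  then have ze: "z \<in> edom f" using interior_subset by blast
  obtain \<alpha> \<beta> where \<alpha>: "0 < \<alpha>" "\<And>u. ereal (blinfun_apply p u + \<alpha> * norm u - \<beta>) \<le> f u"
    using bregman_fun_coercive[OF f bregman_fun_gradient[OF f y]] p_def by blast
  \<comment> \<open>\<open>k\<close> and \<open>G\<close> describe one problem twice:
    \<open>G\<close> as a restriction, for closedness and existence, and \<open>f\<close> plus
    \<open>k\<close> for the sum rule.\<close>
  define k where "k u = (if u \<in> C then ereal (- blinfun_apply p u) else \<infinity>)" for u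
  define G where "G u = (if u \<in> C then f u + ereal (- blinfun_apply p u) else \<infinity>)" for u
  have "convex_on UNIV (\<lambda>u. - blinfun_apply p u)"
    by (auto simp: convex_on_def blinfun.add_right blinfun.scaleR_right)
  then have G1: "closed_convex_fun (\<lambda>u. f u + ereal (- blinfun_apply p u))"
    by (intro closed_convex_fun_add_continuous c) (auto intro!: continuous_intros)
  moreover have "C \<inter> edom (\<lambda>u. f u + ereal (- blinfun_apply p u)) \<noteq> {}"
    using z(1) ze by (auto simp: edom_def)
  ultimately have "closed_convex_fun G"
    unfolding G_def using C by (intro closed_convex_fun_restrict) auto
  moreover have "ereal (\<alpha> * norm u - \<beta>) \<le> G u" for u
    using \<alpha>(2)[of u] by (cases "f u") (auto simp: G_def)
  ultimately obtain x where x: "\<And>u. G x \<le> G u"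
    using coercive_minimizer_exists[OF refl _ \<alpha>(1)] by metis
  have Gk: "G u = f u + k u" for u
    using closed_convex_funD(1)[OF c, of u] by (cases "f u") (auto simp: G_def k_def)
  have "G z < \<infinity>" using z(1) ze by (simp add: G_def edom_def)
  then have "G x < \<infinity>" using x[of z] by (rule le_less_trans[rotated])
  then have xC: "x \<in> C" and xe: "f x < \<infinity>"
    by (auto simp: G_def split: if_splits)
  obtain r M where r: "0 < r" "\<And>u. norm (u - z) < r \<Longrightarrow> f u \<le> ereal M"
    using bounded_above_near_interior[OF c z(2)] by blast
  have "convex (epi k)"
  proof (rule convexI, clarsimp)
    fix u v and a b s t :: real
    assume *: "k u \<le> ereal a" "k v \<le> ereal b" "0 \<le> s" "0 \<le> t" "s + t = 1"
    then have uv: "u \<in> C" "v \<in> C" "- blinfun_apply p u \<le> a" "- blinfun_apply p v \<le> b"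
      by (auto simp: k_def split: if_splits)
    then have "s *\<^sub>R u + t *\<^sub>R v \<in> C" using C(2) * by (intro convexD)
    moreover have "s * - blinfun_apply p u + t * - blinfun_apply p v \<le> s * a + t * b"
      using uv * by (intro add_mono mult_left_mono)
    ultimately show "k (s *\<^sub>R u + t *\<^sub>R v) \<le> ereal (s * a + t * b)"
      by (simp add: k_def blinfun.add_right blinfun.scaleR_right)
  qed
  moreover have "k u \<noteq> -\<infinity>" for u by (simp add: k_def)
  moreover have "k z < \<infinity>" "k x < \<infinity>" using z(1) xC by (auto simp: k_def)
  ultimately obtain q where q: "q \<in> subdifferential f x" "- q \<in> subdifferential k x"
    using subdifferential_sum_rule[of f k r z M x] closed_convex_funD(1,3)[OF c] r xe x
    unfolding Gk by blast
  have xI: "x \<in> interior (edom f)" "q = gradient f x"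
    using q(1) bregman_fun_subdifferential[OF f] by auto
  have sub: "C \<subseteq> bregman_halfspace f y x"
  proof
    fix v assume "v \<in> C"
    then have "blinfun_apply (- q) (v - x) - blinfun_apply p x \<le> - blinfun_apply p v"
      using q(2) xC by (auto simp: subdifferential_def k_def dest: spec[of _ v])
    then show "v \<in> bregman_halfspace f y x"
      by (simp add: bregman_halfspace_def p_def[symmetric] xI(2)[symmetric]
          blinfun.diff_left blinfun.diff_right blinfun.minus_left)
  qed
  have "bregman_proj f C y = x" by (rule bregman_proj_eqI[OF f y xC xI(1) sub])
  then show "bregman_proj f C y \<in> C" "bregman_proj f C y \<in> interior (edom f)"
    "C \<subseteq> bregman_halfspace f y (bregman_proj f C y)"
    using xC xI(1) sub by auto
qed

lemma closed_bregman_halfspace: "closed (bregman_halfspace f x y)"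
  unfolding bregman_halfspace_def by (intro closed_Collect_le continuous_intros)

lemma convex_bregman_halfspace: "convex (bregman_halfspace f x y)"
  using convex_blinfun_halfspace[of "gradient f x - gradient f y" "blinfun_apply (gradient f x - gradient f y) y"]
  by (simp add: bregman_halfspace_def blinfun.diff_right)

lemma bregman_halfspace_self [simp]: "bregman_halfspace f x x = UNIV"
  by (simp add: bregman_halfspace_def)

lemma bregman_halfspace_base [simp]: "y \<in> bregman_halfspace f x y"
  by (simp add: bregman_halfspace_def)

lemma mem_bregman_halfspace_imp_eq:
  fixes f :: "'a::banach \<Rightarrow> ereal"
  assumes "bregman_fun f" "x \<in> interior (edom f)" "y \<in> interior (edom f)" "x \<in> bregman_halfspace f x y"
  shows "x = y"
  using strictly_monotone_gradient[OF assms(1-3)] assms(4) by (force simp: bregman_halfspace_def)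

section \<open>Weak cluster points\<close>

text \<open>The Hahn--Banach theorem is applied to \<open>\<phi> \<mapsto> limsup \<phi> (x\<^sub>n)\<close> on the dual.\<close>

theorem weak_cluster_point_exists:
  fixes x :: "nat \<Rightarrow> 'a::real_normed_vector"
  assumes refl: "reflexive_space TYPE('a)" and bdd: "bounded (range x)"
  obtains l where "\<And>(\<phi> :: 'a dual) c. \<forall>\<^sub>F n in sequentially. blinfun_apply \<phi> (x n) \<le> c \<Longrightarrow> blinfun_apply \<phi> l \<le> c"
proof -
  \<comment> \<open>The infimum of \<open>S \<phi>\<close>, the set of eventual upper bounds, is the
    upper limit of \<open>\<phi> (x n)\<close>.\<close>
  define S where "S \<phi> = {c. \<forall>\<^sub>F n in sequentially. blinfun_apply \<phi> (x n) \<le> c}" for \<phi> :: "'a dual"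
  obtain K where K: "\<And>n. norm (x n) \<le> K" using bdd by (auto simp: bounded_iff)
  have absK: "\<bar>blinfun_apply \<phi> (x n)\<bar> \<le> K * norm \<phi>" for \<phi> n
    using norm_blinfun[of \<phi> "x n"] mult_left_mono[OF K[of n] norm_ge_zero[of \<phi>]]
    by (simp add: mult.commute)
  have K_mem: "K * norm \<phi> \<in> S \<phi>" for \<phi>
    using absK[of \<phi>] by (auto simp: S_def abs_le_iff)
  then have ne: "S \<phi> \<noteq> {}" for \<phi> by blast
  have lower: "- (K * norm \<phi>) \<le> c" if c: "c \<in> S \<phi>" for \<phi> c
  proof -
    obtain n where "blinfun_apply \<phi> (x n) \<le> c"
      using c unfolding S_def by (auto dest: eventually_happens)
    then show ?thesis using absK[of \<phi> n] by (simp add: abs_le_iff)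
  qed
  define p where "p \<phi> = Inf (S \<phi>)" for \<phi> :: "'a dual"
  have bb: "bdd_below (S \<phi>)" for \<phi> using lower by (intro bdd_belowI) blast
  have p_le: "p \<phi> \<le> c" if "c \<in> S \<phi>" for \<phi> c
    unfolding p_def using that bb by (rule cInf_lower)
  have p_ge: "m \<le> p \<phi>" if "\<And>c. c \<in> S \<phi> \<Longrightarrow> m \<le> c" for \<phi> m
    unfolding p_def using ne that by (rule cInf_greatest)
  have S_scale: "t * c \<in> S (t *\<^sub>R \<phi>)" if "c \<in> S \<phi>" "0 \<le> t" for c t \<phi>
    using that by (auto simp: S_def blinfun.scaleR_left elim!: eventually_mono intro!: mult_left_mono)
  have p_scale_le: "p (t *\<^sub>R \<phi>) \<le> t * p \<phi>" if t: "0 < t" for t \<phi>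
  proof -
    have "p (t *\<^sub>R \<phi>) / t \<le> p \<phi>"
    proof (rule p_ge)
      fix c assume "c \<in> S \<phi>"
      then have "p (t *\<^sub>R \<phi>) \<le> t * c" using S_scale t by (intro p_le) auto
      then show "p (t *\<^sub>R \<phi>) / t \<le> c" using t by (simp add: field_simps)
    qed
    then show ?thesis using t by (simp add: field_simps)
  qed
  have "sublinear p"
    unfolding sublinear_def
  proof (intro conjI allI impI)
    fix \<phi> \<psi>
    have "p (\<phi> + \<psi>) - c \<le> p \<psi>" if c: "c \<in> S \<phi>" for c
    proof (rule p_ge)
      fix d assume d: "d \<in> S \<psi>"
      have "\<forall>\<^sub>F n in sequentially. blinfun_apply (\<phi> + \<psi>) (x n) \<le> c + d"
        using c d unfolding S_def mem_Collect_eq by eventually_elim (simp add: blinfun.add_left)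
      then have "p (\<phi> + \<psi>) \<le> c + d" by (intro p_le) (simp add: S_def)
      then show "p (\<phi> + \<psi>) - c \<le> d" by simp
    qed
    then have "p (\<phi> + \<psi>) - p \<psi> \<le> c" if "c \<in> S \<phi>" for c using that by (smt (verit))
    then have "p (\<phi> + \<psi>) - p \<psi> \<le> p \<phi>" by (rule p_ge)
    then show "p (\<phi> + \<psi>) \<le> p \<phi> + p \<psi>" by simp
  next
    fix t :: real and \<phi>
    assume "0 \<le> t"
    show "p (t *\<^sub>R \<phi>) = t * p \<phi>"
    proof (cases "t = 0")
      case True
      have "p 0 \<le> 0" using K_mem[of 0] by (intro p_le) simp
      moreover have "0 \<le> p 0" using lower[of _ 0] by (intro p_ge) simp
      ultimately show ?thesis using True by simp
    next
      case False
      then have t: "0 < t" using \<open>0 \<le> t\<close> by simp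
      have "p \<phi> \<le> inverse t * p (t *\<^sub>R \<phi>)"
        using p_scale_le[of "inverse t" "t *\<^sub>R \<phi>"] t by simp
      then have "t * p \<phi> \<le> p (t *\<^sub>R \<phi>)" using t by (simp add: field_simps)
      then show ?thesis using p_scale_le[OF t, of \<phi>] by simp
    qed
  qed
  then obtain \<xi> where \<xi>: "linear \<xi>" "\<And>\<phi>. \<xi> \<phi> \<le> p \<phi>"
    by (rule hahn_banach_sublinear) blast
  have "\<xi> \<phi> \<le> K * norm \<phi>" for \<phi> :: "'a dual"
    using \<xi>(2)[of \<phi>] p_le[OF K_mem] by (rule order_trans)
  then obtain \<eta> :: "'a dual dual" where \<eta>: "\<And>\<phi>. blinfun_apply \<eta> \<phi> = \<xi> \<phi>"
    by (rule linear_bounded_dual[OF \<xi>(1)]) blast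
  obtain l where l: "\<eta> = bidual_embed l"
    using refl by (auto simp: reflexive_space_def surj_def)
  have "blinfun_apply \<phi> l \<le> c" if "\<forall>\<^sub>F n in sequentially. blinfun_apply \<phi> (x n) \<le> c" for \<phi> :: "'a dual" and c
  proof -
    have "\<xi> \<phi> \<le> c" using \<xi>(2)[of \<phi>] p_le[of c \<phi>] that by (simp add: S_def)
    then show ?thesis using \<eta>[of \<phi>] l by simp
  qed
  then show ?thesis by (rule that)
qed

text \<open>Affine minorants pass to the cluster point, and they determine \<open>f l\<close>. The
  bound contains a functional \<open>p\<close> of the point because sublevel sets of Bregman
  distances have that form.\<close>

lemma weak_cluster_point_lsc:
  fixes f :: "'a::real_normed_vector \<Rightarrow> ereal"
  assumes f: "closed_convex_fun f"
    and l: "\<And>(\<phi> :: 'a dual) c. \<forall>\<^sub>F n in sequentially. blinfun_apply \<phi> (x n) \<le> c \<Longrightarrow> blinfun_apply \<phi> l \<le> c"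
    and le: "\<And>n. f (x n) \<le> ereal (blinfun_apply p (x n) + c)"
  shows "f l \<le> ereal (blinfun_apply p l + c)"
proof (rule ccontr)
  assume "\<not> ?thesis"
  then obtain \<phi> d where \<phi>: "\<And>u. ereal (blinfun_apply \<phi> u + d) \<le> f u"
    "blinfun_apply p l + c < blinfun_apply \<phi> l + d"
    using affine_minorant_above[OF f] by (metis not_le)
  have "blinfun_apply (\<phi> - p) (x n) \<le> c - d" for n
  proof -
    have "ereal (blinfun_apply \<phi> (x n) + d) \<le> ereal (blinfun_apply p (x n) + c)"
      using \<phi>(1) le by (rule order_trans)
    then show ?thesis by (simp add: blinfun.diff_left)
  qed
  with l[of "\<phi> - p" "c - d"] have "blinfun_apply (\<phi> - p) l \<le> c - d" by simp
  then show False using \<phi>(2) by (simp add: blinfun.diff_left)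
qed

section \<open>Maximally monotone operators\<close>

lemma monotone_opD:
  assumes "monotone_op A" "\<phi> \<in> A x" "\<psi> \<in> A y"
  shows "0 \<le> blinfun_apply (\<phi> - \<psi>) (x - y)"
  using assms by (auto simp: monotone_op_def)

lemma maximally_monotoneD:
  assumes A: "maximally_monotone A"
  shows "monotone_op A"
    "(\<And>c \<phi>. \<phi> \<in> A c \<Longrightarrow> 0 \<le> blinfun_apply (\<psi> - \<phi>) (x - c)) \<Longrightarrow> \<psi> \<in> A x"
proof -
  show mono: "monotone_op A" using A by (simp add: maximally_monotone_def)
  assume *: "\<And>c \<phi>. \<phi> \<in> A c \<Longrightarrow> 0 \<le> blinfun_apply (\<psi> - \<phi>) (x - c)"
  define N where "N = A(x := insert \<psi> (A x))"
  have N: "\<phi> \<in> N c \<longleftrightarrow> \<phi> \<in> A c \<or> c = x \<and> \<phi> = \<psi>" for \<phi> c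
    by (auto simp: N_def)
  have "monotone_op N"
    unfolding monotone_op_def
  proof (intro allI ballI)
    fix c d \<phi> \<phi>' assume "\<phi> \<in> N c" "\<phi>' \<in> N d"
    moreover have "0 \<le> blinfun_apply (\<phi> - \<psi>) (c - x)" if "\<phi> \<in> A c" for c \<phi>
      using *[OF that] by (simp add: blinfun.diff_left blinfun.diff_right)
    ultimately show "0 \<le> blinfun_apply (\<phi> - \<phi>') (c - d)"
      using * monotone_opD[OF mono] unfolding N by (elim disjE) auto
  qed
  moreover have "\<forall>c. A c \<subseteq> N c" using N by blast
  ultimately have "N = A" using A by (simp add: maximally_monotone_def)
  moreover have "\<psi> \<in> N x" by (simp add: N)
  ultimately show "\<psi> \<in> A x" by simp
qed

text \<open>In the proof, \<open>D\<close> is the epigraph of \<open>(x, \<phi>) \<mapsto> F\<^sub>A (x, - \<phi>)\<close> for the Fitzpatrick function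
  \<open>F\<^sub>A (x, \<phi>) \<ge> \<phi> x\<close> of \<open>A\<close>. The functional separating it from \<open>k x + k\<^sup>* \<phi>\<close> is, up to sign, the
  sought pair.\<close>

theorem bounded_domain_zero_exists:
  fixes A :: "'a::banach \<Rightarrow> 'a dual set"
  assumes refl: "reflexive_space TYPE('a)"
    and mono: "monotone_op A"
    and maxi: "\<And>x \<psi>. (\<And>c \<phi>. \<phi> \<in> A c \<Longrightarrow> 0 \<le> blinfun_apply (\<psi> - \<phi>) (x - c)) \<Longrightarrow> \<psi> \<in> A x"
    and k: "closed_convex_fun k" and r: "\<And>u. u \<in> edom k \<Longrightarrow> norm u \<le> r"
    and z: "\<zeta> \<in> A z" and \<rho>: "0 < \<rho>" "\<And>u. norm (u - z) < \<rho> \<Longrightarrow> k u \<le> ereal M"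
  shows "\<exists>a \<phi>. \<phi> \<in> A a \<and> - \<phi> \<in> subdifferential k a"
proof -
  note conj_le = conjugate_le_iff[of k, OF closed_convex_funD(1)[OF k]]
  define E where "E = epi (sep_sum k (conjugate k))"
  define D where "D = {((x :: 'a, \<phi> :: 'a dual), t :: real).
    \<forall>c. \<forall>\<psi>\<in>A c. blinfun_apply \<psi> x - blinfun_apply \<phi> c - blinfun_apply \<psi> c \<le> t}"
  have cE: "convex E"
    unfolding E_def by (intro closed_convex_funD closed_convex_fun_sep_sum closed_convex_fun_conjugate k)
  have cD: "convex D"
    unfolding D_def
  proof (rule convexI, clarsimp)
    fix x y :: 'a and \<phi> \<phi>' \<psi> :: "'a dual" and a b s t :: real and c
    assume *: "\<forall>c. \<forall>\<psi>\<in>A c. blinfun_apply \<psi> x - blinfun_apply \<phi> c - blinfun_apply \<psi> c \<le> a"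
      "\<forall>c. \<forall>\<psi>\<in>A c. blinfun_apply \<psi> y - blinfun_apply \<phi>' c - blinfun_apply \<psi> c \<le> b"
      "0 \<le> s" "0 \<le> t" "s + t = 1" "\<psi> \<in> A c"
    have "s * (blinfun_apply \<psi> x - blinfun_apply \<phi> c - blinfun_apply \<psi> c)
        + t * (blinfun_apply \<psi> y - blinfun_apply \<phi>' c - blinfun_apply \<psi> c) \<le> s * a + t * b"
      using * by (intro add_mono mult_left_mono) auto
    moreover have "s * blinfun_apply \<psi> c + t * blinfun_apply \<psi> c = blinfun_apply \<psi> c"
      using *(5) by (simp flip: distrib_right)
    ultimately show "blinfun_apply \<psi> (s *\<^sub>R x + t *\<^sub>R y) - blinfun_apply (s *\<^sub>R \<phi> + t *\<^sub>R \<phi>') c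
        - blinfun_apply \<psi> c \<le> s * a + t * b"
      by (simp add: blinfun.add_right blinfun.add_left blinfun.scaleR_left blinfun.scaleR_right algebra_simps)
  qed
  have graph: "((x, - \<phi>), blinfun_apply \<phi> x) \<in> D" if "\<phi> \<in> A x" for x \<phi>
  proof -
    have "blinfun_apply \<psi> x + blinfun_apply \<phi> c - blinfun_apply \<psi> c \<le> blinfun_apply \<phi> x" if "\<psi> \<in> A c" for c \<psi>
      using monotone_opD[OF mono \<open>\<phi> \<in> A x\<close> that] by (simp add: blinfun.diff_left blinfun.diff_right)
    then show ?thesis by (simp add: D_def blinfun.minus_left)
  qed
  have nonneg: "0 \<le> s + t" if E: "(w, s) \<in> E" and D: "(w, t) \<in> D" for w s t
  proof (rule ccontr)
    assume neg: "\<not> ?thesis"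
    obtain x \<phi> where w: "w = (x, \<phi>)" by force
    have sum: "k x + conjugate k \<phi> \<le> ereal s" using E by (simp add: E_def w)
    obtain a where a: "k x = ereal a"
      using sum closed_convex_funD(1)[OF k, of x] closed_convex_funD(1)[OF closed_convex_fun_conjugate[OF k], of \<phi>]
      by (cases "k x"; cases "conjugate k \<phi>") auto
    obtain b where b: "conjugate k \<phi> = ereal b"
      using sum a closed_convex_funD(1)[OF closed_convex_fun_conjugate[OF k], of \<phi>]
      by (cases "conjugate k \<phi>") auto
    have "blinfun_apply \<phi> x - b \<le> a"
      using conj_le[of \<phi> b] a b by (metis order_refl)
    then have s: "blinfun_apply \<phi> x \<le> s" using sum a b by simp
    \<comment> \<open>A negative sum makes \<open>- \<phi>\<close> strictly monotonically related to
      the whole graph; by maximality it belongs to the graph and is so related to itself.\<close>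
    have pos: "0 < blinfun_apply (- \<phi> - \<psi>) (x - c)" if "\<psi> \<in> A c" for c \<psi>
    proof -
      have "blinfun_apply \<psi> x - blinfun_apply \<phi> c - blinfun_apply \<psi> c \<le> t"
        using D that by (simp add: D_def w)
      then show ?thesis using s neg
        by (simp add: blinfun.diff_left blinfun.diff_right blinfun.minus_left)
    qed
    then have "- \<phi> \<in> A x" by (intro maxi less_imp_le)
    from pos[OF this] show False by simp
  qed
  obtain p :: "'a dual" and d where p: "\<And>u. ereal (blinfun_apply p u + d) \<le> k u"
    using affine_minorant_exists[OF k] by blast
  \<comment> \<open>Bounds the conjugate of \<open>k\<close> on the unit ball around
    \<open>- \<zeta>\<close>, since the domain of \<open>k\<close> lies in the ball of radius
    \<open>r\<close> and \<open>k\<close> has an affine minorant. Here the bounded domain gives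
    \<open>E\<close> its interior.\<close>
  define M' where "M' = (norm \<zeta> + 1 + norm p) * r - d"
  have ball: "(w, M + M') \<in> E" if w: "norm (w - (z, - \<zeta>)) < min \<rho> 1" for w
  proof -
    obtain x \<phi> where xw: "w = (x, \<phi>)" by force
    have "norm (x - z) < \<rho>" "norm (\<phi> + \<zeta>) < 1"
      using w norm_fst_le[of "x - z" "\<phi> + \<zeta>"] norm_snd_le[of "\<phi> + \<zeta>" "x - z"] by (auto simp: xw)
    then have 1: "k x \<le> ereal M" and n: "norm \<phi> \<le> norm \<zeta> + 1"
      using \<rho>(2) norm_triangle_ineq4[of "\<phi> + \<zeta>" \<zeta>] by auto
    have "conjugate k \<phi> \<le> ereal M'"
      unfolding conj_le
    proof (intro allI impI)
      fix u a assume ua: "k u \<le> ereal a"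
      then have "u \<in> edom k" by (auto simp: edom_def intro: le_less_trans)
      then have ur: "norm u \<le> r" by (rule r)
      have "ereal (blinfun_apply p u + d) \<le> ereal a" using p ua by (rule order_trans)
      moreover have "blinfun_apply (\<phi> - p) u \<le> (norm \<zeta> + 1 + norm p) * r"
      proof -
        have "blinfun_apply (\<phi> - p) u \<le> norm (\<phi> - p) * norm u"
          using norm_blinfun[of "\<phi> - p" u] by (simp add: abs_le_iff)
        also have "\<dots> \<le> (norm \<zeta> + 1 + norm p) * r"
          using n norm_triangle_ineq4[of \<phi> p] ur by (intro mult_mono) auto
        finally show ?thesis .
      qed
      ultimately show "blinfun_apply \<phi> u - M' \<le> a"
        by (simp add: M'_def blinfun.diff_left)
    qed
    with 1 have "k x + conjugate k \<phi> \<le> ereal M + ereal M'" by (rule add_mono)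
    then show ?thesis by (simp add: E_def xw)
  qed
  have "0 < min \<rho> 1" using \<rho>(1) by simp
  then obtain \<Phi> c where 1: "\<And>w a. (w, a) \<in> E \<Longrightarrow> blinfun_apply \<Phi> w + c \<le> a"
    and 2: "\<And>w b. (w, b) \<in> D \<Longrightarrow> - blinfun_apply \<Phi> w - c \<le> b"
    by (rule sandwich[where M="M + M'", OF cE cD _ _ graph[OF z]]) (use ball nonneg in blast)+
  obtain q \<xi> where \<Phi>: "\<Phi> = pair_dual q \<xi>" by (rule pair_dual_cases)
  obtain y where y: "\<xi> = bidual_embed y"
    using refl by (auto simp: reflexive_space_def surj_def)
  \<comment> \<open>Optimizing the separation inequality over \<open>\<phi>\<close> replaces the
    conjugate of \<open>k\<close> by \<open>k y\<close>; affine minorants of \<open>k\<close> do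
    this without a biconjugate.\<close>
  have ky: "k y \<le> ereal (s - blinfun_apply q x - c)" if xs: "k x \<le> ereal s" for x s
  proof (rule ccontr)
    assume "\<not> ?thesis"
    then obtain \<phi> d where \<phi>: "\<And>u. ereal (blinfun_apply \<phi> u + d) \<le> k u"
      "s - blinfun_apply q x - c < blinfun_apply \<phi> y + d"
      using affine_minorant_above[OF k] by (metis not_le)
    have "conjugate k \<phi> \<le> ereal (- d)"
      unfolding conj_le
    proof (intro allI impI)
      fix u a assume "k u \<le> ereal a"
      with \<phi>(1)[of u] have "ereal (blinfun_apply \<phi> u + d) \<le> ereal a" by (rule order_trans)
      then show "blinfun_apply \<phi> u - - d \<le> a" by simp
    qed
    with xs have "k x + conjugate k \<phi> \<le> ereal s + ereal (- d)" by (rule add_mono)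
    then have "((x, \<phi>), s - d) \<in> E" by (simp add: E_def)
    from 1[OF this] \<phi>(2) show False by (simp add: \<Phi> y)
  qed
  have "k z \<le> ereal M" using \<rho> by simp
  from ky[OF this] obtain b where b: "k y = ereal b"
    using closed_convex_funD(1)[OF k, of y] by (cases "k y") auto
  have le: "blinfun_apply q x + b + c \<le> s" if "k x \<le> ereal s" for x s
    using ky[OF that] b by simp
  have qy: "blinfun_apply q y + c \<le> 0" using le[of y b] b by simp
  have graph_le: "- c - blinfun_apply q y \<le> blinfun_apply (\<phi> + q) (x - y)" if "\<phi> \<in> A x" for x \<phi>
    using 2[OF graph[OF that]] by (simp add: \<Phi> y blinfun.add_left blinfun.diff_right blinfun.minus_left)
  have qA: "- q \<in> A y"
  proof (rule maxi)
    fix x \<phi> assume "\<phi> \<in> A x"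
    from graph_le[OF this] qy show "0 \<le> blinfun_apply (- q - \<phi>) (y - x)"
      by (simp add: blinfun.add_left blinfun.diff_left blinfun.diff_right blinfun.minus_left)
  qed
  \<comment> \<open>The graph inequality at the new point \<open>(y, - q)\<close> itself reverses
    \<open>qy\<close>.\<close>
  have "c = - blinfun_apply q y" using graph_le[OF qA] qy by simp
  then have "q \<in> subdifferential k y"
    using le by (subst subdifferential_iff[of k, OF b closed_convex_funD(1)[OF k]])
      (fastforce simp: blinfun.diff_right)
  with qA show ?thesis by (intro exI[of _ y] exI[of _ "- q"]) simp
qed

text \<open>Coercivity is given for the parameter \<open>\<epsilon>\<close> only. For larger
  \<open>\<gamma>\<close> the surplus \<open>\<gamma> - \<epsilon>\<close>, by monotonicity against
  the fixed graph point \<open>(z, \<zeta>)\<close>, costs at most a multiple of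
  \<open>norm (a - z)\<close>, so one radius serves all parameters up to
  \<open>\<sigma>\<close>.\<close>

lemma coercive_gradient_plus_estimate:
  fixes h :: "'a::real_normed_vector \<Rightarrow> ereal"
  assumes mono: "monotone_op A" and coercive: "coercive_op (gradient_plus h \<epsilon> A)"
  obtains z \<zeta> where "z \<in> interior (edom h)" "\<zeta> \<in> A z"
    "\<And>U \<sigma>. \<exists>R. \<forall>\<gamma>\<in>{\<epsilon>..\<sigma>}. \<forall>a\<in>interior (edom h). \<forall>\<phi>\<in>A a.
      blinfun_apply (gradient h a + \<gamma> *\<^sub>R \<phi>) (a - z) \<le> U * norm (a - z) \<longrightarrow> norm a < R"
proof -
  let ?M = "gradient_plus h \<epsilon> A"
  obtain z where z: "z \<in> op_dom ?M" and
    lim: "((\<lambda>x. INF \<phi>\<in>?M x. ereal (blinfun_apply \<phi> (x - z) / norm x)) \<longlongrightarrow> \<infinity>) at_infinity"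
    using coercive by (auto simp: coercive_op_def)
  obtain \<zeta> where \<zeta>: "z \<in> interior (edom h)" "\<zeta> \<in> A z"
    using z by (auto simp: op_dom_def gradient_plus_def split: if_splits)
  have "\<exists>R. \<forall>\<gamma>\<in>{\<epsilon>..\<sigma>}. \<forall>a\<in>interior (edom h). \<forall>\<phi>\<in>A a.
      blinfun_apply (gradient h a + \<gamma> *\<^sub>R \<phi>) (a - z) \<le> U * norm (a - z) \<longrightarrow> norm a < R" for U \<sigma>
  proof -
    define V where "V = \<bar>U\<bar> + \<bar>\<sigma> - \<epsilon>\<bar> * norm \<zeta>"
    have V: "0 \<le> V" by (simp add: V_def)
    have "\<forall>\<^sub>F x in at_infinity. ereal (2 * V + 1) < (INF \<phi>\<in>?M x. ereal (blinfun_apply \<phi> (x - z) / norm x))"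
      using lim unfolding tendsto_PInfty by blast
    then obtain R where R: "\<And>x. R \<le> norm x \<Longrightarrow>
        ereal (2 * V + 1) < (INF \<phi>\<in>?M x. ereal (blinfun_apply \<phi> (x - z) / norm x))"
      by (auto simp: eventually_at_infinity)
    \<comment> \<open>Beyond \<open>norm z + 1\<close> the point \<open>a\<close> is nonzero with
      \<open>norm (a - z) \<le> 2 * norm a\<close>, and growth at rate \<open>2 * V + 1\<close>
      beats the error \<open>V * norm (a - z)\<close>.\<close>
    have "norm a < max R (norm z + 1)"
      if \<gamma>: "\<gamma> \<in> {\<epsilon>..\<sigma>}" and a: "a \<in> interior (edom h)" "\<phi> \<in> A a" and
        le: "blinfun_apply (gradient h a + \<gamma> *\<^sub>R \<phi>) (a - z) \<le> U * norm (a - z)" for \<gamma> a \<phi>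
    proof (rule ccontr)
      assume "\<not> ?thesis"
      then have na: "R \<le> norm a" "norm z + 1 \<le> norm a" by auto
      then have a0: "0 < norm a" using norm_ge_zero[of z] by linarith
      have "gradient h a + \<epsilon> *\<^sub>R \<phi> \<in> ?M a" using a by (auto simp: gradient_plus_def)
      then have "ereal (2 * V + 1) < ereal (blinfun_apply (gradient h a + \<epsilon> *\<^sub>R \<phi>) (a - z) / norm a)"
        using R[OF na(1)] by (meson INF_lower order.strict_trans2)
      then have 1: "(2 * V + 1) * norm a < blinfun_apply (gradient h a + \<epsilon> *\<^sub>R \<phi>) (a - z)"
        using a0 by (simp add: field_simps)
      have "0 \<le> (\<gamma> - \<epsilon>) * blinfun_apply (\<phi> - \<zeta>) (a - z)"
        using monotone_opD[OF mono a(2) \<zeta>(2)] \<gamma> by simp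
      moreover have "- ((\<gamma> - \<epsilon>) * blinfun_apply \<zeta> (a - z)) \<le> \<bar>\<sigma> - \<epsilon>\<bar> * norm \<zeta> * norm (a - z)"
      proof -
        have "- blinfun_apply \<zeta> (a - z) \<le> norm \<zeta> * norm (a - z)"
          using norm_blinfun[of \<zeta> "a - z"] by (simp add: abs_le_iff)
        then have "(\<gamma> - \<epsilon>) * - blinfun_apply \<zeta> (a - z) \<le> \<bar>\<sigma> - \<epsilon>\<bar> * (norm \<zeta> * norm (a - z))"
          using \<gamma> by (intro order_trans[OF mult_left_mono mult_right_mono]) auto
        then show ?thesis by (simp add: mult.assoc)
      qed
      moreover have "U * norm (a - z) \<le> \<bar>U\<bar> * norm (a - z)" by (intro mult_right_mono) auto
      ultimately have "(2 * V + 1) * norm a < V * norm (a - z)"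
        using 1 le by (simp add: V_def blinfun.add_left blinfun.scaleR_left blinfun.diff_left algebra_simps)
      also have "\<dots> \<le> V * (2 * norm a)"
        using V norm_triangle_ineq4[of a z] na(2) by (intro mult_left_mono) auto
      finally show False using a0 by (simp add: algebra_simps)
    qed
    then show ?thesis by blast
  qed
  with \<zeta> show ?thesis by (rule that)
qed

lemma blinfun_nonneg_near_imp_0:
  fixes p :: "'a::real_normed_vector dual"
  assumes "0 < \<rho>" "\<And>x. norm (x - a) < \<rho> \<Longrightarrow> 0 \<le> blinfun_apply p (x - a)"
  shows "p = 0"
proof (rule blinfun_eqI)
  have nn: "0 \<le> blinfun_apply p v" for v
  proof (cases "v = 0")
    case False
    define t where "t = \<rho> / (2 * norm v)"
    have t: "0 < t" using False assms(1) by (simp add: t_def)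
    have "norm (a + t *\<^sub>R v - a) < \<rho>" using False assms(1) by (simp add: t_def)
    from assms(2)[OF this] show ?thesis using t by (simp add: blinfun.scaleR_right zero_le_mult_iff)
  qed simp
  fix v show "blinfun_apply p v = blinfun_apply 0 v"
    using nn[of v] nn[of "- v"] by (simp add: blinfun.minus_right)
qed

text \<open>On the ball the existence theorem solves the inclusion only up to a normal vector.
  Tested at \<open>z\<close>, the resulting variational inequality is the hypothesis of the
  coercivity estimate, which places the solution strictly inside; there the inequality holds in all
  directions and becomes an equation.\<close>

theorem gradient_plus_surjective:
  fixes A :: "'a::banach \<Rightarrow> 'a dual set"
  assumes refl: "reflexive_space TYPE('a)" and A: "maximally_monotone A" and h: "bregman_fun h"
    and \<epsilon>: "0 < \<epsilon>" and coercive: "coercive_op (gradient_plus h \<epsilon> A)" and \<gamma>: "\<epsilon> \<le> \<gamma>"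
  obtains a where "u \<in> gradient_plus h \<gamma> A a"
proof -
  note mono = maximally_monotoneD(1)[OF A] and c = bregman_funD(1)[OF h]
  have \<gamma>0: "0 < \<gamma>" using \<epsilon> \<gamma> by simp
  obtain z \<zeta> where z: "z \<in> interior (edom h)" "\<zeta> \<in> A z" and
    est: "\<And>U \<sigma>. \<exists>R. \<forall>\<gamma>\<in>{\<epsilon>..\<sigma>}. \<forall>a\<in>interior (edom h). \<forall>\<phi>\<in>A a.
      blinfun_apply (gradient h a + \<gamma> *\<^sub>R \<phi>) (a - z) \<le> U * norm (a - z) \<longrightarrow> norm a < R"
    by (rule coercive_gradient_plus_estimate[OF mono coercive]) blast
  obtain R where R: "\<And>a \<phi>. a \<in> interior (edom h) \<Longrightarrow> \<phi> \<in> A a \<Longrightarrow>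
      blinfun_apply (gradient h a + \<gamma> *\<^sub>R \<phi>) (a - z) \<le> norm u * norm (a - z) \<Longrightarrow> norm a < R"
    using est[of \<gamma> "norm u"] \<gamma> by (metis atLeastAtMost_iff order_refl)
  \<comment> \<open>At least \<open>R\<close>, so that the solution is interior to the ball, and
    large enough to contain the unit ball around \<open>z\<close>, so that \<open>k\<close> is
    bounded above near \<open>z\<close>.\<close>
  define r where "r = max R (norm z + 1)"
  have zr: "norm z + 1 \<le> r" by (simp add: r_def)
  define A' where "A' x = {\<gamma> *\<^sub>R \<phi> |\<phi>. \<phi> \<in> A x}" for x
  have mono': "monotone_op A'"
    unfolding monotone_op_def
  proof (intro allI ballI)
    fix x y \<phi> \<psi> assume "\<phi> \<in> A' x" "\<psi> \<in> A' y"
    then obtain \<phi>' \<psi>' where *: "\<phi> = \<gamma> *\<^sub>R \<phi>'" "\<psi> = \<gamma> *\<^sub>R \<psi>'" "\<phi>' \<in> A x" "\<psi>' \<in> A y"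
      by (auto simp: A'_def)
    have "0 \<le> \<gamma> * blinfun_apply (\<phi>' - \<psi>') (x - y)"
      using monotone_opD[OF mono *(3,4)] \<gamma>0 by simp
    then show "0 \<le> blinfun_apply (\<phi> - \<psi>) (x - y)"
      by (simp add: * blinfun.scaleR_left blinfun.diff_left algebra_simps)
  qed
  have maxi': "\<psi> \<in> A' x" if *: "\<And>c \<phi>. \<phi> \<in> A' c \<Longrightarrow> 0 \<le> blinfun_apply (\<psi> - \<phi>) (x - c)" for x \<psi>
  proof -
    have "inverse \<gamma> *\<^sub>R \<psi> \<in> A x"
    proof (rule maximally_monotoneD(2)[OF A])
      fix c \<phi> assume "\<phi> \<in> A c"
      then have "0 \<le> blinfun_apply (\<psi> - \<gamma> *\<^sub>R \<phi>) (x - c)" by (intro *) (auto simp: A'_def)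
      then have "0 \<le> inverse \<gamma> * blinfun_apply (\<psi> - \<gamma> *\<^sub>R \<phi>) (x - c)" using \<gamma>0 by simp
      then show "0 \<le> blinfun_apply (inverse \<gamma> *\<^sub>R \<psi> - \<phi>) (x - c)"
        using \<gamma>0 by (simp add: blinfun.scaleR_left blinfun.diff_left field_simps)
    qed
    moreover have "\<psi> = \<gamma> *\<^sub>R (inverse \<gamma> *\<^sub>R \<psi>)" using \<gamma>0 by simp
    ultimately show ?thesis unfolding A'_def by blast
  qed
  define k where "k x = (if x \<in> cball 0 r then h x + ereal (- blinfun_apply u x) else \<infinity>)" for x
  have ze: "z \<in> edom h" using z(1) interior_subset by blast
  have "convex_on UNIV (\<lambda>x. - blinfun_apply u x)"
    by (auto simp: convex_on_def blinfun.add_right blinfun.scaleR_right)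
  then have "closed_convex_fun (\<lambda>x. h x + ereal (- blinfun_apply u x))"
    by (intro closed_convex_fun_add_continuous c) (auto intro!: continuous_intros)
  moreover have "cball 0 r \<inter> edom (\<lambda>x. h x + ereal (- blinfun_apply u x)) \<noteq> {}"
  proof -
    have "z \<in> cball 0 r" using zr by simp
    moreover have "z \<in> edom (\<lambda>x. h x + ereal (- blinfun_apply u x))" using ze by (simp add: edom_def)
    ultimately show ?thesis by blast
  qed
  ultimately have k: "closed_convex_fun k"
    unfolding k_def by (intro closed_convex_fun_restrict) auto
  obtain \<rho> M where \<rho>: "0 < \<rho>" "\<And>x. norm (x - z) < \<rho> \<Longrightarrow> h x \<le> ereal M"
    using bounded_above_near_interior[OF c z(1)] by blast
  have kM: "k x \<le> ereal (M + norm u * r)" if "norm (x - z) < min \<rho> 1" for x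
  proof -
    have "norm x \<le> r" using that zr norm_triangle_ineq[of "x - z" z] by simp
    then have "- blinfun_apply u x \<le> norm u * r"
      using norm_blinfun[of u x] mult_left_mono[of "norm x" r "norm u"] by (simp add: abs_le_iff)
    then have "h x + ereal (- blinfun_apply u x) \<le> ereal M + ereal (norm u * r)"
      using that \<rho>(2) by (intro add_mono) auto
    then show ?thesis using \<open>norm x \<le> r\<close> by (simp add: k_def)
  qed
  have "norm x \<le> r" if "x \<in> edom k" for x
    using that by (auto simp: k_def edom_def split: if_splits)
  moreover have "\<gamma> *\<^sub>R \<zeta> \<in> A' z" using z(2) by (auto simp: A'_def)
  moreover have "0 < min \<rho> 1" using \<rho>(1) by simp
  ultimately obtain a \<phi>' where "\<phi>' \<in> A' a" "- \<phi>' \<in> subdifferential k a"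
    using bounded_domain_zero_exists[OF refl mono' maxi' k _ _ _ kM] by blast
  then obtain \<phi> where \<phi>: "\<phi> \<in> A a" "- (\<gamma> *\<^sub>R \<phi>) \<in> subdifferential k a"
    by (auto simp: A'_def)
  have "a \<in> edom k" by (rule subdifferential_edom[OF k \<phi>(2)])
  then have a: "norm a \<le> r" "h a < \<infinity>"
    by (auto simp: k_def edom_def split: if_splits)
  \<comment> \<open>A second sum rule splits the subgradient of \<open>k\<close> into the gradient
    of \<open>h\<close> and a part that comes from the ball; \<open>m\<close> is the objective
    without \<open>h\<close>.\<close>
  define m where "m x = (if x \<in> cball 0 r then ereal (blinfun_apply (\<gamma> *\<^sub>R \<phi> - u) x) else \<infinity>)" for x
  have "convex (epi m)"
  proof -
    have "epi m = epi (\<lambda>x. ereal (blinfun_apply (\<gamma> *\<^sub>R \<phi> - u) x)) \<inter> cball 0 r \<times> UNIV"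
      by (auto simp: m_def split: if_splits)
    moreover have "convex_on UNIV (\<lambda>x. blinfun_apply (\<gamma> *\<^sub>R \<phi> - u) x)"
      by (auto simp: convex_on_def blinfun.add_right blinfun.scaleR_right)
    then have "convex (epi (\<lambda>x. ereal (blinfun_apply (\<gamma> *\<^sub>R \<phi> - u) x)))" by (rule convex_epi_real)
    ultimately show ?thesis by (auto intro!: convex_Int convex_Times)
  qed
  moreover have "m x \<noteq> -\<infinity>" for x by (simp add: m_def)
  moreover have "m z < \<infinity>" "m a < \<infinity>" using zr a(1) by (auto simp: m_def)
  moreover have "h a + m a \<le> h x + m x" for x
  proof (cases "norm x \<le> r")
    case True
    have "ereal (blinfun_apply (- (\<gamma> *\<^sub>R \<phi>)) (x - a)) + k a \<le> k x"
      using \<phi>(2) by (simp add: subdifferential_def)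
    then show ?thesis
      using True a closed_convex_funD(1)[OF c, of a] closed_convex_funD(1)[OF c, of x]
      by (cases "h a"; cases "h x")
        (auto simp: k_def m_def blinfun.diff_left blinfun.diff_right blinfun.minus_left)
  next
    case False
    then show ?thesis
      using closed_convex_funD(1)[OF c, of x] by (cases "h x") (auto simp: m_def)
  qed
  ultimately obtain p where p: "p \<in> subdifferential h a" "- p \<in> subdifferential m a"
    using subdifferential_sum_rule[of h m \<rho> z M a] closed_convex_funD(1,3)[OF c] \<rho> a(2) by blast
  have aI: "a \<in> interior (edom h)" and pa: "p = gradient h a"
    using p(1) bregman_fun_subdifferential[OF h] by auto
  define w where "w = gradient h a + \<gamma> *\<^sub>R \<phi> - u"
  have var: "0 \<le> blinfun_apply w (x - a)" if "norm x \<le> r" for x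
  proof -
    have "ereal (blinfun_apply (- p) (x - a)) + m a \<le> m x"
      using p(2) by (simp add: subdifferential_def)
    then show ?thesis using that a(1)
      by (simp add: m_def w_def pa blinfun.diff_left blinfun.diff_right blinfun.minus_left blinfun.add_left)
  qed
  have "blinfun_apply (gradient h a + \<gamma> *\<^sub>R \<phi>) (a - z) \<le> blinfun_apply u (a - z)"
    using var[of z] zr by (simp add: w_def blinfun.diff_left blinfun.diff_right blinfun.add_left)
  also have "\<dots> \<le> norm u * norm (a - z)"
    using norm_blinfun[of u "a - z"] by (simp add: abs_le_iff)
  finally have "norm a < r" using R[OF aI \<phi>(1)] by (simp add: r_def)
  have "w = 0"
  proof (rule blinfun_nonneg_near_imp_0)
    show "0 < r - norm a" using \<open>norm a < r\<close> by simp
    fix x assume "norm (x - a) < r - norm a"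
    then show "0 \<le> blinfun_apply w (x - a)"
      using norm_triangle_ineq[of "x - a" a] by (intro var) simp
  qed
  then have "u = gradient h a + \<gamma> *\<^sub>R \<phi>" by (simp add: w_def)
  then have "u \<in> gradient_plus h \<gamma> A a" using aI \<phi>(1) by (auto simp: gradient_plus_def)
  then show ?thesis by (rule that)
qed

theorem gradient_plus_inv:
  fixes A :: "'a::banach \<Rightarrow> 'a dual set"
  assumes refl: "reflexive_space TYPE('a)" and A: "maximally_monotone A" and h: "bregman_fun h"
    and \<epsilon>: "0 < \<epsilon>" and coercive: "coercive_op (gradient_plus h \<epsilon> A)" and \<gamma>: "\<epsilon> \<le> \<gamma>"
  shows "u \<in> gradient_plus h \<gamma> A (gradient_plus_inv h \<gamma> A u)"
proof -
  obtain a where a: "u \<in> gradient_plus h \<gamma> A a"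
    by (rule gradient_plus_surjective[OF assms]) blast
  have "a' = a" if a': "u \<in> gradient_plus h \<gamma> A a'" for a'
  proof (rule ccontr)
    assume ne: "a' \<noteq> a"
    obtain \<phi> where \<phi>: "a \<in> interior (edom h)" "\<phi> \<in> A a" "u = gradient h a + \<gamma> *\<^sub>R \<phi>"
      using a by (auto simp: gradient_plus_def split: if_splits)
    obtain \<phi>' where \<phi>': "a' \<in> interior (edom h)" "\<phi>' \<in> A a'" "u = gradient h a' + \<gamma> *\<^sub>R \<phi>'"
      using a' by (auto simp: gradient_plus_def split: if_splits)
    have "gradient h a' - gradient h a = - (\<gamma> *\<^sub>R (\<phi>' - \<phi>))"
      using \<phi>(3) \<phi>'(3) by (simp add: algebra_simps)
    then have "blinfun_apply (gradient h a' - gradient h a) (a' - a) = - (\<gamma> * blinfun_apply (\<phi>' - \<phi>) (a' - a))"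
      by (simp add: blinfun.minus_left blinfun.scaleR_left)
    moreover have "0 \<le> \<gamma> * blinfun_apply (\<phi>' - \<phi>) (a' - a)"
      using monotone_opD[OF maximally_monotoneD(1)[OF A] \<phi>'(2) \<phi>(2)] \<epsilon> \<gamma> by simp
    ultimately show False
      using strictly_monotone_gradient[OF h \<phi>'(1) \<phi>(1) ne] by simp
  qed
  with a have "gradient_plus_inv h \<gamma> A u = a"
    unfolding gradient_plus_inv_def by (rule the_equality)
  with a show ?thesis by simp
qed

section \<open>The Kuhn--Tucker set as an intersection of half-spaces\<close>

definition kt_functional ::
  "('a::real_normed_vector \<Rightarrow>\<^sub>L 'b::real_normed_vector) \<Rightarrow> 'a \<Rightarrow> 'a dual \<Rightarrow> 'b \<Rightarrow> 'b dual \<Rightarrow> ('a \<times> 'b dual) dual"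
  where "kt_functional L a a' b b' = pair_dual (a' + adjoint_op L b') (bidual_embed (b - blinfun_apply L a))"

definition kt_halfspace ::
  "('a::real_normed_vector \<Rightarrow>\<^sub>L 'b::real_normed_vector) \<Rightarrow> 'a \<Rightarrow> 'a dual \<Rightarrow> 'b \<Rightarrow> 'b dual \<Rightarrow> ('a \<times> 'b dual) set"
  where "kt_halfspace L a a' b b' =
    {z. blinfun_apply (kt_functional L a a' b b') z \<le> blinfun_apply a' a + blinfun_apply b' b}"

lemma adjoint_op_apply [simp]: "blinfun_apply (adjoint_op L \<psi>) x = blinfun_apply \<psi> (blinfun_apply L x)"
  by (simp add: adjoint_op_def)

lemma norm_adjoint_op: "norm (adjoint_op L \<psi>) \<le> norm \<psi> * norm L"
  unfolding adjoint_op_def by (rule norm_blinfun_compose)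

text \<open>Splits the violation into one monotonicity term for \<open>A\<close> and one for
  \<open>B\<close>. For graph points both are nonpositive at a Kuhn-Tucker point, and at the
  iterates both turn into gradient differences.\<close>

lemma kt_functional_gap:
  "blinfun_apply (kt_functional L a a' b b') (x, y) - (blinfun_apply a' a + blinfun_apply b' b) =
    blinfun_apply (a' + adjoint_op L y) (x - a) + blinfun_apply (b' - y) (blinfun_apply L x - b)"
  by (simp add: kt_functional_def blinfun.add_left blinfun.diff_left blinfun.add_right blinfun.diff_right)

lemma closed_kt_halfspace: "closed (kt_halfspace L a a' b b')"
  unfolding kt_halfspace_def by (intro closed_Collect_le continuous_intros)

lemma convex_kt_halfspace: "convex (kt_halfspace L a a' b b')"
  unfolding kt_halfspace_def by (rule convex_blinfun_halfspace)

text \<open>The infimum of these products over the graph is never positive, the basic property of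
  the Fitzpatrick function. It lets the term of one operator be made negligible while the other is
  tested.\<close>

lemma maximally_monotone_gap:
  assumes A: "maximally_monotone A" and e: "0 < e"
  shows "\<exists>c. \<exists>\<phi>\<in>A c. blinfun_apply (\<psi> - \<phi>) (x - c) < e"
proof (cases "\<psi> \<in> A x")
  case True
  then show ?thesis using e by (intro exI[of _ x] bexI[of _ \<psi>]) simp_all
next
  case False
  then obtain c \<phi> where "\<phi> \<in> A c" "\<not> 0 \<le> blinfun_apply (\<psi> - \<phi>) (x - c)"
    using maximally_monotoneD(2)[OF A, of \<psi> x] by blast
  then show ?thesis using e by (intro exI[of _ c] bexI[of _ \<phi>]) simp_all
qed

text \<open>The half-spaces control only the sum of the two terms. If the term of one operator were
  negative, a graph point of the other with a small enough term would make the sum negative.\<close>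

theorem kuhn_tucker_set_eq:
  assumes A: "maximally_monotone A" and B: "maximally_monotone B"
  shows "kuhn_tucker_set A B L = {z. \<forall>a. \<forall>a'\<in>A a. \<forall>b. \<forall>b'\<in>B b. z \<in> kt_halfspace L a a' b b'}"
proof -
  have mem: "(x, y) \<in> kt_halfspace L a a' b b' \<longleftrightarrow>
      0 \<le> blinfun_apply (- adjoint_op L y - a') (x - a) + blinfun_apply (y - b') (blinfun_apply L x - b)"
    for x y a a' b b'
    using kt_functional_gap[of L a a' b b' x y]
    by (auto simp: kt_halfspace_def blinfun.add_left blinfun.diff_left blinfun.minus_left)
  have "(x, y) \<in> kuhn_tucker_set A B L \<longleftrightarrow> (\<forall>a. \<forall>a'\<in>A a. \<forall>b. \<forall>b'\<in>B b. (x, y) \<in> kt_halfspace L a a' b b')"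
    for x y
  proof
    assume "(x, y) \<in> kuhn_tucker_set A B L"
    then have *: "- adjoint_op L y \<in> A x" "y \<in> B (blinfun_apply L x)"
      by (auto simp: kuhn_tucker_set_def op_inverse_def)
    show "\<forall>a. \<forall>a'\<in>A a. \<forall>b. \<forall>b'\<in>B b. (x, y) \<in> kt_halfspace L a a' b b'"
      unfolding mem
      using monotone_opD[OF maximally_monotoneD(1)[OF A] *(1)] monotone_opD[OF maximally_monotoneD(1)[OF B] *(2)]
      by (auto intro: add_nonneg_nonneg)
  next
    assume H: "\<forall>a. \<forall>a'\<in>A a. \<forall>b. \<forall>b'\<in>B b. (x, y) \<in> kt_halfspace L a a' b b'"
    have "- adjoint_op L y \<in> A x"
    proof (rule maximally_monotoneD(2)[OF A], rule ccontr)
      fix c \<phi> assume c: "\<phi> \<in> A c" "\<not> 0 \<le> blinfun_apply (- adjoint_op L y - \<phi>) (x - c)"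
      then have "0 < - blinfun_apply (- adjoint_op L y - \<phi>) (x - c)" by simp
      from maximally_monotone_gap[OF B this, of y "blinfun_apply L x"] obtain d \<psi> where "\<psi> \<in> B d"
        "blinfun_apply (y - \<psi>) (blinfun_apply L x - d) < - blinfun_apply (- adjoint_op L y - \<phi>) (x - c)"
        by blast
      then show False using H c(1) unfolding mem by fastforce
    qed
    moreover have "y \<in> B (blinfun_apply L x)"
    proof (rule maximally_monotoneD(2)[OF B], rule ccontr)
      fix d \<psi> assume d: "\<psi> \<in> B d" "\<not> 0 \<le> blinfun_apply (y - \<psi>) (blinfun_apply L x - d)"
      then have "0 < - blinfun_apply (y - \<psi>) (blinfun_apply L x - d)" by simp
      from maximally_monotone_gap[OF A this, of "- adjoint_op L y" x] obtain c \<phi> where "\<phi> \<in> A c"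
        "blinfun_apply (- adjoint_op L y - \<phi>) (x - c) < - blinfun_apply (y - \<psi>) (blinfun_apply L x - d)"
        by blast
      then show False using H d(1) unfolding mem by fastforce
    qed
    ultimately show "(x, y) \<in> kuhn_tucker_set A B L"
      by (simp add: kuhn_tucker_set_def op_inverse_def)
  qed
  then show ?thesis by auto
qed

lemma closed_kuhn_tucker_set:
  assumes "maximally_monotone A" "maximally_monotone B"
  shows "closed (kuhn_tucker_set A B L)"
  unfolding kuhn_tucker_set_eq[OF assms] Ball_def
  by (intro closed_Collect_all closed_Collect_imp) (auto simp: closed_kt_halfspace)

lemma convex_kuhn_tucker_set:
  assumes "maximally_monotone A" "maximally_monotone B"
  shows "convex (kuhn_tucker_set A B L)"
proof -
  have "kuhn_tucker_set A B L = (\<Inter>(a, a')\<in>{(a, a'). a' \<in> A a}. \<Inter>(b, b')\<in>{(b, b'). b' \<in> B b}. kt_halfspace L a a' b b')"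
    unfolding kuhn_tucker_set_eq[OF assms] by auto
  then show ?thesis by (auto intro!: convex_INT simp: convex_kt_halfspace)
qed

section \<open>Haugazeau's scheme with Bregman projections\<close>

text \<open>Isolates the projection scheme from the operators: \<open>H\<close> enters only through
  closed convex sets that contain \<open>Z\<close>.\<close>

locale haugazeau =
  fixes F :: "'a::banach \<Rightarrow> ereal" and Z :: "'a set" and H :: "nat \<Rightarrow> 'a set" and w wh :: "nat \<Rightarrow> 'a"
  assumes refl: "reflexive_space TYPE('a)" and F: "bregman_fun F"
    and Z: "closed Z" "convex Z" "Z \<inter> interior (edom F) \<noteq> {}"
    and H: "\<And>n. closed (H n)" "\<And>n. convex (H n)"
    and w0: "w 0 \<in> interior (edom F)"
    and ZH: "\<And>n. w n \<in> interior (edom F) \<Longrightarrow> Z \<subseteq> H n"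
    and wh: "\<And>n. wh n = bregman_proj F (H n) (w n)"
    and w_Suc: "\<And>n. w (Suc n) = bregman_Q F (w 0) (w n) (wh n)"
begin

abbreviation "I \<equiv> interior (edom F)"
abbreviation "D \<equiv> rbregman F"
abbreviation "HS \<equiv> bregman_halfspace F"

definition "zbar = bregman_proj F Z (w 0)"

lemma IE: "u \<in> I \<Longrightarrow> u \<in> edom F"
  using interior_subset by blast

lemma zbar: "zbar \<in> Z" "zbar \<in> I" "Z \<subseteq> HS (w 0) zbar"
  unfolding zbar_def using bregman_proj[OF refl F Z w0] by auto

lemma wh_if:
  assumes "w n \<in> I"
  shows "wh n \<in> H n" "wh n \<in> I" "H n \<subseteq> HS (w n) (wh n)"
proof -
  have "H n \<inter> I \<noteq> {}" using ZH[OF assms] Z(3) by blast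
  from bregman_proj[OF refl F H this assms]
  show "wh n \<in> H n" "wh n \<in> I" "H n \<subseteq> HS (w n) (wh n)" by (auto simp: wh)
qed

lemma w_Suc_if:
  assumes "w n \<in> I" "Z \<subseteq> HS (w 0) (w n)"
  shows "w (Suc n) \<in> HS (w 0) (w n) \<inter> HS (w n) (wh n)" "w (Suc n) \<in> I"
    "HS (w 0) (w n) \<inter> HS (w n) (wh n) \<subseteq> HS (w 0) (w (Suc n))"
proof -
  let ?C = "HS (w 0) (w n) \<inter> HS (w n) (wh n)"
  have "closed ?C" "convex ?C"
    by (intro closed_Int convex_Int closed_bregman_halfspace convex_bregman_halfspace)+
  moreover have "?C \<inter> I \<noteq> {}" using assms ZH[OF assms(1)] wh_if(3)[OF assms(1)] Z(3) by blast
  ultimately have "w (Suc n) \<in> ?C" "w (Suc n) \<in> I" "?C \<subseteq> HS (w 0) (w (Suc n))"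
    unfolding w_Suc bregman_Q_def using bregman_proj[OF refl F _ _ _ w0] by blast+
  then show "w (Suc n) \<in> HS (w 0) (w n) \<inter> HS (w n) (wh n)" "w (Suc n) \<in> I"
    "HS (w 0) (w n) \<inter> HS (w n) (wh n) \<subseteq> HS (w 0) (w (Suc n))" by auto
qed

text \<open>Proved together: the next projection exists because both half-spaces contain
  \<open>Z\<close>, which meets the interior, and their intersection lies in the half-space of the
  new iterate. At the start the half-space is the whole space.\<close>

lemma w_I: "w n \<in> I" and Z_HS: "Z \<subseteq> HS (w 0) (w n)"
proof -
  have "w n \<in> I \<and> Z \<subseteq> HS (w 0) (w n)"
  proof (induction n)
    case 0
    then show ?case using w0 by simp
  next
    case (Suc n)
    then show ?case using w_Suc_if[of n] wh_if(3)[of n] ZH[of n] by blast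
  qed
  then show "w n \<in> I" "Z \<subseteq> HS (w 0) (w n)" by auto
qed

lemma wh_n: "wh n \<in> H n" "wh n \<in> I" "H n \<subseteq> HS (w n) (wh n)"
  using wh_if[OF w_I] by auto

lemma w_Suc_n:
  "w (Suc n) \<in> HS (w 0) (w n)" "w (Suc n) \<in> HS (w n) (wh n)"
  using w_Suc_if(1)[OF w_I Z_HS] by auto

text \<open>The invariant \<open>Z_HS\<close> is the projection criterion itself; only membership in
  \<open>Z\<close> is missing.\<close>

lemma eq_zbar_iff: "w n = zbar \<longleftrightarrow> w n \<in> Z"
proof
  assume "w n \<in> Z"
  then have "bregman_proj F Z (w 0) = w n" using Z_HS w_I by (intro bregman_proj_eqI F w0)
  then show "w n = zbar" by (simp add: zbar_def)
qed (use zbar in simp)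

lemma wh_eq_iff: "wh n = w n \<longleftrightarrow> w n \<in> H n"
proof
  assume "w n \<in> H n"
  then show "wh n = w n"
    using mem_bregman_halfspace_imp_eq[OF F w_I[of n] wh_n(2)[of n]] wh_n(3)[of n] by auto
qed (use wh_n(1)[of n] in simp)

lemma w_Suc_eq_iff: "w (Suc n) = w n \<longleftrightarrow> wh n = w n"
proof
  assume "w (Suc n) = w n"
  then have "w n \<in> HS (w n) (wh n)" using w_Suc_n(2)[of n] by simp
  then show "wh n = w n" using mem_bregman_halfspace_imp_eq[OF F w_I[of n] wh_n(2)[of n]] by simp
next
  assume "wh n = w n"
  then have "w (Suc n) = bregman_proj F (HS (w 0) (w n)) (w 0)"
    by (simp add: w_Suc bregman_Q_def)
  also have "\<dots> = w n" by (rule bregman_proj_eqI[OF F w0]) (auto simp: w_I)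
  finally show "w (Suc n) = w n" .
qed

lemma D_nonneg: "u \<in> I \<Longrightarrow> v \<in> I \<Longrightarrow> 0 \<le> D u v"
  using rbregman_nonneg[OF F] IE by blast

lemma D_increment: "D (w (Suc n)) (w n) + D (w n) (w 0) \<le> D (w (Suc n)) (w 0)"
  by (rule bregman_halfspace_inequality[OF w_Suc_n(1)])

lemma D_zbar: "D zbar (w n) + D (w n) (w 0) \<le> D zbar (w 0)"
  using Z_HS zbar(1) by (intro bregman_halfspace_inequality) blast

lemma D_le: "D (w n) (w 0) \<le> D zbar (w 0)"
  using D_zbar[of n] D_nonneg[OF zbar(2) w_I[of n]] by linarith

lemma sum_D_Suc_le: "(\<Sum>i<n. D (w (Suc i)) (w i)) \<le> D zbar (w 0)"
proof -
  have "(\<Sum>i<n. D (w (Suc i)) (w i)) \<le> D (w n) (w 0)"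
  proof (induction n)
    case (Suc n)
    then show ?case using D_increment[of n] by simp
  qed simp
  then show ?thesis using D_le[of n] by linarith
qed

text \<open>The Pythagorean inequality in the second half-space; it reduces (iii) to (ii).\<close>

lemma D_half_le: "D (wh n) (w n) \<le> D (w (Suc n)) (w n)"
  using bregman_halfspace_inequality[OF w_Suc_n(2)] D_nonneg[OF w_I wh_n(2)] by (smt (verit))

lemma sum_D_half_le: "(\<Sum>i<n. D (wh i) (w i)) \<le> D zbar (w 0)"
  using sum_mono[of "{..<n}", OF D_half_le] sum_D_Suc_le[of n] by (rule order_trans)

lemma bounded_w: "bounded (range w)"
proof -
  obtain R where "\<forall>u\<in>edom F. D u (w 0) \<le> D zbar (w 0) \<longrightarrow> norm u \<le> R"
    using bounded_bregman_sublevel[OF F w0] by blast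
  then show ?thesis using D_le IE[OF w_I] by (auto simp: bounded_iff)
qed

lemma incseq_D: "incseq (\<lambda>n. D (w n) (w 0))"
  using D_increment D_nonneg[OF w_I w_I] by (intro incseq_SucI) (smt (verit))

text \<open>Since \<open>D (w n) (w 0)\<close> increases to at most \<open>D zbar (w 0)\<close>, a cluster point in \<open>Z\<close> forces the
  limit to be \<open>D zbar (w 0)\<close>, by weak lower semicontinuity and the minimality of \<open>zbar\<close>.\<close>

theorem D_zbar_tendsto_0:
  assumes l: "\<And>(\<phi> :: 'a dual) c. \<forall>\<^sub>F n in sequentially. blinfun_apply \<phi> (w n) \<le> c \<Longrightarrow> blinfun_apply \<phi> l \<le> c"
    and lZ: "l \<in> Z"
  shows "(\<lambda>n. D zbar (w n)) \<longlonglongrightarrow> 0"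
proof -
  note c = bregman_funD(1)[OF F]
  obtain s where s: "(\<lambda>n. D (w n) (w 0)) \<longlonglongrightarrow> s" "\<And>n. D (w n) (w 0) \<le> s"
    using incseq_convergent[OF incseq_D, of "D zbar (w 0)"] D_le by blast
  obtain b where b: "F (w 0) = ereal b" using closed_convex_fun_finite[OF c IE[OF w0]] by blast
  let ?p = "gradient F (w 0)"
  have D_eq: "D u (w 0) = a - b - blinfun_apply ?p u + blinfun_apply ?p (w 0)" if "F u = ereal a" for u a
    using that b by (simp add: rbregman_def blinfun.diff_right)
  have "F (w n) \<le> ereal (blinfun_apply ?p (w n) + (s + b - blinfun_apply ?p (w 0)))" for n
  proof -
    obtain a where a: "F (w n) = ereal a" using closed_convex_fun_finite[OF c IE[OF w_I]] by blast
    then show ?thesis using s(2)[of n] D_eq[OF a] by simp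
  qed
  from weak_cluster_point_lsc[OF c l this]
  have Fl: "F l \<le> ereal (blinfun_apply ?p l + (s + b - blinfun_apply ?p (w 0)))" .
  \<comment> \<open>The cluster point may lie on the boundary of the domain, but the distances used
    have interior points as second argument.\<close>
  then have le: "l \<in> edom F" by (auto simp: edom_def intro: le_less_trans)
  obtain a where a: "F l = ereal a" using closed_convex_fun_finite[OF c le] by blast
  have "D l (w 0) \<le> s" using Fl D_eq[OF a] a by simp
  moreover have "D l zbar + D zbar (w 0) \<le> D l (w 0)"
    using zbar(3) lZ by (intro bregman_halfspace_inequality) blast
  ultimately have "D zbar (w 0) \<le> s"
    using rbregman_nonneg[OF F le zbar(2)] by linarith
  then have "D zbar (w n) \<le> s - D (w n) (w 0)" for n
    using D_zbar[of n] by linarith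
  then have upper: "\<forall>\<^sub>F n in sequentially. D zbar (w n) \<le> s - D (w n) (w 0)"
    by simp
  have lower: "\<forall>\<^sub>F n in sequentially. 0 \<le> D zbar (w n)"
    using D_nonneg[OF zbar(2) w_I] by simp
  have "(\<lambda>n. s - D (w n) (w 0)) \<longlonglongrightarrow> s - s" by (intro tendsto_intros s)
  then have "(\<lambda>n. s - D (w n) (w 0)) \<longlonglongrightarrow> 0" by simp
  from tendsto_sandwich[OF lower upper tendsto_const this] show ?thesis .
qed

end

section \<open>Sequences of gradients and resolvents\<close>

text \<open>Convexity allows the segment from \<open>s0\<close> to be walked in \<open>N\<close>
  steps shorter than \<open>d\<close>, each changing \<open>g\<close> by less than \<open>1\<close>;
  \<open>N\<close> depends only on \<open>K\<close> and \<open>d\<close>.\<close>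

lemma bounded_uniformly_continuous_convex_image:
  fixes g :: "'a::real_normed_vector \<Rightarrow> 'b::real_normed_vector"
  assumes g: "uniformly_continuous_on S g" and S: "convex S" "bounded S"
  shows "bounded (g ` S)"
proof (cases "S = {}")
  case False
  then obtain s0 where s0: "s0 \<in> S" by blast
  obtain d where d: "0 < d" "\<And>x y. x \<in> S \<Longrightarrow> y \<in> S \<Longrightarrow> dist y x < d \<Longrightarrow> dist (g y) (g x) < 1"
    using g unfolding uniformly_continuous_on_def by (metis zero_less_one)
  obtain K where K: "\<And>x. x \<in> S \<Longrightarrow> norm (x - s0) \<le> K"
    using S(2) bounded_any_center[of S s0] by (auto simp: dist_norm norm_minus_commute)
  obtain N :: nat where N: "K / d < N" using reals_Archimedean2 by blast
  have "0 \<le> K" using K[OF s0] by simp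
  then have N0: "0 < N" using N d(1) by (cases N) (auto simp: divide_less_0_iff)
  have "dist (g x) (g s0) \<le> N" if x: "x \<in> S" for x
  proof -
    define q where "q i = s0 + (real i / N) *\<^sub>R (x - s0)" for i
    have qS: "q i \<in> S" if "i \<le> N" for i
    proof -
      have "q i = (1 - real i / N) *\<^sub>R s0 + (real i / N) *\<^sub>R x"
        by (simp add: q_def algebra_simps)
      then show ?thesis using S(1) s0 x that N0 by (simp add: convex_alt)
    qed
    have "dist (g (q i)) (g s0) \<le> i" if "i \<le> N" for i
      using that
    proof (induction i)
      case (Suc i)
      have "q (Suc i) - q i = (1 / N) *\<^sub>R (x - s0)"
        by (simp add: q_def add_divide_distrib algebra_simps)
      then have "dist (q (Suc i)) (q i) = norm (x - s0) / N" by (simp add: dist_norm)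
      also have "\<dots> < d" using K[OF x] N N0 d(1) by (simp add: field_simps)
      finally have "dist (g (q (Suc i))) (g (q i)) < 1" using Suc.prems by (intro d(2) qS) auto
      then show ?case
        using Suc dist_triangle[of "g (q (Suc i))" "g s0" "g (q i)"] by simp
    qed (simp add: q_def)
    from this[of N] show ?thesis using N0 by (simp add: q_def)
  qed
  then have "\<forall>y\<in>g ` S. dist (g s0) y \<le> N" by (auto simp: dist_commute)
  then show ?thesis unfolding bounded_def by blast
qed simp

text \<open>The range of a sequence need not be convex, so it is enlarged to the part of the
  interior within a ball.\<close>

lemma bounded_gradient_sequence:
  fixes h :: "'a::banach \<Rightarrow> ereal" and u :: "nat \<Rightarrow> 'a"
  assumes h: "bregman_fun h"
    and uc: "\<And>S. bounded S \<Longrightarrow> S \<subseteq> interior (edom h) \<Longrightarrow> uniformly_continuous_on S (gradient h)"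
    and u: "bounded (range u)" "range u \<subseteq> interior (edom h)"
  shows "bounded (range (\<lambda>n. gradient h (u n)))"
proof -
  obtain R where "\<And>n. norm (u n) \<le> R" using u(1) by (auto simp: bounded_iff)
  then have R: "range u \<subseteq> cball 0 R" by auto
  let ?S = "interior (edom h) \<inter> cball 0 R"
  have "convex ?S" "bounded ?S"
    using convex_interior[OF convex_edom[OF bregman_funD(1)[OF h]]]
    by (auto intro: convex_Int bounded_subset[OF bounded_cball])
  then have "bounded (gradient h ` ?S)"
    by (intro bounded_uniformly_continuous_convex_image uc) auto
  then show ?thesis by (rule bounded_subset) (use R u(2) in auto)
qed

lemma gradient_differences_tendsto_0:
  fixes h :: "'a::banach \<Rightarrow> ereal" and u v :: "nat \<Rightarrow> 'a"
  assumes uc: "\<And>S. bounded S \<Longrightarrow> S \<subseteq> interior (edom h) \<Longrightarrow> uniformly_continuous_on S (gradient h)"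
    and u: "bounded (range u)" "range u \<subseteq> interior (edom h)"
    and v: "bounded (range v)" "range v \<subseteq> interior (edom h)"
    and lim: "(\<lambda>n. u n - v n) \<longlonglongrightarrow> 0"
  shows "(\<lambda>n. gradient h (u n) - gradient h (v n)) \<longlonglongrightarrow> 0"
proof -
  have "uniformly_continuous_on (range u \<union> range v) (gradient h)"
    using u v by (intro uc) auto
  then have "(\<lambda>n. dist (gradient h (u n)) (gradient h (v n))) \<longlonglongrightarrow> 0"
    using lim unfolding uniformly_continuous_on_sequentially
    by (auto simp: dist_norm tendsto_norm_zero_iff)
  then show ?thesis by (simp add: dist_norm tendsto_norm_zero_iff)
qed

lemma blinfun_apply_tendsto_0:
  fixes p :: "nat \<Rightarrow> 'a::real_normed_vector dual" and v :: "nat \<Rightarrow> 'a"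
  shows "bounded (range p) \<Longrightarrow> v \<longlonglongrightarrow> 0 \<Longrightarrow> (\<lambda>n. blinfun_apply (p n) (v n)) \<longlonglongrightarrow> 0"
    and "p \<longlonglongrightarrow> 0 \<Longrightarrow> bounded (range v) \<Longrightarrow> (\<lambda>n. blinfun_apply (p n) (v n)) \<longlonglongrightarrow> 0"
proof -
  assume "bounded (range p)" and v: "v \<longlonglongrightarrow> 0"
  then obtain K where K: "\<And>n. norm (p n) \<le> K" by (auto simp: bounded_iff)
  have "norm (blinfun_apply (p n) (v n)) \<le> K * norm (v n)" for n
    using norm_blinfun[of "p n" "v n"] mult_right_mono[OF K[of n] norm_ge_zero[of "v n"]] by linarith
  moreover have "(\<lambda>n. K * norm (v n)) \<longlonglongrightarrow> 0"
    using tendsto_mult_right_zero[OF tendsto_norm_zero[OF v]] by simp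
  ultimately show "(\<lambda>n. blinfun_apply (p n) (v n)) \<longlonglongrightarrow> 0"
    by (rule Lim_null_comparison[OF always_eventually[OF allI]])
next
  assume p: "p \<longlonglongrightarrow> 0" and "bounded (range v)"
  then obtain K where K: "\<And>n. norm (v n) \<le> K" by (auto simp: bounded_iff)
  have "norm (blinfun_apply (p n) (v n)) \<le> norm (p n) * K" for n
    using norm_blinfun[of "p n" "v n"] mult_left_mono[OF K[of n] norm_ge_zero[of "p n"]] by linarith
  moreover have "(\<lambda>n. norm (p n) * K) \<longlonglongrightarrow> 0"
    using tendsto_mult_left_zero[OF tendsto_norm_zero[OF p]] by simp
  ultimately show "(\<lambda>n. blinfun_apply (p n) (v n)) \<longlonglongrightarrow> 0"
    by (rule Lim_null_comparison[OF always_eventually[OF allI]])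
qed

text \<open>Stated with a free \<open>q\<close>: the first resolvent takes
  \<open>q = adjoint_op L (y n)\<close>, the second \<open>q = - y n\<close>.\<close>

lemma resolvent_step:
  fixes A :: "'a::banach \<Rightarrow> 'a dual set"
  assumes refl: "reflexive_space TYPE('a)" and A: "maximally_monotone A" and h: "bregman_fun h"
    and \<epsilon>: "0 < \<epsilon>" and coercive: "coercive_op (gradient_plus h \<epsilon> A)" and \<gamma>: "\<epsilon> \<le> \<gamma>"
    and a: "a = gradient_plus_inv h \<gamma> A (u - \<gamma> *\<^sub>R q)"
  shows "a \<in> interior (edom h)" "inverse \<gamma> *\<^sub>R (u - gradient h a) - q \<in> A a"
proof -
  obtain \<phi> where \<phi>: "a \<in> interior (edom h)" "\<phi> \<in> A a" "u - \<gamma> *\<^sub>R q = gradient h a + \<gamma> *\<^sub>R \<phi>"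
    using gradient_plus_inv[OF assms(1-6), of "u - \<gamma> *\<^sub>R q"]
    by (auto simp: a[symmetric] gradient_plus_def split: if_splits)
  have "u - gradient h a = \<gamma> *\<^sub>R (\<phi> + q)"
    using \<phi>(3) by (simp add: algebra_simps)
  then have "inverse \<gamma> *\<^sub>R (u - gradient h a) - q = \<phi>" using \<epsilon> \<gamma> by simp
  with \<phi> show "a \<in> interior (edom h)" "inverse \<gamma> *\<^sub>R (u - gradient h a) - q \<in> A a" by auto
qed

text \<open>The resolvent equation equates
  \<open>gradient h (a n) + \<gamma> n *\<^sub>R a' n\<close> with a bounded sequence, and the
  coercivity estimate has one radius for all \<open>\<gamma> n\<close>. Boundedness of
  \<open>a'\<close> then follows from that of the gradients because \<open>\<gamma> n\<close> stays
  above \<open>\<epsilon>\<close>.\<close>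

lemma resolvent_sequence_bounded:
  fixes A :: "'a::banach \<Rightarrow> 'a dual set" and u a :: "nat \<Rightarrow> 'a" and q a' :: "nat \<Rightarrow> 'a dual"
  assumes A: "monotone_op A" and h: "bregman_fun h"
    and \<epsilon>: "0 < \<epsilon>" and coercive: "coercive_op (gradient_plus h \<epsilon> A)" and \<gamma>: "\<And>n. \<gamma> n \<in> {\<epsilon>..\<sigma>}"
    and uc: "\<And>S. bounded S \<Longrightarrow> S \<subseteq> interior (edom h) \<Longrightarrow> uniformly_continuous_on S (gradient h)"
    and u: "range u \<subseteq> interior (edom h)" "bounded (range u)" and q: "bounded (range q)"
    and a: "range a \<subseteq> interior (edom h)"
    and a': "\<And>n. a' n = inverse (\<gamma> n) *\<^sub>R (gradient h (u n) - gradient h (a n)) - q n" "\<And>n. a' n \<in> A (a n)"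
  shows "bounded (range a)" "bounded (range a')"
proof -
  have \<gamma>0: "0 < \<gamma> n" "\<gamma> n \<le> \<sigma>" "\<epsilon> \<le> \<gamma> n" for n using \<gamma>[of n] \<epsilon> by auto
  have "bounded (range (\<lambda>n. gradient h (u n)))"
    by (rule bounded_gradient_sequence[OF h uc u(2,1)])
  then obtain K where K: "\<And>n. norm (gradient h (u n)) \<le> K" by (auto simp: bounded_iff)
  obtain K' where K': "\<And>n. norm (q n) \<le> K'" using q by (auto simp: bounded_iff)
  have eq: "gradient h (a n) + \<gamma> n *\<^sub>R a' n = gradient h (u n) - \<gamma> n *\<^sub>R q n" for n
    using \<gamma>0[of n] by (simp add: a'(1) algebra_simps)
  have nle: "norm (gradient h (u n) - \<gamma> n *\<^sub>R q n) \<le> K + \<sigma> * K'" for n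
  proof -
    have "norm (\<gamma> n *\<^sub>R q n) \<le> \<sigma> * K'"
      using \<gamma>0[of n] K'[of n] by (auto intro!: mult_mono)
    then show ?thesis using norm_triangle_ineq4[of "gradient h (u n)" "\<gamma> n *\<^sub>R q n"] K[of n] by linarith
  qed
  obtain z where
    est: "\<And>U \<sigma>. \<exists>R. \<forall>\<gamma>\<in>{\<epsilon>..\<sigma>}. \<forall>a\<in>interior (edom h). \<forall>\<phi>\<in>A a.
      blinfun_apply (gradient h a + \<gamma> *\<^sub>R \<phi>) (a - z) \<le> U * norm (a - z) \<longrightarrow> norm a < R"
    by (rule coercive_gradient_plus_estimate[OF A coercive]) blast
  obtain R where R: "\<And>\<gamma> a \<phi>. \<gamma> \<in> {\<epsilon>..\<sigma>} \<Longrightarrow> a \<in> interior (edom h) \<Longrightarrow> \<phi> \<in> A a \<Longrightarrow>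
      blinfun_apply (gradient h a + \<gamma> *\<^sub>R \<phi>) (a - z) \<le> (K + \<sigma> * K') * norm (a - z) \<Longrightarrow> norm a < R"
    using est[where U="K + \<sigma> * K'" and \<sigma>=\<sigma>] by metis
  have "norm (a n) < R" for n
  proof (rule R[OF \<gamma>[of n] _ a'(2)])
    show "a n \<in> interior (edom h)" using a by auto
    have "blinfun_apply (gradient h (u n) - \<gamma> n *\<^sub>R q n) (a n - z)
        \<le> norm (gradient h (u n) - \<gamma> n *\<^sub>R q n) * norm (a n - z)"
      using norm_blinfun[of "gradient h (u n) - \<gamma> n *\<^sub>R q n" "a n - z"] by (simp add: abs_le_iff)
    also have "\<dots> \<le> (K + \<sigma> * K') * norm (a n - z)" using nle by (intro mult_right_mono) auto
    finally show "blinfun_apply (gradient h (a n) + \<gamma> n *\<^sub>R a' n) (a n - z) \<le> (K + \<sigma> * K') * norm (a n - z)"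
      unfolding eq .
  qed
  then show ba: "bounded (range a)" by (auto simp: bounded_iff intro: less_imp_le)
  have "bounded (range (\<lambda>n. gradient h (a n)))"
    by (rule bounded_gradient_sequence[OF h uc ba a])
  then obtain K'' where K'': "\<And>n. norm (gradient h (a n)) \<le> K''" by (auto simp: bounded_iff)
  have "norm (a' n) \<le> inverse \<epsilon> * (K + K'') + K'" for n
  proof -
    have "norm (gradient h (u n) - gradient h (a n)) \<le> K + K''"
      using norm_triangle_ineq4[of "gradient h (u n)" "gradient h (a n)"] K[of n] K''[of n] by linarith
    then have "inverse (\<gamma> n) * norm (gradient h (u n) - gradient h (a n)) \<le> inverse \<epsilon> * (K + K'')"
      using \<gamma>0[of n] \<epsilon> by (intro mult_mono le_imp_inverse_le) auto
    then show ?thesis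
      using norm_triangle_ineq4[of "inverse (\<gamma> n) *\<^sub>R (gradient h (u n) - gradient h (a n))" "q n"] K'[of n] \<gamma>0(1)[of n]
      by (simp add: a'(1))
  qed
  then show "bounded (range a')" by (auto simp: bounded_iff)
qed

text \<open>The product in \<open>gap\<close> is the symmetrized Bregman distance of
  \<open>u n\<close> and \<open>a n\<close>, so it dominates the one-sided distance to which
  \<open>controls\<close> applies.\<close>

lemma resolvent_sequence_tendsto:
  fixes h :: "'a::banach \<Rightarrow> ereal" and u a :: "nat \<Rightarrow> 'a"
  assumes h: "bregman_fun h" and controls: "bregman_dist_controls h"
    and \<epsilon>: "0 < \<epsilon>" and \<gamma>: "\<And>n. \<gamma> n \<in> {\<epsilon>..\<sigma>}"
    and uc: "\<And>S. bounded S \<Longrightarrow> S \<subseteq> interior (edom h) \<Longrightarrow> uniformly_continuous_on S (gradient h)"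
    and u: "range u \<subseteq> interior (edom h)" "bounded (range u)"
    and a: "range a \<subseteq> interior (edom h)" "bounded (range a)"
    and gap: "\<And>n. inverse (\<gamma> n) * blinfun_apply (gradient h (u n) - gradient h (a n)) (u n - a n) \<le> g n"
    and g: "g \<longlonglongrightarrow> 0"
  shows "(\<lambda>n. u n - a n) \<longlonglongrightarrow> 0"
    "(\<lambda>n. inverse (\<gamma> n) *\<^sub>R (gradient h (u n) - gradient h (a n))) \<longlonglongrightarrow> 0"
proof -
  have \<gamma>0: "0 < \<gamma> n" "\<gamma> n \<le> \<sigma>" "\<epsilon> \<le> \<gamma> n" for n using \<gamma>[of n] \<epsilon> by auto
  have uI: "u n \<in> interior (edom h)" and aI: "a n \<in> interior (edom h)" for n using u(1) a(1) by auto
  then have ue: "u n \<in> edom h" and ae: "a n \<in> edom h" for n using interior_subset by blast+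
  have le: "rbregman h (a n) (u n) \<le> \<sigma> * g n" for n
  proof -
    let ?G = "blinfun_apply (gradient h (u n) - gradient h (a n)) (u n - a n)"
    have "rbregman h (a n) (u n) + rbregman h (u n) (a n) = ?G"
      using three_point_identity[of h "u n" "u n" "a n"] by (simp add: rbregman_def blinfun.diff_left blinfun.diff_right)
    then have 1: "rbregman h (a n) (u n) \<le> ?G"
      using rbregman_nonneg[OF h ue aI, of n n] by linarith
    have "?G = \<gamma> n * (inverse (\<gamma> n) * ?G)" using \<gamma>0(1)[of n] by simp
    also have "\<dots> \<le> \<gamma> n * g n" using gap[of n] \<gamma>0(1)[of n] by (intro mult_left_mono) auto
    \<comment> \<open>Replacing \<open>\<gamma> n\<close> by its upper bound requires
      \<open>0 \<le> g n\<close>, which the nonnegative left side of \<open>gap\<close>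
      provides.\<close>
    also have "\<dots> \<le> \<sigma> * g n"
    proof (rule mult_right_mono)
      have "0 \<le> ?G" using 1 rbregman_nonneg[OF h ae uI, of n n] by linarith
      then have "0 \<le> inverse (\<gamma> n) * ?G" using \<gamma>0(1)[of n] by (intro mult_nonneg_nonneg) auto
      then show "0 \<le> g n" using gap[of n] by linarith
    qed (rule \<gamma>0)
    finally show ?thesis using 1 by linarith
  qed
  have lim: "(\<lambda>n. \<sigma> * g n) \<longlonglongrightarrow> 0" using tendsto_mult_right_zero[OF g] .
  have lower: "\<forall>\<^sub>F n in sequentially. 0 \<le> rbregman h (a n) (u n)"
    using rbregman_nonneg[OF h ae uI] by simp
  have upper: "\<forall>\<^sub>F n in sequentially. rbregman h (a n) (u n) \<le> \<sigma> * g n"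
    using le by simp
  have "(\<lambda>n. rbregman h (a n) (u n)) \<longlonglongrightarrow> 0"
    by (rule tendsto_sandwich[OF lower upper tendsto_const lim])
  then have "(\<lambda>n. ereal (rbregman h (a n) (u n))) \<longlonglongrightarrow> 0"
    unfolding zero_ereal_def by (rule tendsto_ereal)
  then have "(\<lambda>n. bregman_dist h (a n) (u n)) \<longlonglongrightarrow> 0"
    using bregman_dist_eq_rbregman[OF bregman_funD(1)[OF h] ae uI] by simp
  then have "(\<lambda>n. a n - u n) \<longlonglongrightarrow> 0"
    using controls[unfolded bregman_dist_controls_def, rule_format, of a u] u a by simp
  then show ua: "(\<lambda>n. u n - a n) \<longlonglongrightarrow> 0"
    using tendsto_minus by fastforce
  have lim: "(\<lambda>n. gradient h (u n) - gradient h (a n)) \<longlonglongrightarrow> 0"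
    by (rule gradient_differences_tendsto_0[OF uc u(2,1) a(2,1) ua])
  have "norm (inverse (\<gamma> n) *\<^sub>R (gradient h (u n) - gradient h (a n)))
      \<le> inverse \<epsilon> * norm (gradient h (u n) - gradient h (a n))" for n
    using \<gamma>0[of n] \<epsilon> by (auto intro!: mult_right_mono le_imp_inverse_le)
  moreover have "(\<lambda>n. inverse \<epsilon> * norm (gradient h (u n) - gradient h (a n))) \<longlonglongrightarrow> 0"
    using tendsto_mult_right_zero[OF tendsto_norm_zero[OF lim]] .
  ultimately show "(\<lambda>n. inverse (\<gamma> n) *\<^sub>R (gradient h (u n) - gradient h (a n))) \<longlonglongrightarrow> 0"
    by (rule Lim_null_comparison[OF always_eventually[OF allI]])
qed

lemma rbregman_sep_sum:
  fixes f :: "'a::banach \<Rightarrow> ereal" and k :: "'b::banach \<Rightarrow> ereal"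
  assumes f: "bregman_fun f" and k: "bregman_fun k"
    and "u \<in> edom f" "v \<in> edom k" and uv': "u' \<in> interior (edom f)" "v' \<in> interior (edom k)"
  shows "rbregman (sep_sum f k) (u, v) (u', v') = rbregman f u u' + rbregman k v v'"
proof -
  have "u' \<in> edom f" "v' \<in> edom k" using uv' interior_subset by blast+
  then obtain p q p' q' where "f u = ereal p" "k v = ereal q" "f u' = ereal p'" "k v' = ereal q'"
    using closed_convex_fun_finite[OF bregman_funD(1)[OF f]] closed_convex_fun_finite[OF bregman_funD(1)[OF k]]
      assms(3,4) by metis
  then show ?thesis
    using gradient_sep_sum[OF f k uv'] by (simp add: rbregman_def)
qed

lemma suminf_ereal_finite:
  assumes "\<And>n. 0 \<le> r n" "\<And>n. (\<Sum>i<n. r i) \<le> C"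
  shows "(\<Sum>n. ereal (r n)) < \<infinity>"
  using suminf_ereal'[OF summableI_nonneg_bounded[OF assms]] by simp

theorem theorem3p2:
  fixes A :: "'a::banach \<Rightarrow> 'a dual set"
    and B :: "'b::banach \<Rightarrow> 'b dual set"
    and L :: "'a \<Rightarrow>\<^sub>L 'b"
    and f h :: "'a \<Rightarrow> ereal"
    and g j :: "'b \<Rightarrow> ereal"
    and F :: "'a \<times> 'b dual \<Rightarrow> ereal"
    and Z :: "('a \<times> 'b dual) set"
    and xbar :: 'a and ybar :: "'b dual"
    and \<epsilon> \<delta> \<sigma> :: real
    and \<gamma> \<mu> :: "nat \<Rightarrow> real"
    and x a xh :: "nat \<Rightarrow> 'a"
    and y b' yh :: "nat \<Rightarrow> 'b dual"
    and a' :: "nat \<Rightarrow> 'a dual"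
    and b :: "nat \<Rightarrow> 'b"
    and H :: "nat \<Rightarrow> ('a \<times> 'b dual) set"
  assumes refl_X: "reflexive_space TYPE('a)" and nontriv_X: "(UNIV :: 'a set) \<noteq> {0}"
    and refl_Y: "reflexive_space TYPE('b)" and nontriv_Y: "(UNIV :: 'b set) \<noteq> {0}"
    and A: "maximally_monotone A"
    and B: "maximally_monotone B"
    and Z: "Z = kuhn_tucker_set A B L"
    and f: "legendre f" and g: "legendre g"
    and F: "F = (\<lambda>(u, v'). f u + conjugate g v')"
    and x_0: "x 0 \<in> interior (edom f)"
    and y_0: "y 0 \<in> interior (edom (conjugate g))"
    and Z_int: "Z \<inter> interior (edom F) \<noteq> {}"
    and bar: "(xbar, ybar) = bregman_proj F Z (x 0, y 0)"
    and h: "legendre h" and j: "legendre j"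
    and dom_h: "interior (edom f) \<subseteq> interior (edom h)"
    and dom_j: "blinfun_apply L ` interior (edom f) \<subseteq> interior (edom j)"
    and \<epsilon>: "0 < \<epsilon>" and \<delta>: "0 < \<delta>"
    and coercive_h: "coercive_op (gradient_plus h \<epsilon> A)"
    and coercive_j: "coercive_op (gradient_plus j \<delta> B)"
    and \<sigma>: "max \<epsilon> \<delta> \<le> \<sigma>"
    and \<gamma>: "\<And>n. \<gamma> n \<in> {\<epsilon>..\<sigma>}"
    and \<mu>: "\<And>n. \<mu> n \<in> {\<delta>..\<sigma>}"
    and step_a: "\<And>n. a n =
      gradient_plus_inv h (\<gamma> n) A (gradient h (x n) - \<gamma> n *\<^sub>R adjoint_op L (y n))"
    and step_a': "\<And>n. a' n =
      inverse (\<gamma> n) *\<^sub>R (gradient h (x n) - gradient h (a n)) - adjoint_op L (y n)"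
    and step_b: "\<And>n. b n =
      gradient_plus_inv j (\<mu> n) B (gradient j (blinfun_apply L (x n)) + \<mu> n *\<^sub>R y n)"
    and step_b': "\<And>n. b' n =
      inverse (\<mu> n) *\<^sub>R (gradient j (blinfun_apply L (x n)) - gradient j (b n)) + y n"
    and step_H: "\<And>n. H n =
      {(u, v'). blinfun_apply (a' n + adjoint_op L (b' n)) u
                + blinfun_apply v' (b n - blinfun_apply L (a n))
              \<le> blinfun_apply (a' n) (a n) + blinfun_apply (b' n) (b n)}"
    and step_half: "\<And>n. (xh n, yh n) = bregman_proj F (H n) (x n, y n)"
    and step_Suc: "\<And>n. (x (Suc n), y (Suc n)) =
      bregman_Q F (x 0, y 0) (x n, y n) (xh n, yh n)"
  shows
    "(\<forall>n.
        ((x n, y n) = (xbar, ybar) \<longleftrightarrow> (x n, y n) \<in> Z) \<and>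
        ((x n, y n) \<in> Z \<longleftrightarrow> (x n, y n) \<in> H n) \<and>
        ((x n, y n) \<in> H n \<longleftrightarrow> x n = a n \<and> y n = b' n) \<and>
        (x n = a n \<and> y n = b' n \<longleftrightarrow>
          blinfun_apply L (a n) = b n \<and> a' n = - adjoint_op L (b' n)) \<and>
        (blinfun_apply L (a n) = b n \<and> a' n = - adjoint_op L (b' n) \<longleftrightarrow> H n = UNIV) \<and>
        (H n = UNIV \<longleftrightarrow> (xh n, yh n) = (x n, y n)) \<and>
        ((xh n, yh n) = (x n, y n) \<longleftrightarrow> (x (Suc n), y (Suc n)) = (x n, y n)))
     \<and> ((\<Sum>n. bregman_dist f (x (Suc n)) (x n)) < \<infinity> \<and>
        (\<Sum>n. bregman_dist (conjugate g) (y (Suc n)) (y n)) < \<infinity>)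
     \<and> ((\<Sum>n. bregman_dist f (xh n) (x n)) < \<infinity> \<and>
        (\<Sum>n. bregman_dist (conjugate g) (yh n) (y n)) < \<infinity>)
     \<and> (bregman_dist_controls f \<and> bregman_dist_controls (conjugate g) \<and>
        bregman_dist_controls h \<and> bregman_dist_controls j \<and>
        (\<forall>S. bounded S \<and> S \<subseteq> interior (edom h) \<longrightarrow> uniformly_continuous_on S (gradient h)) \<and>
        (\<forall>S. bounded S \<and> S \<subseteq> interior (edom j) \<longrightarrow> uniformly_continuous_on S (gradient j))
        \<longrightarrow> x \<longlonglongrightarrow> xbar \<and> y \<longlonglongrightarrow> ybar)"
proof -
  note fB = legendre_bregman_fun[OF refl_X f] and gB = legendre_conjugate_bregman_fun[OF refl_Y g]
    and hB = legendre_bregman_fun[OF refl_X h] and jB = legendre_bregman_fun[OF refl_Y j]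
  note Z_eq = Z and fc = bregman_funD(1)[OF fB] and gc = bregman_funD(1)[OF gB]
  have F_eq: "F = sep_sum f (conjugate g)" by (simp add: F sep_sum_def)
  have FB: "bregman_fun F" unfolding F_eq by (rule bregman_fun_sep_sum[OF fB gB])
  have "edom F = edom f \<times> edom (conjugate g)"
    unfolding F_eq by (intro edom_sep_sum closed_convex_funD(1) fc gc)
  then have intF: "interior (edom F) = interior (edom f) \<times> interior (edom (conjugate g))"
    by (simp add: interior_Times)
  define w wh where "w n = (x n, y n)" and "wh n = (xh n, yh n)" for n
  have resolvents: "a n \<in> interior (edom h)" "a' n \<in> A (a n)" "b n \<in> interior (edom j)" "b' n \<in> B (b n)" for n
  proof -
    have "\<epsilon> \<le> \<gamma> n" "\<delta> \<le> \<mu> n" using \<gamma>[of n] \<mu>[of n] by auto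
    then show "a n \<in> interior (edom h)" "a' n \<in> A (a n)"
      using resolvent_step[OF refl_X A hB \<epsilon> coercive_h _ step_a[of n]] by (auto simp: step_a')
    have b: "b n = gradient_plus_inv j (\<mu> n) B (gradient j (blinfun_apply L (x n)) - \<mu> n *\<^sub>R (- y n))"
      by (simp add: step_b)
    show "b n \<in> interior (edom j)" "b' n \<in> B (b n)"
      using resolvent_step[OF refl_Y B jB \<delta> coercive_j \<open>\<delta> \<le> \<mu> n\<close> b] by (auto simp: step_b')
  qed
  have H_eq: "H n = kt_halfspace L (a n) (a' n) (b n) (b' n)" for n
    by (auto simp: step_H kt_halfspace_def kt_functional_def)
  interpret haugazeau F Z H w wh
  proof
    show "reflexive_space TYPE('a \<times> 'b dual)" by (intro reflexive_prod reflexive_dual refl_X refl_Y)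
    show "closed Z" "convex Z"
      unfolding Z by (intro closed_kuhn_tucker_set convex_kuhn_tucker_set A B)+
    show "closed (H n)" "convex (H n)" for n
      unfolding H_eq by (rule closed_kt_halfspace convex_kt_halfspace)+
    show "w 0 \<in> interior (edom F)" using x_0 y_0 by (simp add: w_def intF)
    show "Z \<subseteq> H n" for n
      unfolding Z kuhn_tucker_set_eq[OF A B] H_eq using resolvents(2,4) by blast
    show "wh n = bregman_proj F (H n) (w n)" "w (Suc n) = bregman_Q F (w 0) (w n) (wh n)" for n
      using step_half step_Suc by (simp_all add: w_def wh_def)
  qed (rule FB Z_int)+
  have zbar_eq: "zbar = (xbar, ybar)" using bar by (simp add: zbar_def w_def)
  have xI: "x n \<in> interior (edom f)" and yI: "y n \<in> interior (edom (conjugate g))" for n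
    using w_I[of n] by (auto simp: w_def intF)
  have xhI: "xh n \<in> interior (edom f)" and yhI: "yh n \<in> interior (edom (conjugate g))" for n
    using wh_n(2)[of n] by (auto simp: wh_def intF)
  have xbarI: "xbar \<in> interior (edom f)" and ybarI: "ybar \<in> interior (edom (conjugate g))"
    using zbar(2) by (auto simp: zbar_eq intF)
  have xh': "x n \<in> interior (edom h)" and Lxj: "blinfun_apply L (x n) \<in> interior (edom j)" for n
    using xI dom_h dom_j by auto
  have \<gamma>0: "0 < \<gamma> n" and \<mu>0: "0 < \<mu> n" for n using \<gamma>[of n] \<mu>[of n] \<epsilon> \<delta> by auto

  \<comment> \<open>The violation at the iterates and the equivalences (i)\<close>
  define gh gj where "gh n = inverse (\<gamma> n) * blinfun_apply (gradient h (x n) - gradient h (a n)) (x n - a n)"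
    and "gj n = inverse (\<mu> n) * blinfun_apply (gradient j (blinfun_apply L (x n)) - gradient j (b n)) (blinfun_apply L (x n) - b n)"
    for n
  have gh: "0 \<le> gh n" "gh n = 0 \<Longrightarrow> x n = a n" for n
    using strictly_monotone_gradient[OF hB xh' resolvents(1), of n n] \<gamma>0[of n]
    by (cases "x n = a n"; simp add: gh_def)+
  have gj: "0 \<le> gj n" "gj n = 0 \<Longrightarrow> blinfun_apply L (x n) = b n" for n
    using strictly_monotone_gradient[OF jB Lxj resolvents(3), of n n] \<mu>0[of n]
    by (cases "blinfun_apply L (x n) = b n"; simp add: gj_def)+
  have a'_eq: "a' n + adjoint_op L (y n) = inverse (\<gamma> n) *\<^sub>R (gradient h (x n) - gradient h (a n))"
    and b'_eq: "b' n - y n = inverse (\<mu> n) *\<^sub>R (gradient j (blinfun_apply L (x n)) - gradient j (b n))" for n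
    by (simp_all add: step_a' step_b')
  let ?P = "\<lambda>n. kt_functional L (a n) (a' n) (b n) (b' n)"
  let ?r = "\<lambda>n. blinfun_apply (a' n) (a n) + blinfun_apply (b' n) (b n)"
  have gap: "blinfun_apply (?P n) (w n) - ?r n = gh n + gj n" for n
    unfolding w_def kt_functional_gap a'_eq b'_eq gh_def gj_def by (simp add: blinfun.scaleR_left)

  \<comment> \<open>In \<open>H n\<close> the violation is at most \<open>0\<close>, so its two
    nonnegative terms vanish one by one.\<close>
  have cd: "x n = a n \<and> y n = b' n" if "w n \<in> H n" for n
  proof -
    have "gh n + gj n \<le> 0" using that gap[of n] by (simp add: H_eq kt_halfspace_def)
    then have "gh n = 0" "gj n = 0" using gh(1)[of n] gj(1)[of n] by linarith+
    then have "x n = a n" "blinfun_apply L (x n) = b n" using gh(2)[of n] gj(2)[of n] by blast+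
    then show ?thesis using b'_eq[of n] by simp
  qed
  \<comment> \<open>The equation \<open>y n = b' n\<close> concerns \<open>b n\<close> only through
    gradients: it equates those of \<open>j\<close> at \<open>L (x n)\<close> and
    \<open>b n\<close>, and strict monotonicity equates the points.\<close>
  have de: "blinfun_apply L (a n) = b n \<and> a' n = - adjoint_op L (b' n)" if "x n = a n \<and> y n = b' n" for n
  proof -
    have "gradient j (blinfun_apply L (x n)) = gradient j (b n)"
      using b'_eq[of n] that \<mu>0[of n] by simp
    then have "blinfun_apply L (x n) = b n"
      using strictly_monotone_gradient[OF jB Lxj resolvents(3), of n n] by force
    moreover have "a' n + adjoint_op L (y n) = 0" using a'_eq[of n] that by simp
    ultimately show ?thesis using that by (simp add: eq_neg_iff_add_eq_0)
  qed
  have ef: "H n = UNIV" if "blinfun_apply L (a n) = b n \<and> a' n = - adjoint_op L (b' n)" for n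
  proof -
    have "?r n = 0" using that by (auto simp: blinfun.minus_left)
    moreover have "?P n = 0" using that by (auto simp: kt_functional_def intro!: blinfun_eqI)
    ultimately show ?thesis by (auto simp: H_eq kt_halfspace_def)
  qed
  have cb: "w n \<in> Z" if "w n \<in> H n" for n
  proof -
    have d: "x n = a n" "y n = b' n" using cd[OF that] by auto
    moreover have "blinfun_apply L (a n) = b n" "a' n = - adjoint_op L (b' n)" using de d by auto
    ultimately show ?thesis
      using resolvents(2,4)[of n] by (simp add: Z_eq kuhn_tucker_set_def op_inverse_def w_def)
  qed
  have bc: "w n \<in> H n" if "w n \<in> Z" for n using ZH[OF w_I] that by blast
  have part1: "((x n, y n) = (xbar, ybar) \<longleftrightarrow> (x n, y n) \<in> Z) \<and>
        ((x n, y n) \<in> Z \<longleftrightarrow> (x n, y n) \<in> H n) \<and>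
        ((x n, y n) \<in> H n \<longleftrightarrow> x n = a n \<and> y n = b' n) \<and>
        (x n = a n \<and> y n = b' n \<longleftrightarrow>
          blinfun_apply L (a n) = b n \<and> a' n = - adjoint_op L (b' n)) \<and>
        (blinfun_apply L (a n) = b n \<and> a' n = - adjoint_op L (b' n) \<longleftrightarrow> H n = UNIV) \<and>
        (H n = UNIV \<longleftrightarrow> (xh n, yh n) = (x n, y n)) \<and>
        ((xh n, yh n) = (x n, y n) \<longleftrightarrow> (x (Suc n), y (Suc n)) = (x n, y n))" for n
  proof -
    have ab: "w n = zbar \<longleftrightarrow> w n \<in> Z" by (rule eq_zbar_iff)
    have cg: "wh n = w n \<longleftrightarrow> w n \<in> H n" by (rule wh_eq_iff)
    have gh: "w (Suc n) = w n \<longleftrightarrow> wh n = w n" by (rule w_Suc_eq_iff)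
    \<comment> \<open>The step from (f) to (c) closes the cycle.\<close>
    have cf: "H n = UNIV \<Longrightarrow> w n \<in> H n" by simp
    show ?thesis
      using ab cg gh cf cd[of n] de[of n] ef[of n] cb[of n] bc[of n]
      unfolding w_def wh_def zbar_eq by blast
  qed

  \<comment> \<open>Summability of the distances, (ii) and (iii)\<close>
  note ief = subsetD[OF interior_subset[of "edom f"]]
    and ieg = subsetD[OF interior_subset[of "edom (conjugate g)"]]
  have split: "D (u, v) (u', v') = rbregman f u u' + rbregman (conjugate g) v v'"
    if "u \<in> interior (edom f)" "v \<in> interior (edom (conjugate g))"
      "u' \<in> interior (edom f)" "v' \<in> interior (edom (conjugate g))" for u v u' v'
    unfolding F_eq using that by (intro rbregman_sep_sum fB gB ief ieg)
  have nn_f: "0 \<le> rbregman f u u'" if "u \<in> interior (edom f)" "u' \<in> interior (edom f)" for u u'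
    using that by (intro rbregman_nonneg fB ief)
  have nn_g: "0 \<le> rbregman (conjugate g) v v'"
    if "v \<in> interior (edom (conjugate g))" "v' \<in> interior (edom (conjugate g))" for v v'
    using that by (intro rbregman_nonneg gB ieg)
  have bd_f: "bregman_dist f u u' = ereal (rbregman f u u')"
    if "u \<in> interior (edom f)" "u' \<in> interior (edom f)" for u u'
    using that by (intro bregman_dist_eq_rbregman fc ief)
  have bd_g: "bregman_dist (conjugate g) v v' = ereal (rbregman (conjugate g) v v')"
    if "v \<in> interior (edom (conjugate g))" "v' \<in> interior (edom (conjugate g))" for v v'
    using that by (intro bregman_dist_eq_rbregman gc ieg)
  \<comment> \<open>The distance for \<open>F\<close> is a sum of two nonnegative component
    distances, so its bound passes to each.\<close>
  have bounded_parts: "(\<Sum>i<n. rbregman f (u i) (x i)) \<le> C" "(\<Sum>i<n. rbregman (conjugate g) (v i) (y i)) \<le> C"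
    if u: "\<And>i. u i \<in> interior (edom f)" and v: "\<And>i. v i \<in> interior (edom (conjugate g))"
      and C: "(\<Sum>i<n. D (u i, v i) (w i)) \<le> C" for u v C n
  proof -
    have eq: "D (u i, v i) (w i) = rbregman f (u i) (x i) + rbregman (conjugate g) (v i) (y i)" for i
      unfolding w_def by (rule split[OF u v xI yI])
    have "(\<Sum>i<n. rbregman f (u i) (x i)) \<le> (\<Sum>i<n. D (u i, v i) (w i))"
      unfolding eq using nn_g[OF v yI] by (intro sum_mono) simp
    then show "(\<Sum>i<n. rbregman f (u i) (x i)) \<le> C" using C by linarith
    have "(\<Sum>i<n. rbregman (conjugate g) (v i) (y i)) \<le> (\<Sum>i<n. D (u i, v i) (w i))"
      unfolding eq using nn_f[OF u xI] by (intro sum_mono) simp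
    then show "(\<Sum>i<n. rbregman (conjugate g) (v i) (y i)) \<le> C" using C by linarith
  qed
  have sums: "(\<Sum>i<n. rbregman f (x (Suc i)) (x i)) \<le> D zbar (w 0)"
    "(\<Sum>i<n. rbregman (conjugate g) (y (Suc i)) (y i)) \<le> D zbar (w 0)"
    "(\<Sum>i<n. rbregman f (xh i) (x i)) \<le> D zbar (w 0)"
    "(\<Sum>i<n. rbregman (conjugate g) (yh i) (y i)) \<le> D zbar (w 0)" for n
    using bounded_parts[OF xI yI sum_D_Suc_le[of n, unfolded w_def[of "Suc _"]]]
      bounded_parts[OF xhI yhI sum_D_half_le[of n, unfolded wh_def]] by auto
  have part2: "(\<Sum>n. bregman_dist f (x (Suc n)) (x n)) < \<infinity>"
    "(\<Sum>n. bregman_dist (conjugate g) (y (Suc n)) (y n)) < \<infinity>"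
    unfolding bd_f[OF xI xI] bd_g[OF yI yI]
    by (rule suminf_ereal_finite[OF nn_f[OF xI xI] sums(1)] suminf_ereal_finite[OF nn_g[OF yI yI] sums(2)])+
  have part3: "(\<Sum>n. bregman_dist f (xh n) (x n)) < \<infinity>"
    "(\<Sum>n. bregman_dist (conjugate g) (yh n) (y n)) < \<infinity>"
    unfolding bd_f[OF xhI xI] bd_g[OF yhI yI]
    by (rule suminf_ereal_finite[OF nn_f[OF xhI xI] sums(3)] suminf_ereal_finite[OF nn_g[OF yhI yI] sums(4)])+

  \<comment> \<open>Strong convergence, (iv)\<close>
  have part4: "x \<longlonglongrightarrow> xbar \<and> y \<longlonglongrightarrow> ybar"
    if controls: "bregman_dist_controls f" "bregman_dist_controls (conjugate g)"
      "bregman_dist_controls h" "bregman_dist_controls j"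
    and uch: "\<And>S. bounded S \<Longrightarrow> S \<subseteq> interior (edom h) \<Longrightarrow> uniformly_continuous_on S (gradient h)"
    and ucj: "\<And>S. bounded S \<Longrightarrow> S \<subseteq> interior (edom j) \<Longrightarrow> uniformly_continuous_on S (gradient j)"
  proof -
    have control_f: "(\<lambda>n. u n - u' n) \<longlonglongrightarrow> 0"
      if "\<And>n. u n \<in> interior (edom f)" "\<And>n. u' n \<in> interior (edom f)" "bounded (range u')"
        "(\<lambda>n. rbregman f (u n) (u' n)) \<longlonglongrightarrow> 0" for u u'
      using that controls(1)[unfolded bregman_dist_controls_def, rule_format, of u u'] bd_f tendsto_ereal[OF that(4)]
      by (auto simp: zero_ereal_def)
    have control_g: "(\<lambda>n. v n - v' n) \<longlonglongrightarrow> 0"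
      if "\<And>n. v n \<in> interior (edom (conjugate g))" "\<And>n. v' n \<in> interior (edom (conjugate g))" "bounded (range v')"
        "(\<lambda>n. rbregman (conjugate g) (v n) (v' n)) \<longlonglongrightarrow> 0" for v v'
      using that controls(2)[unfolded bregman_dist_controls_def, rule_format, of v v'] bd_g tendsto_ereal[OF that(4)]
      by (auto simp: zero_ereal_def)
    obtain K where K: "\<And>n. norm (w n) \<le> K" using bounded_w by (auto simp: bounded_iff)
    have "norm (x n) \<le> K" "norm (y n) \<le> K" for n
      using K[of n] norm_fst_le[of "x n" "y n"] norm_snd_le[of "y n" "x n"] by (auto simp: w_def)
    then have bx: "bounded (range x)" and by': "bounded (range y)" by (auto simp: bounded_iff)
    have bLx: "bounded (range (\<lambda>n. blinfun_apply L (x n)))"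
      using bounded_linear_image[OF bx blinfun.bounded_linear_right[of L]] by (simp add: image_image)
    have bLy: "bounded (range (\<lambda>n. adjoint_op L (y n)))"
    proof -
      obtain K' where K': "\<And>n. norm (y n) \<le> K'" using by' by (auto simp: bounded_iff)
      have "norm (adjoint_op L (y n)) \<le> K' * norm L" for n
        using norm_adjoint_op[of L "y n"] mult_right_mono[OF K'[of n] norm_ge_zero[of L]] by linarith
      then show ?thesis by (auto simp: bounded_iff)
    qed
    have lim_xh: "(\<lambda>n. xh n - x n) \<longlonglongrightarrow> 0"
      by (rule control_f[OF xhI xI bx summable_LIMSEQ_zero[OF summableI_nonneg_bounded[OF nn_f[OF xhI xI] sums(3)]]])
    have lim_yh: "(\<lambda>n. yh n - y n) \<longlonglongrightarrow> 0"
      by (rule control_g[OF yhI yI by' summable_LIMSEQ_zero[OF summableI_nonneg_bounded[OF nn_g[OF yhI yI] sums(4)]]])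
    have \<gamma>': "\<gamma> n \<in> {\<epsilon>..\<sigma>}" and \<mu>': "\<mu> n \<in> {\<delta>..\<sigma>}" for n using \<gamma> \<mu> by auto
    have rng: "range x \<subseteq> interior (edom h)" "range (\<lambda>n. blinfun_apply L (x n)) \<subseteq> interior (edom j)"
      "range a \<subseteq> interior (edom h)" "range b \<subseteq> interior (edom j)"
      using xh' Lxj resolvents by auto
    note ba = resolvent_sequence_bounded[OF maximally_monotoneD(1)[OF A] hB \<epsilon> coercive_h \<gamma>' uch rng(1) bx bLy rng(3)
        step_a' resolvents(2)]
    have bny: "bounded (range (\<lambda>n. - y n))" using by' by (auto simp: bounded_iff)
    have b'_alt: "b' n = inverse (\<mu> n) *\<^sub>R (gradient j (blinfun_apply L (x n)) - gradient j (b n)) - - y n" for n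
      by (simp add: step_b')
    note bb = resolvent_sequence_bounded[OF maximally_monotoneD(1)[OF B] jB \<delta> coercive_j \<mu>' ucj rng(2) bLx bny rng(4)
        b'_alt resolvents(4)]
    have bP: "bounded (range (\<lambda>n. a' n + adjoint_op L (b' n)))"
    proof -
      obtain K1 K2 where K12: "\<And>n. norm (a' n) \<le> K1" "\<And>n. norm (b' n) \<le> K2"
        using ba(2) bb(2) by (auto simp: bounded_iff)
      have "norm (a' n + adjoint_op L (b' n)) \<le> K1 + K2 * norm L" for n
        using norm_triangle_ineq[of "a' n" "adjoint_op L (b' n)"] norm_adjoint_op[of L "b' n"]
          mult_right_mono[OF K12(2)[of n] norm_ge_zero[of L]] K12(1)[of n] by linarith
      then show ?thesis by (auto simp: bounded_iff)
    qed
    have bQ: "bounded (range (\<lambda>n. b n - blinfun_apply L (a n)))"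
      using bb(1) bounded_linear_image[OF ba(1) blinfun.bounded_linear_right[of L]]
      by (intro bounded_minus_comp) (simp_all add: image_image)
    \<comment> \<open>The decrease of the functional from \<open>w n\<close> to \<open>wh n\<close>.
      As \<open>wh n\<close> satisfies the inequality of \<open>H n\<close>, it bounds the violation
      at \<open>w n\<close>, and it tends to \<open>0\<close> because the coefficients are
      bounded.\<close>
    define e where "e n = blinfun_apply (a' n + adjoint_op L (b' n)) (x n - xh n)
      + blinfun_apply (y n - yh n) (b n - blinfun_apply L (a n))" for n
    have lim_x: "(\<lambda>n. x n - xh n) \<longlonglongrightarrow> 0" and lim_y: "(\<lambda>n. y n - yh n) \<longlonglongrightarrow> 0"
      using tendsto_minus[OF lim_xh] tendsto_minus[OF lim_yh] by simp_all
    have e0: "e \<longlonglongrightarrow> 0"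
      unfolding e_def
      using tendsto_add[OF blinfun_apply_tendsto_0(1)[OF bP lim_x] blinfun_apply_tendsto_0(2)[OF lim_y bQ]] by simp
    have "gh n + gj n \<le> e n" for n
    proof -
      have "blinfun_apply (?P n) (wh n) \<le> ?r n"
        using wh_n(1)[of n] by (simp add: H_eq kt_halfspace_def)
      moreover have "blinfun_apply (?P n) (w n) - blinfun_apply (?P n) (wh n) = e n"
        by (simp add: e_def w_def wh_def kt_functional_def blinfun.diff_right blinfun.diff_left)
      ultimately show ?thesis using gap[of n] by linarith
    qed
    then have ghe: "gh n \<le> e n" and gje: "gj n \<le> e n" for n
      using gh(1)[of n] gj(1)[of n] by (smt (verit))+
    note lim_a = resolvent_sequence_tendsto[OF hB controls(3) \<epsilon> \<gamma>' uch rng(1) bx rng(3) ba(1) ghe[unfolded gh_def] e0]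
    note lim_b = resolvent_sequence_tendsto[OF jB controls(4) \<delta> \<mu>' ucj rng(2) bLx rng(4) bb(1) gje[unfolded gj_def] e0]
    obtain l where l: "\<And>\<phi> c. \<forall>\<^sub>F n in sequentially. blinfun_apply \<phi> (w n) \<le> (c :: real) \<Longrightarrow> blinfun_apply \<phi> l \<le> c"
      using weak_cluster_point_exists[OF refl bounded_w] by blast
    have "l \<in> kt_halfspace L c \<phi> d \<psi>" if \<phi>: "\<phi> \<in> A c" and \<psi>: "\<psi> \<in> B d" for c \<phi> d \<psi>
    proof -
      let ?Q = "kt_functional L c \<phi> d \<psi>" and ?s = "blinfun_apply \<phi> c + blinfun_apply \<psi> d"
      \<comment> \<open>Left over when the graph points under test are compared with
        \<open>(a n, a' n)\<close> and \<open>(b n, b' n)\<close> instead of the iterate; each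
        product has one bounded and one vanishing factor.\<close>
      define t where "t n = blinfun_apply (\<phi> - a' n) (x n - a n) + blinfun_apply (a' n + adjoint_op L (y n)) (x n - c)
        + (blinfun_apply (\<psi> - b' n) (blinfun_apply L (x n) - b n) + blinfun_apply (b' n - y n) (blinfun_apply L (x n) - d))" for n
      have le: "blinfun_apply ?Q (w n) \<le> ?s + t n" for n
      proof -
        have "blinfun_apply ?Q (w n) - ?s = blinfun_apply (\<phi> + adjoint_op L (y n)) (x n - c)
            + blinfun_apply (\<psi> - y n) (blinfun_apply L (x n) - d)"
          unfolding w_def by (rule kt_functional_gap)
        also have "\<dots> = t n - blinfun_apply (a' n - \<phi>) (a n - c) - blinfun_apply (b' n - \<psi>) (b n - d)"
          by (simp add: t_def blinfun.add_left blinfun.diff_left blinfun.diff_right)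
        also have "\<dots> \<le> t n"
          using monotone_opD[OF maximally_monotoneD(1)[OF A] resolvents(2)[of n] \<phi>]
            monotone_opD[OF maximally_monotoneD(1)[OF B] resolvents(4)[of n] \<psi>] by linarith
        finally show ?thesis by simp
      qed
      have "t \<longlonglongrightarrow> 0"
      proof -
        have "bounded (range (\<lambda>n. \<phi> - a' n))" "bounded (range (\<lambda>n. \<psi> - b' n))"
          "bounded (range (\<lambda>n. x n - c))" "bounded (range (\<lambda>n. blinfun_apply L (x n) - d))"
          using ba(2) bb(2) bx bLx by (auto intro!: bounded_minus_comp)
        then have "t \<longlonglongrightarrow> (0 + 0) + (0 + 0)"
          unfolding t_def a'_eq b'_eq
          by (intro tendsto_add blinfun_apply_tendsto_0(1)[OF _ lim_a(1)] blinfun_apply_tendsto_0(2)[OF lim_a(2)]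
              blinfun_apply_tendsto_0(1)[OF _ lim_b(1)] blinfun_apply_tendsto_0(2)[OF lim_b(2)])
        then show ?thesis by simp
      qed
      \<comment> \<open>The cluster property transfers only eventual bounds by a constant, hence the
        detour through \<open>\<eta>\<close>.\<close>
      have "blinfun_apply ?Q l \<le> ?s + \<eta>" if "0 < \<eta>" for \<eta>
      proof (rule l)
        have "\<forall>\<^sub>F n in sequentially. t n < \<eta>" using \<open>t \<longlonglongrightarrow> 0\<close> that by (rule order_tendstoD)
        then show "\<forall>\<^sub>F n in sequentially. blinfun_apply ?Q (w n) \<le> ?s + \<eta>"
        proof eventually_elim
          case (elim n)
          then show ?case using le[of n] by linarith
        qed
      qed
      then have "blinfun_apply ?Q l \<le> ?s" by (rule field_le_epsilon)
      then show ?thesis by (simp add: kt_halfspace_def)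
    qed
    then have "l \<in> Z" unfolding Z_eq kuhn_tucker_set_eq[OF A B] by blast
    from D_zbar_tendsto_0[OF l this]
    have lim: "(\<lambda>n. rbregman f xbar (x n) + rbregman (conjugate g) ybar (y n)) \<longlonglongrightarrow> 0"
      unfolding zbar_eq w_def split[OF xbarI ybarI xI yI] .
    have "(\<lambda>n. rbregman f xbar (x n)) \<longlonglongrightarrow> 0" "(\<lambda>n. rbregman (conjugate g) ybar (y n)) \<longlonglongrightarrow> 0"
      using nn_f[OF xbarI xI] nn_g[OF ybarI yI] by (auto intro!: Lim_null_comparison[OF _ lim] always_eventually)
    then have lims: "(\<lambda>n. xbar - x n) \<longlonglongrightarrow> 0" "(\<lambda>n. ybar - y n) \<longlonglongrightarrow> 0"
      using control_f[of "\<lambda>_. xbar" x] control_g[of "\<lambda>_. ybar" y] xbarI ybarI xI yI bx by' by auto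
    then show ?thesis
      using tendsto_diff[OF tendsto_const[of xbar] lims(1)] tendsto_diff[OF tendsto_const[of ybar] lims(2)]
      by simp
  qed
  show ?thesis using part1 part2 part3 part4 by blast
qed

end
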